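(* Let $V$ be a simple vertex algebra of countable dimension, $G$ a finite automorphism group of $V$, $\sigma$ an element of the center of $G$, and $M$ an irreducible $\sigma$-twisted $V$-module that is $G$-stable (i.e. $M\cdot g\cong M$ for all $g\in G$). Let $\mathbb{C}^{\alpha_M}[G]$ be the associated twisted group algebra acting on $M$, $\Lambda_M$ the set of its irreducible characters, $W_\lambda$ the simple module with character $\lambda\in\Lambda_M$, and $M_\lambda=\mathrm{Hom}_{\mathbb{C}^{\alpha_M}[G]}(W_\lambda,M)$. Then the $\mathbb{C}^{\alpha_M}[G]\otimes V^G$-module decomposition $$M=\bigoplus_{\lambda\in\Lambda_M}W_\lambda\otimes M_\lambda$$ gives a dual pair $(\mathbb{C}^{\alpha_M}[G],V^G)$ on $M$, that is: (1) $M_\lambda$ is nonzero for any $\lambda\in\Lambda_M$. (2) Each $M_\lambda$ is an irreducible $V^G$-module. (3) $M_\lambda$ and $M_\mu$ are isomorphic $V^G$-modules if and only if $\lambda=\mu$.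
   Context: All vector spaces are over $\mathbb{C}$ and $\otimes=\otimes_{\mathbb{C}}$; $\delta(z)=\sum_{n\in\mathbb{Z}}z^n$ and binomials are expanded in nonnegative powers of the second variable. A vertex algebra is a vector space $V$ with a vector $\mathbf{1}\in V$ and a linear map $v\mapsto Y(v,z)=\sum_{n\in\mathbb{Z}}v_nz^{-n-1}\in(\mathrm{End}\,V)[[z,z^{-1}]]$ such that $u_nv=0$ for $n$ large, $Y(\mathbf{1},z)=\mathrm{Id}_V$, $Y(v,z)\mathbf{1}\in V[[z]]$ with constant term $v$, and the Jacobi identity holds: $$z_0^{-1}\delta\left(\tfrac{z_1-z_2}{z_0}\right)Y(u,z_1)Y(v,z_2)-z_0^{-1}\delta\left(\tfrac{z_2-z_1}{-z_0}\right)Y(v,z_2)Y(u,z_1)=z_2^{-1}\delta\left(\tfrac{z_1-z_0}{z_2}\right)Y(Y(u,z_0)v,z_2).$$ An automorphism is an invertible linear map $g$ of $V$ with $g\mathbf{1}=\mathbf{1}$ and $gY(u,z)g^{-1}=Y(gu,z)$ for all $u\in V$. $V^G=\{v\in V: gv=v\ \forall g\in G\}$, a vertex subalgebra. Let $\sigma$ have order $T$ and $V^r=\{v\in V:\sigma v=e^{-2\pi i r/T}v\}$, $0\le r\le T-1$. A $\sigma$-twisted $V$-module is a vector space $M$ with a linear map $v\mapsto Y_M(v,z)=\sum_{n\in\frac1T\mathbb{Z}}v_nz^{-n-1}$, $v_n\in\mathrm{End}\,M$, such that for $u\in V^r$, $v\in V$, $w\in M$: $Y_M(u,z)=\sum_{n\in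 \frac rT+\mathbb{Z}}u_nz^{-n-1}$; $u_lw=0$ for $l$ large; $Y_M(\mathbf{1},z)=\mathrm{Id}_M$; and $$z_0^{-1}\delta\left(\tfrac{z_1-z_2}{z_0}\right)Y_M(u,z_1)Y_M(v,z_2)-z_0^{-1}\delta\left(\tfrac{z_2-z_1}{-z_0}\right)Y_M(v,z_2)Y_M(u,z_1)=z_2^{-1}\left(\tfrac{z_1-z_0}{z_2}\right)^{-r/T}\delta\left(\tfrac{z_1-z_0}{z_2}\right)Y_M(Y(u,z_0)v,z_2).$$ For $\sigma=1$ this is the notion of a $V$-module. Submodules are subspaces stable under all $v_n$; isomorphisms are linear bijections commuting with all $v_n$; irreducible means nonzero with no proper nonzero submodule. $V$ is simple if irreducible as a module over itself. By restriction $M$ is a $V^G$-module. For $g\in G$, $M\cdot g$ is the $\sigma$-twisted module with underlying space $M$ and $Y_{M\cdot g}(v,z)=Y_M(gv,z)$. If $M$ is $G$-stable, fix for each $g\in G$ a linear isomorphism $\phi(g):M\to M$ with $\phi(g)Y_M(v,z)\phi(g)^{-1}=Y_M(gv,z)$ for all $v\in V$, with $\phi(1)=\mathrm{Id}_M$. By Schur's lemma $\phi(g)\phi(h)=\alpha_M(g,h)\phi(gh)$ with $\alpha_M(g,h)\in\mathbb{C}^*$, and $\alpha_M$ is a 2-cocycle. $\mathbb{C}^{\alpha_M}[G]=\bigoplus_{g\in G}\mathbb{C}\bar g$ with $\bar g\bar h=\alpha_M(g,h)\overline{gh}$ is a finite dimensional semisimple associative algebra, acting on $M$ by $\bar gm=\phi(g)m$;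 this action commutes with that of $V^G$. $M_\lambda$ is a $V^G$-module via $(v_nf)(w)=v_n(f(w))$, and $\bigoplus_\lambda W_\lambda\otimes M_\lambda$ is identified with $M$ via $w\otimes f\mapsto f(w)$, the algebra acting on the first factor and $V^G$ on the second. A $\mathbb{C}^{\alpha_M}[G]\otimes V^G$-module means a space that is a module for both with commuting actions. *)

theory Defs
  imports
    Complex_Main
    "HOL-Library.Function_Algebras"
    "HOL-Library.Groups_Big_Fun"
    "HOL-Library.Product_Plus"
    "HOL-Library.Countable_Set"
begin

text \<open>
  Complex vector spaces are subspaces ("carriers") of types equipped with a scalar
  multiplication satisfying \<^locale>\<open>vector_space\<close>. Function spaces carry the pointwise structure
  of \<^theory>\<open>HOL-Library.Function_Algebras\<close> and \<open>fscale\<close>.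
\<close>

section \<open>Linear algebra on carriers\<close>

definition fscale :: "(complex \<Rightarrow> 'b \<Rightarrow> 'b) \<Rightarrow> complex \<Rightarrow> ('a \<Rightarrow> 'b) \<Rightarrow> 'a \<Rightarrow> 'b"
  where "fscale s c f = (\<lambda>x. s c (f x))"

definition lin_on ::
  "(complex \<Rightarrow> 'a::ab_group_add \<Rightarrow> 'a) \<Rightarrow> 'a set \<Rightarrow> (complex \<Rightarrow> 'b::ab_group_add \<Rightarrow> 'b) \<Rightarrow> 'b set
    \<Rightarrow> ('a \<Rightarrow> 'b) \<Rightarrow> bool"
  where "lin_on s1 W1 s2 W2 f \<longleftrightarrow>
    (\<forall>x\<in>W1. f x \<in> W2) \<and> (\<forall>x\<in>W1. \<forall>y\<in>W1. f (x + y) = f x + f y) \<and>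
    (\<forall>c. \<forall>x\<in>W1. f (s1 c x) = s2 c (f x))"

definition bilin_on ::
  "(complex \<Rightarrow> 'a::ab_group_add \<Rightarrow> 'a) \<Rightarrow> 'a set \<Rightarrow> (complex \<Rightarrow> 'b::ab_group_add \<Rightarrow> 'b) \<Rightarrow> 'b set
    \<Rightarrow> (complex \<Rightarrow> 'c::ab_group_add \<Rightarrow> 'c) \<Rightarrow> 'c set \<Rightarrow> ('a \<Rightarrow> 'b \<Rightarrow> 'c) \<Rightarrow> bool"
  where "bilin_on s1 W1 s2 W2 s3 W3 B \<longleftrightarrow>
    (\<forall>x\<in>W1. lin_on s2 W2 s3 W3 (B x)) \<and> (\<forall>y\<in>W2. lin_on s1 W1 s3 W3 (\<lambda>x. B x y))"

definition countable_dim :: "(complex \<Rightarrow> 'a::ab_group_add \<Rightarrow> 'a) \<Rightarrow> 'a set \<Rightarrow> bool"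
  where "countable_dim s W \<longleftrightarrow>
    (\<exists>B. countable B \<and> \<not> module.dependent s B \<and> module.span s B = W)"

text \<open>Trace of an endomorphism of a finite-dimensional carrier (independent of the chosen basis).\<close>

definition trace_on :: "(complex \<Rightarrow> 'a::ab_group_add \<Rightarrow> 'a) \<Rightarrow> 'a set \<Rightarrow> ('a \<Rightarrow> 'a) \<Rightarrow> complex"
  where "trace_on s W f =
    (let B = (SOME B. \<not> module.dependent s B \<and> module.span s B = W)
     in \<Sum>b\<in>B. module.representation s B (f b) b)"

definition irreducible_under ::
  "(complex \<Rightarrow> 'a::ab_group_add \<Rightarrow> 'a) \<Rightarrow> 'a set \<Rightarrow> ('a \<Rightarrow> 'a) set \<Rightarrow> bool"
  where "irreducible_under s W Op \<longleftrightarrow>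
    W \<noteq> {0} \<and>
    (\<forall>N. module.subspace s N \<and> N \<subseteq> W \<and> (\<forall>a\<in>Op. a ` N \<subseteq> N) \<longrightarrow> N = {0} \<or> N = W)"


section \<open>Tensor products and direct sums\<close>

text \<open>
  Since bilinear forms separate the elements of a tensor product over a field, it can be realised
  inside the dual of the space of bilinear forms, \<open>x \<otimes> y\<close> being evaluation at \<open>(x, y)\<close>.
  Lemma \<open>tensor_universal\<close> below is the universal property.
\<close>

definition pure_tensor ::
  "(complex \<Rightarrow> 'a::ab_group_add \<Rightarrow> 'a) \<Rightarrow> 'a set \<Rightarrow> (complex \<Rightarrow> 'b::ab_group_add \<Rightarrow> 'b) \<Rightarrow> 'b set
    \<Rightarrow> 'a \<Rightarrow> 'b \<Rightarrow> ('a \<Rightarrow> 'b \<Rightarrow> complex) \<Rightarrow> complex"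
  where "pure_tensor s1 W1 s2 W2 x y =
    (\<lambda>\<beta>. if bilin_on s1 W1 s2 W2 (*) UNIV \<beta> then \<beta> x y else 0)"

definition tensor ::
  "(complex \<Rightarrow> 'a::ab_group_add \<Rightarrow> 'a) \<Rightarrow> 'a set \<Rightarrow> (complex \<Rightarrow> 'b::ab_group_add \<Rightarrow> 'b) \<Rightarrow> 'b set
    \<Rightarrow> (('a \<Rightarrow> 'b \<Rightarrow> complex) \<Rightarrow> complex) set"
  where "tensor s1 W1 s2 W2 =
    module.span (fscale (*)) {pure_tensor s1 W1 s2 W2 x y |x y. x \<in> W1 \<and> y \<in> W2}"

text \<open>The map \<open>a \<otimes> b\<close> for endomorphisms \<open>a\<close>, \<open>b\<close> of the two factors.\<close>

definition tensor_map ::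
  "(complex \<Rightarrow> 'a::ab_group_add \<Rightarrow> 'a) \<Rightarrow> 'a set \<Rightarrow> (complex \<Rightarrow> 'b::ab_group_add \<Rightarrow> 'b) \<Rightarrow> 'b set
    \<Rightarrow> ('a \<Rightarrow> 'a) \<Rightarrow> ('b \<Rightarrow> 'b)
    \<Rightarrow> (('a \<Rightarrow> 'b \<Rightarrow> complex) \<Rightarrow> complex) \<Rightarrow> ('a \<Rightarrow> 'b \<Rightarrow> complex) \<Rightarrow> complex"
  where "tensor_map s1 W1 s2 W2 a b t =
    (\<lambda>\<beta>. if bilin_on s1 W1 s2 W2 (*) UNIV \<beta> then t (\<lambda>x y. \<beta> (a x) (b y)) else 0)"

definition direct_sum :: "'i set \<Rightarrow> ('i \<Rightarrow> 'a::zero set) \<Rightarrow> ('i \<Rightarrow> 'a) set"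
  where "direct_sum I X =
    {t. finite {i. t i \<noteq> 0} \<and> (\<forall>i\<in>I. t i \<in> X i) \<and> (\<forall>i. i \<notin> I \<longrightarrow> t i = 0)}"

definition summand :: "'i \<Rightarrow> 'a::zero \<Rightarrow> 'i \<Rightarrow> 'a"
  where "summand i x = (\<lambda>j. if j = i then x else 0)"

lemma vector_space_fscale:
  assumes "vector_space s"
  shows "vector_space (fscale s)"
proof -
  interpret vector_space s by fact
  show ?thesis
    by unfold_locales
      (auto simp: fscale_def fun_eq_iff scale_right_distrib scale_left_distrib)
qed

lemma vector_space_times: "vector_space ((*) :: complex \<Rightarrow> complex \<Rightarrow> complex)"
  by unfold_locales (auto simp: algebra_simps)

lemma tensor_map_pure_tensor:
  assumes "lin_on s1 W1 s1 W1 a" "lin_on s2 W2 s2 W2 b"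
  shows "tensor_map s1 W1 s2 W2 a b (pure_tensor s1 W1 s2 W2 x y) =
    pure_tensor s1 W1 s2 W2 (a x) (b y)"
proof -
  have "bilin_on s1 W1 s2 W2 (*) UNIV (\<lambda>x y. \<beta> (a x) (b y))"
    if "bilin_on s1 W1 s2 W2 (*) UNIV \<beta>" for \<beta>
    using that assms unfolding bilin_on_def lin_on_def by simp
  then show ?thesis
    by (auto simp: tensor_map_def pure_tensor_def fun_eq_iff)
qed

lemma bilin_on_pure_tensor:
  fixes s1 :: "complex \<Rightarrow> 'a::ab_group_add \<Rightarrow> 'a" and s2 :: "complex \<Rightarrow> 'b::ab_group_add \<Rightarrow> 'b"
  shows "bilin_on s1 W1 s2 W2 (fscale (*)) (tensor s1 W1 s2 W2) (pure_tensor s1 W1 s2 W2)"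
proof -
  interpret t: vector_space "fscale (*) :: complex \<Rightarrow> (('a \<Rightarrow> 'b \<Rightarrow> complex) \<Rightarrow> complex) \<Rightarrow> _"
    by (intro vector_space_fscale vector_space_times)
  have "pure_tensor s1 W1 s2 W2 x y \<in> tensor s1 W1 s2 W2" if "x \<in> W1" "y \<in> W2" for x y
    unfolding tensor_def using that by (intro t.span_base) blast
  then show ?thesis
    unfolding bilin_on_def lin_on_def
    by (auto simp: pure_tensor_def fscale_def fun_eq_iff bilin_on_def lin_on_def)
qed

lemma tensor_universal:
  fixes s1 :: "complex \<Rightarrow> 'a::ab_group_add \<Rightarrow> 'a" and s2 :: "complex \<Rightarrow> 'b::ab_group_add \<Rightarrow> 'b"
    and s3 :: "complex \<Rightarrow> 'c::ab_group_add \<Rightarrow> 'c"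
  assumes s3: "vector_space s3" and B: "bilin_on s1 W1 s2 W2 s3 UNIV B"
  shows "\<exists>f. lin_on (fscale (*)) (tensor s1 W1 s2 W2) s3 UNIV f \<and>
    (\<forall>x\<in>W1. \<forall>y\<in>W2. f (pure_tensor s1 W1 s2 W2 x y) = B x y)"
proof -
  let ?p = "pure_tensor s1 W1 s2 W2"
  let ?S = "{?p x y |x y. x \<in> W1 \<and> y \<in> W2}"
  interpret t: vector_space "fscale (*) :: complex \<Rightarrow> (('a \<Rightarrow> 'b \<Rightarrow> complex) \<Rightarrow> complex) \<Rightarrow> _"
    by (intro vector_space_fscale vector_space_times)
  interpret c: vector_space "(*) :: complex \<Rightarrow> complex \<Rightarrow> complex"
    by (rule vector_space_times)
  interpret p: vector_space s3 by fact
  interpret tp: vector_space_pair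
    "fscale (*) :: complex \<Rightarrow> (('a \<Rightarrow> 'b \<Rightarrow> complex) \<Rightarrow> complex) \<Rightarrow> _" s3 ..
  interpret pc: vector_space_pair s3 "(*) :: complex \<Rightarrow> complex \<Rightarrow> complex" ..
  obtain D where D: "D \<subseteq> ?S" "t.independent D" "?S \<subseteq> t.span D"
    by (rule t.maximal_independent_subset)
  have "\<forall>d\<in>D. \<exists>xy. fst xy \<in> W1 \<and> snd xy \<in> W2 \<and> d = ?p (fst xy) (snd xy)"
    using D(1) by fastforce
  then obtain r where r: "\<And>d. d \<in> D \<Longrightarrow> fst (r d) \<in> W1 \<and> snd (r d) \<in> W2 \<and> d = ?p (fst (r d)) (snd (r d))"
    by metis
  define g where "g d = B (fst (r d)) (snd (r d))" for d
  define f where "f = tp.construct D g"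
  have lf: "Vector_Spaces.linear (fscale (*)) s3 f"
    unfolding f_def by (rule tp.linear_construct[OF D(2)])
  interpret f: Vector_Spaces.linear "fscale (*)" s3 f by (rule lf)
  have fd: "f d = g d" if "d \<in> D" for d
    unfolding f_def by (rule tp.construct_basis[OF D(2) that])
  have "f (?p x y) = B x y" if xy: "x \<in> W1" "y \<in> W2" for x y
  proof (rule ccontr)
    assume "f (?p x y) \<noteq> B x y"
    define e where "e = f (?p x y) - B x y"
    have e: "e \<noteq> 0" using \<open>f (?p x y) \<noteq> B x y\<close> by (simp add: e_def)
    define l where "l = pc.construct {e} (\<lambda>_. 1)"
    have "p.independent {e}" using e by simp
    then have ll: "Vector_Spaces.linear s3 (*) l" and le: "l e = 1"
      unfolding l_def by (rule pc.linear_construct, rule pc.construct_basis) auto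
    interpret l: Vector_Spaces.linear s3 "(*)" l by (rule ll)
    define \<beta> where "\<beta> x y = l (B x y)" for x y
    have \<beta>: "bilin_on s1 W1 s2 W2 (*) UNIV \<beta>"
      using B unfolding bilin_on_def lin_on_def \<beta>_def by (simp add: l.add l.scale)
    have "?p x y \<in> t.span D" using D(3) xy by blast
    then obtain A k where A: "finite A" "A \<subseteq> D" "?p x y = (\<Sum>d\<in>A. fscale (*) (k d) d)"
      unfolding t.span_explicit by auto
    have ev: "(\<Sum>d\<in>A. fscale (*) (k d) d) \<beta> = (\<Sum>d\<in>A. k d * d \<beta>)"
      using A(1) by (induction A) (auto simp: fscale_def)
    have "\<beta> x y = ?p x y \<beta>" using \<beta> by (simp add: pure_tensor_def)
    also have "\<dots> = (\<Sum>d\<in>A. k d * d \<beta>)" by (simp only: A(3) ev)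
    also have "\<dots> = (\<Sum>d\<in>A. k d * l (g d))"
    proof (rule sum.cong[OF refl])
      fix d assume "d \<in> A"
      then have "d = ?p (fst (r d)) (snd (r d))" using r A(2) by blast
      then have "d \<beta> = ?p (fst (r d)) (snd (r d)) \<beta>" by metis
      then show "k d * d \<beta> = k d * l (g d)" using \<beta> by (simp add: pure_tensor_def \<beta>_def g_def)
    qed
    also have "\<dots> = (\<Sum>d\<in>A. l (s3 (k d) (f d)))"
      using A(2) fd by (intro sum.cong) (auto simp: l.scale)
    also have "\<dots> = l (f (?p x y))"
      unfolding A(3) by (simp add: l.sum f.sum f.scale)
    finally have "l e = 0" by (simp add: e_def l.diff \<beta>_def)
    with le show False by simp
  qed
  moreover have "lin_on (fscale (*)) (tensor s1 W1 s2 W2) s3 UNIV f"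
    by (simp add: lin_on_def f.add f.scale)
  ultimately show ?thesis by blast
qed


section \<open>Formal calculus\<close>

text \<open>Coefficient of \<open>x\<^sup>p y\<^sup>q\<close> in \<open>(x - y)\<^sup>s\<close>, expanded in nonnegative powers of \<open>y\<close>.\<close>

definition binomial_coeff :: "rat \<Rightarrow> rat \<Rightarrow> rat \<Rightarrow> complex"
  where "binomial_coeff s p q =
    (if q \<in> \<nat> \<and> p + q = s
     then (-1) ^ nat \<lfloor>q\<rfloor> * (of_rat s gchoose nat \<lfloor>q\<rfloor>) else 0)"

text \<open>
  Coefficient of \<open>x\<^sup>p y\<^sup>q z\<^sup>r\<close> in
  \<open>z\<^sup>-\<^sup>1 ((x - y) / z)\<^sup>k \<delta>((x - y) / z) = (\<Sum>s \<in> k + \<int>. (x - y)\<^sup>s z\<^sup>-\<^sup>s\<^sup>-\<^sup>1)\<close>.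
\<close>

definition delta_coeff :: "rat \<Rightarrow> rat \<Rightarrow> rat \<Rightarrow> rat \<Rightarrow> complex"
  where "delta_coeff k p q r =
    (if - r - 1 - k \<in> \<int> then binomial_coeff (- r - 1) p q else 0)"

text \<open>
  A formal series in \<open>z\<^sub>0, z\<^sub>1, z\<^sub>2\<close> is the function sending \<open>(a, b, c)\<close> to the coefficient of
  \<open>z\<^sub>0\<^sup>a z\<^sub>1\<^sup>b z\<^sub>2\<^sup>c\<close>. In the products below the truncation axioms make the defining sums finite;
  an infinite sum would be \<open>0\<close> by convention of \<^const>\<open>Sum_any\<close>.
\<close>

definition series_mult ::
  "(complex \<Rightarrow> 'm::ab_group_add \<Rightarrow> 'm) \<Rightarrow> (rat \<times> rat \<times> rat \<Rightarrow> complex) \<Rightarrow> (rat \<times> rat \<times> rat \<Rightarrow> 'm)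
    \<Rightarrow> rat \<times> rat \<times> rat \<Rightarrow> 'm"
  where "series_mult s K F = (\<lambda>e. Sum_any (\<lambda>d. s (K d) (F (e - d))))"

text \<open>
  The Jacobi identity applied to \<open>w\<close>. The modes are \<open>YV u n = u\<^sub>n\<close> on the algebra and
  \<open>YM u n = u\<^sub>n\<close> on the module, so that the coefficient of \<open>z\<^sup>e\<close> in \<open>Y\<^sub>M(u, z)\<close> is
  \<open>YM u (- e - 1)\<close>; \<open>k\<close> is \<open>r/T\<close>. In the second term
  \<open>\<delta>((z\<^sub>2 - z\<^sub>1) / (- z\<^sub>0))\<close> differs from \<open>\<delta>((z\<^sub>2 - z\<^sub>1) / z\<^sub>0)\<close> by \<open>(-1)\<^sup>n\<close> in the term
  of exponent \<open>n = - a - 1\<close>, where \<open>a\<close> is the exponent of \<open>z\<^sub>0\<close> after multiplication by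
  \<open>z\<^sub>0\<^sup>-\<^sup>1\<close>.
\<close>

definition jacobi_identity ::
  "(complex \<Rightarrow> 'm::ab_group_add \<Rightarrow> 'm) \<Rightarrow> ('v \<Rightarrow> rat \<Rightarrow> 'v \<Rightarrow> 'v) \<Rightarrow> ('v \<Rightarrow> rat \<Rightarrow> 'm \<Rightarrow> 'm)
    \<Rightarrow> rat \<Rightarrow> 'v \<Rightarrow> 'v \<Rightarrow> 'm \<Rightarrow> bool"
  where "jacobi_identity s YV YM k u v w \<longleftrightarrow>
    (\<forall>e.
      series_mult s (\<lambda>(a, b, c). delta_coeff 0 b c a)
        (\<lambda>(a, b, c). if a = 0 then YM u (- b - 1) (YM v (- c - 1) w) else 0) e
    - series_mult s (\<lambda>(a, b, c). (-1) powi (- \<lfloor>a\<rfloor> - 1) * delta_coeff 0 c b a)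
        (\<lambda>(a, b, c). if a = 0 then YM v (- c - 1) (YM u (- b - 1) w) else 0) e
    = series_mult s (\<lambda>(a, b, c). delta_coeff (- k) b a c)
        (\<lambda>(a, b, c). if b = 0 then YM (YV u (- a - 1) v) (- c - 1) w else 0) e)"

text \<open>Integer-indexed modes, viewed as rational-indexed modes vanishing off \<open>\<int>\<close>.\<close>

definition rat_modes :: "('v \<Rightarrow> int \<Rightarrow> 'm \<Rightarrow> 'm::zero) \<Rightarrow> 'v \<Rightarrow> rat \<Rightarrow> 'm \<Rightarrow> 'm"
  where "rat_modes Y v q w = (if q \<in> \<int> then Y v \<lfloor>q\<rfloor> w else 0)"


section \<open>Vertex algebras, automorphisms and twisted modules\<close>

locale vertex_algebra = vector_space sV
  for sV :: "complex \<Rightarrow> 'v::ab_group_add \<Rightarrow> 'v" +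
  fixes U :: "'v set" and vac :: 'v and Y :: "'v \<Rightarrow> int \<Rightarrow> 'v \<Rightarrow> 'v"
  assumes subspace_U: "subspace U"
    and vac_in: "vac \<in> U"
    and Y_bilinear: "bilin_on sV U sV U sV U (\<lambda>u. Y u n)"
    and Y_truncated: "\<lbrakk>u \<in> U; v \<in> U\<rbrakk> \<Longrightarrow> \<exists>N. \<forall>n\<ge>N. Y u n v = 0"
    and Y_vac: "v \<in> U \<Longrightarrow> Y vac n v = (if n = -1 then v else 0)"
    and creation: "v \<in> U \<Longrightarrow> Y v (-1) vac = v" "\<lbrakk>v \<in> U; n \<ge> 0\<rbrakk> \<Longrightarrow> Y v n vac = 0"
    and jacobi: "\<lbrakk>u \<in> U; v \<in> U; w \<in> U\<rbrakk> \<Longrightarrow>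
      jacobi_identity sV (rat_modes Y) (rat_modes Y) 0 u v w"

definition va_automorphism ::
  "(complex \<Rightarrow> 'v::ab_group_add \<Rightarrow> 'v) \<Rightarrow> 'v set \<Rightarrow> 'v \<Rightarrow> ('v \<Rightarrow> int \<Rightarrow> 'v \<Rightarrow> 'v) \<Rightarrow> ('v \<Rightarrow> 'v) \<Rightarrow> bool"
  where "va_automorphism sV U vac Y g \<longleftrightarrow>
    lin_on sV U sV U g \<and> bij_betw g U U \<and> g vac = vac \<and>
    (\<forall>u\<in>U. \<forall>n. \<forall>v\<in>U. g (Y u n v) = Y (g u) n (g v))"

definition finite_automorphism_group ::
  "(complex \<Rightarrow> 'v::ab_group_add \<Rightarrow> 'v) \<Rightarrow> 'v \<Rightarrow> ('v \<Rightarrow> int \<Rightarrow> 'v \<Rightarrow> 'v) \<Rightarrow> ('v \<Rightarrow> 'v) set \<Rightarrow> bool"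
  where "finite_automorphism_group sV vac Y G \<longleftrightarrow>
    finite G \<and> (\<forall>g\<in>G. va_automorphism sV UNIV vac Y g) \<and>
    id \<in> G \<and> (\<forall>g\<in>G. \<forall>h\<in>G. g \<circ> h \<in> G) \<and> (\<forall>g\<in>G. inv g \<in> G)"

definition fixed_points :: "('v \<Rightarrow> 'v) set \<Rightarrow> 'v set"
  where "fixed_points G = {v. \<forall>g\<in>G. g v = v}"

definition aut_order :: "'v set \<Rightarrow> ('v \<Rightarrow> 'v) \<Rightarrow> nat"
  where "aut_order U \<sigma> = (LEAST n. 0 < n \<and> (\<forall>v\<in>U. (\<sigma> ^^ n) v = v))"

definition sigma_eigenspace ::
  "(complex \<Rightarrow> 'v \<Rightarrow> 'v) \<Rightarrow> 'v set \<Rightarrow> ('v \<Rightarrow> 'v) \<Rightarrow> nat \<Rightarrow> 'v set"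
  where "sigma_eigenspace sV U \<sigma> r =
    {v \<in> U. \<sigma> v = sV (exp (- (2 * of_real pi * \<i> * of_nat r / of_nat (aut_order U \<sigma>)))) v}"

locale twisted_module = vertex_algebra sV U vac Y + M: vector_space sM
  for sV :: "complex \<Rightarrow> 'v::ab_group_add \<Rightarrow> 'v" and U vac Y
    and \<sigma> :: "'v \<Rightarrow> 'v"
    and sM :: "complex \<Rightarrow> 'm::ab_group_add \<Rightarrow> 'm" and W :: "'m set"
    and YM :: "'v \<Rightarrow> rat \<Rightarrow> 'm \<Rightarrow> 'm" +
  assumes automorphism: "va_automorphism sV U vac Y \<sigma>"
    and finite_order: "\<exists>n>0. \<forall>v\<in>U. (\<sigma> ^^ n) v = v"
    and subspace_W: "M.subspace W"
    and YM_bilinear: "bilin_on sV U sM W sM W (\<lambda>v. YM v n)"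
    and modes: "\<lbrakk>v \<in> U; w \<in> W; of_nat (aut_order U \<sigma>) * n \<notin> \<int>\<rbrakk> \<Longrightarrow> YM v n w = 0"
    and modes_eigen: "\<lbrakk>r < aut_order U \<sigma>; u \<in> sigma_eigenspace sV U \<sigma> r; w \<in> W;
      n - of_nat r / of_nat (aut_order U \<sigma>) \<notin> \<int>\<rbrakk> \<Longrightarrow> YM u n w = 0"
    and YM_truncated: "\<lbrakk>r < aut_order U \<sigma>; u \<in> sigma_eigenspace sV U \<sigma> r; w \<in> W\<rbrakk> \<Longrightarrow>
      \<exists>N. \<forall>l\<ge>N. YM u l w = 0"
    and YM_vac: "w \<in> W \<Longrightarrow> YM vac n w = (if n = -1 then w else 0)"
    and twisted_jacobi: "\<lbrakk>r < aut_order U \<sigma>; u \<in> sigma_eigenspace sV U \<sigma> r; v \<in> U; w \<in> W\<rbrakk> \<Longrightarrow>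
      jacobi_identity sM (rat_modes Y) YM (of_nat r / of_nat (aut_order U \<sigma>)) u v w"

abbreviation va_module ::
  "(complex \<Rightarrow> 'v::ab_group_add \<Rightarrow> 'v) \<Rightarrow> 'v set \<Rightarrow> 'v \<Rightarrow> ('v \<Rightarrow> int \<Rightarrow> 'v \<Rightarrow> 'v)
    \<Rightarrow> (complex \<Rightarrow> 'm::ab_group_add \<Rightarrow> 'm) \<Rightarrow> 'm set \<Rightarrow> ('v \<Rightarrow> rat \<Rightarrow> 'm \<Rightarrow> 'm) \<Rightarrow> bool"
  where "va_module sV U vac Y \<equiv> twisted_module sV U vac Y id"

definition va_modes :: "'v set \<Rightarrow> ('v \<Rightarrow> 'i \<Rightarrow> 'm \<Rightarrow> 'm) \<Rightarrow> ('m \<Rightarrow> 'm) set"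
  where "va_modes U YM = {YM v n |v n. v \<in> U}"

definition simple_vertex_algebra ::
  "(complex \<Rightarrow> 'v::ab_group_add \<Rightarrow> 'v) \<Rightarrow> 'v set \<Rightarrow> 'v \<Rightarrow> ('v \<Rightarrow> int \<Rightarrow> 'v \<Rightarrow> 'v) \<Rightarrow> bool"
  where "simple_vertex_algebra sV U vac Y \<longleftrightarrow>
    vertex_algebra sV U vac Y \<and> irreducible_under sV U (va_modes U Y)"

definition irreducible_twisted_module ::
  "(complex \<Rightarrow> 'v::ab_group_add \<Rightarrow> 'v) \<Rightarrow> 'v set \<Rightarrow> 'v \<Rightarrow> ('v \<Rightarrow> int \<Rightarrow> 'v \<Rightarrow> 'v) \<Rightarrow> ('v \<Rightarrow> 'v)
    \<Rightarrow> (complex \<Rightarrow> 'm::ab_group_add \<Rightarrow> 'm) \<Rightarrow> 'm set \<Rightarrow> ('v \<Rightarrow> rat \<Rightarrow> 'm \<Rightarrow> 'm) \<Rightarrow> bool"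
  where "irreducible_twisted_module sV U vac Y \<sigma> sM W YM \<longleftrightarrow>
    twisted_module sV U vac Y \<sigma> sM W YM \<and> irreducible_under sM W (va_modes U YM)"

abbreviation irreducible_va_module ::
  "(complex \<Rightarrow> 'v::ab_group_add \<Rightarrow> 'v) \<Rightarrow> 'v set \<Rightarrow> 'v \<Rightarrow> ('v \<Rightarrow> int \<Rightarrow> 'v \<Rightarrow> 'v)
    \<Rightarrow> (complex \<Rightarrow> 'm::ab_group_add \<Rightarrow> 'm) \<Rightarrow> 'm set \<Rightarrow> ('v \<Rightarrow> rat \<Rightarrow> 'm \<Rightarrow> 'm) \<Rightarrow> bool"
  where "irreducible_va_module sV U vac Y \<equiv> irreducible_twisted_module sV U vac Y id"

definition module_isomorphic ::
  "'v set \<Rightarrow> (complex \<Rightarrow> 'm::ab_group_add \<Rightarrow> 'm) \<Rightarrow> 'm set \<Rightarrow> ('v \<Rightarrow> rat \<Rightarrow> 'm \<Rightarrow> 'm)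
    \<Rightarrow> (complex \<Rightarrow> 'n::ab_group_add \<Rightarrow> 'n) \<Rightarrow> 'n set \<Rightarrow> ('v \<Rightarrow> rat \<Rightarrow> 'n \<Rightarrow> 'n) \<Rightarrow> bool"
  where "module_isomorphic U s1 W1 Y1 s2 W2 Y2 \<longleftrightarrow>
    (\<exists>f. lin_on s1 W1 s2 W2 f \<and> bij_betw f W1 W2 \<and>
      (\<forall>v\<in>U. \<forall>n. \<forall>w\<in>W1. f (Y1 v n w) = Y2 v n (f w)))"

text \<open>\<open>M \<cdot> g\<close>\<close>

definition conj_modes :: "('v \<Rightarrow> rat \<Rightarrow> 'm \<Rightarrow> 'm) \<Rightarrow> ('v \<Rightarrow> 'v) \<Rightarrow> 'v \<Rightarrow> rat \<Rightarrow> 'm \<Rightarrow> 'm"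
  where "conj_modes YM g v n = YM (g v) n"

definition G_stable ::
  "(complex \<Rightarrow> 'm::ab_group_add \<Rightarrow> 'm) \<Rightarrow> ('v \<Rightarrow> rat \<Rightarrow> 'm \<Rightarrow> 'm) \<Rightarrow> ('v \<Rightarrow> 'v) set \<Rightarrow> bool"
  where "G_stable sM YM G \<longleftrightarrow>
    (\<forall>g\<in>G. module_isomorphic UNIV sM UNIV (conj_modes YM g) sM UNIV YM)"


section \<open>The twisted group algebra\<close>

text \<open>The choice of isomorphisms \<open>\<phi>(g)\<close>, and the cocycle it determines (well defined by Schur's lemma).\<close>

definition stabilizing_isos ::
  "(complex \<Rightarrow> 'm::ab_group_add \<Rightarrow> 'm) \<Rightarrow> ('v \<Rightarrow> rat \<Rightarrow> 'm \<Rightarrow> 'm) \<Rightarrow> ('v \<Rightarrow> 'v) set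
    \<Rightarrow> (('v \<Rightarrow> 'v) \<Rightarrow> 'm \<Rightarrow> 'm) \<Rightarrow> bool"
  where "stabilizing_isos sM YM G \<phi> \<longleftrightarrow>
    \<phi> id = id \<and>
    (\<forall>g\<in>G. lin_on sM UNIV sM UNIV (\<phi> g) \<and> bij (\<phi> g) \<and>
      (\<forall>v n. \<phi> g \<circ> YM v n \<circ> inv (\<phi> g) = YM (g v) n))"

definition schur_cocycle ::
  "(complex \<Rightarrow> 'm \<Rightarrow> 'm) \<Rightarrow> (('v \<Rightarrow> 'v) \<Rightarrow> 'm \<Rightarrow> 'm) \<Rightarrow> ('v \<Rightarrow> 'v) \<Rightarrow> ('v \<Rightarrow> 'v) \<Rightarrow> complex"
  where "schur_cocycle sM \<phi> g h = (THE c. \<forall>m. \<phi> g (\<phi> h m) = sM c (\<phi> (g \<circ> h) m))"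

text \<open>An element \<open>\<Sum>g\<in>G. a g \<cdot> g\<close> of the twisted group algebra is the function \<open>a\<close>, supported on \<open>G\<close>.\<close>

type_synonym 'v tga = "('v \<Rightarrow> 'v) \<Rightarrow> complex"

definition tga_carrier :: "('v \<Rightarrow> 'v) set \<Rightarrow> 'v tga set"
  where "tga_carrier G = {a. \<forall>g. g \<notin> G \<longrightarrow> a g = 0}"

definition tga_basis :: "('v \<Rightarrow> 'v) \<Rightarrow> 'v tga"
  where "tga_basis g = (\<lambda>h. if h = g then 1 else 0)"

definition tga_mult ::
  "('v \<Rightarrow> 'v) set \<Rightarrow> (('v \<Rightarrow> 'v) \<Rightarrow> ('v \<Rightarrow> 'v) \<Rightarrow> complex) \<Rightarrow> 'v tga \<Rightarrow> 'v tga \<Rightarrow> 'v tga"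
  where "tga_mult G \<alpha> a b =
    (\<lambda>k. \<Sum>(g, h) \<in> {(g, h). g \<in> G \<and> h \<in> G \<and> g \<circ> h = k}. a g * b h * \<alpha> g h)"

locale tga_module = vector_space s
  for G :: "('v \<Rightarrow> 'v) set" and \<alpha> :: "('v \<Rightarrow> 'v) \<Rightarrow> ('v \<Rightarrow> 'v) \<Rightarrow> complex"
    and s :: "complex \<Rightarrow> 'w::ab_group_add \<Rightarrow> 'w" and W :: "'w set" and \<rho> :: "'v tga \<Rightarrow> 'w \<Rightarrow> 'w" +
  assumes subspace_W: "subspace W"
    and action_bilinear: "bilin_on (fscale (*)) (tga_carrier G) s W s W \<rho>"
    and action_one: "w \<in> W \<Longrightarrow> \<rho> (tga_basis id) w = w"
    and action_mult: "\<lbrakk>a \<in> tga_carrier G; b \<in> tga_carrier G; w \<in> W\<rbrakk> \<Longrightarrow>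
      \<rho> (tga_mult G \<alpha> a b) w = \<rho> a (\<rho> b w)"

definition simple_tga_module ::
  "('v \<Rightarrow> 'v) set \<Rightarrow> (('v \<Rightarrow> 'v) \<Rightarrow> ('v \<Rightarrow> 'v) \<Rightarrow> complex)
    \<Rightarrow> (complex \<Rightarrow> 'w::ab_group_add \<Rightarrow> 'w) \<Rightarrow> 'w set \<Rightarrow> ('v tga \<Rightarrow> 'w \<Rightarrow> 'w) \<Rightarrow> bool"
  where "simple_tga_module G \<alpha> s W \<rho> \<longleftrightarrow>
    tga_module G \<alpha> s W \<rho> \<and> irreducible_under s W (\<rho> ` tga_carrier G)"

definition tga_character ::
  "('v \<Rightarrow> 'v) set \<Rightarrow> (complex \<Rightarrow> 'w::ab_group_add \<Rightarrow> 'w) \<Rightarrow> 'w set \<Rightarrow> ('v tga \<Rightarrow> 'w \<Rightarrow> 'w)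
    \<Rightarrow> 'v tga \<Rightarrow> complex"
  where "tga_character G s W \<rho> =
    (\<lambda>a. if a \<in> tga_carrier G then trace_on s W (\<rho> a) else 0)"

text \<open>
  Simple modules of the (finite-dimensional) twisted group algebra are finite-dimensional, hence all
  of them are, up to isomorphism, carried by subspaces of \<open>nat \<Rightarrow> complex\<close>.
\<close>

definition irreducible_characters ::
  "('v \<Rightarrow> 'v) set \<Rightarrow> (('v \<Rightarrow> 'v) \<Rightarrow> ('v \<Rightarrow> 'v) \<Rightarrow> complex) \<Rightarrow> ('v tga \<Rightarrow> complex) set"
  where "irreducible_characters G \<alpha> =
    {tga_character G (fscale (*)) W \<rho> |(W :: (nat \<Rightarrow> complex) set) \<rho>.
      simple_tga_module G \<alpha> (fscale (*)) W \<rho>}"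

definition tga_action ::
  "('v \<Rightarrow> 'v) set \<Rightarrow> (complex \<Rightarrow> 'm::ab_group_add \<Rightarrow> 'm) \<Rightarrow> (('v \<Rightarrow> 'v) \<Rightarrow> 'm \<Rightarrow> 'm)
    \<Rightarrow> 'v tga \<Rightarrow> 'm \<Rightarrow> 'm"
  where "tga_action G sM \<phi> a m = (\<Sum>g\<in>G. sM (a g) (\<phi> g m))"

text \<open>Homomorphisms out of a carrier are extended by \<open>0\<close>, so that they form a subspace of \<open>'w \<Rightarrow> 'm\<close>.\<close>

definition tga_hom ::
  "('v \<Rightarrow> 'v) set \<Rightarrow> (complex \<Rightarrow> 'w::ab_group_add \<Rightarrow> 'w) \<Rightarrow> 'w set \<Rightarrow> ('v tga \<Rightarrow> 'w \<Rightarrow> 'w)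
    \<Rightarrow> (complex \<Rightarrow> 'm::ab_group_add \<Rightarrow> 'm) \<Rightarrow> 'm set \<Rightarrow> ('v tga \<Rightarrow> 'm \<Rightarrow> 'm) \<Rightarrow> ('w \<Rightarrow> 'm) set"
  where "tga_hom G s1 W1 \<rho>1 s2 W2 \<rho>2 =
    {f. lin_on s1 W1 s2 W2 f \<and> (\<forall>x. x \<notin> W1 \<longrightarrow> f x = 0) \<and>
      (\<forall>a\<in>tga_carrier G. \<forall>x\<in>W1. f (\<rho>1 a x) = \<rho>2 a (f x))}"

definition hom_modes :: "('v \<Rightarrow> rat \<Rightarrow> 'm \<Rightarrow> 'm) \<Rightarrow> 'v \<Rightarrow> rat \<Rightarrow> ('w \<Rightarrow> 'm) \<Rightarrow> 'w \<Rightarrow> 'm"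
  where "hom_modes YM v n f = (\<lambda>w. YM v n (f w))"

definition tga_va_module ::
  "('v::ab_group_add \<Rightarrow> 'v) set \<Rightarrow> (('v \<Rightarrow> 'v) \<Rightarrow> ('v \<Rightarrow> 'v) \<Rightarrow> complex)
    \<Rightarrow> (complex \<Rightarrow> 'v \<Rightarrow> 'v) \<Rightarrow> 'v set \<Rightarrow> 'v \<Rightarrow> ('v \<Rightarrow> int \<Rightarrow> 'v \<Rightarrow> 'v)
    \<Rightarrow> (complex \<Rightarrow> 'm::ab_group_add \<Rightarrow> 'm) \<Rightarrow> 'm set \<Rightarrow> ('v tga \<Rightarrow> 'm \<Rightarrow> 'm) \<Rightarrow> ('v \<Rightarrow> rat \<Rightarrow> 'm \<Rightarrow> 'm) \<Rightarrow> bool"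
  where "tga_va_module G \<alpha> sV U vac Y sM W \<rho> YM \<longleftrightarrow>
    tga_module G \<alpha> sM W \<rho> \<and> va_module sV U vac Y sM W YM \<and>
    (\<forall>a\<in>tga_carrier G. \<forall>v\<in>U. \<forall>n. \<forall>w\<in>W. \<rho> a (YM v n w) = YM v n (\<rho> a w))"

definition tga_va_isomorphism ::
  "('v \<Rightarrow> 'v) set \<Rightarrow> 'v set
    \<Rightarrow> (complex \<Rightarrow> 'm::ab_group_add \<Rightarrow> 'm) \<Rightarrow> 'm set \<Rightarrow> ('v tga \<Rightarrow> 'm \<Rightarrow> 'm) \<Rightarrow> ('v \<Rightarrow> rat \<Rightarrow> 'm \<Rightarrow> 'm)
    \<Rightarrow> (complex \<Rightarrow> 'n::ab_group_add \<Rightarrow> 'n) \<Rightarrow> 'n set \<Rightarrow> ('v tga \<Rightarrow> 'n \<Rightarrow> 'n) \<Rightarrow> ('v \<Rightarrow> rat \<Rightarrow> 'n \<Rightarrow> 'n)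
    \<Rightarrow> ('m \<Rightarrow> 'n) \<Rightarrow> bool"
  where "tga_va_isomorphism G U s1 W1 \<rho>1 Y1 s2 W2 \<rho>2 Y2 f \<longleftrightarrow>
    lin_on s1 W1 s2 W2 f \<and> bij_betw f W1 W2 \<and>
    (\<forall>a\<in>tga_carrier G. \<forall>w\<in>W1. f (\<rho>1 a w) = \<rho>2 a (f w)) \<and>
    (\<forall>v\<in>U. \<forall>n. \<forall>w\<in>W1. f (Y1 v n w) = Y2 v n (f w))"

text \<open>
  The two actions on \<open>\<Oplus>\<^sub>\<lambda> W\<^sub>\<lambda> \<otimes> M\<^sub>\<lambda>\<close>: the algebra acts on the first tensor factors, the
  vertex algebra on the second ones.
\<close>

definition sum_tga_action ::
  "(complex \<Rightarrow> 'w::ab_group_add \<Rightarrow> 'w) \<Rightarrow> ('i \<Rightarrow> 'w set) \<Rightarrow> ('i \<Rightarrow> 'v tga \<Rightarrow> 'w \<Rightarrow> 'w)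
    \<Rightarrow> (complex \<Rightarrow> 'n::ab_group_add \<Rightarrow> 'n) \<Rightarrow> ('i \<Rightarrow> 'n set)
    \<Rightarrow> 'v tga \<Rightarrow> ('i \<Rightarrow> ('w \<Rightarrow> 'n \<Rightarrow> complex) \<Rightarrow> complex) \<Rightarrow> 'i \<Rightarrow> ('w \<Rightarrow> 'n \<Rightarrow> complex) \<Rightarrow> complex"
  where "sum_tga_action s1 W \<rho> s2 N a t = (\<lambda>i. tensor_map s1 (W i) s2 (N i) (\<rho> i a) id (t i))"

definition sum_modes ::
  "(complex \<Rightarrow> 'w::ab_group_add \<Rightarrow> 'w) \<Rightarrow> ('i \<Rightarrow> 'w set)
    \<Rightarrow> (complex \<Rightarrow> 'n::ab_group_add \<Rightarrow> 'n) \<Rightarrow> ('i \<Rightarrow> 'n set) \<Rightarrow> ('v \<Rightarrow> rat \<Rightarrow> 'n \<Rightarrow> 'n)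
    \<Rightarrow> 'v \<Rightarrow> rat \<Rightarrow> ('i \<Rightarrow> ('w \<Rightarrow> 'n \<Rightarrow> complex) \<Rightarrow> complex) \<Rightarrow> 'i \<Rightarrow> ('w \<Rightarrow> 'n \<Rightarrow> complex) \<Rightarrow> complex"
  where "sum_modes s1 W s2 N YN v n t = (\<lambda>i. tensor_map s1 (W i) s2 (N i) id (YN v n) (t i))"

end

theory Submission
  imports Defs
    "HOL-Analysis.Continuum_Not_Denumerable"
    "HOL-Computational_Algebra.Fundamental_Theorem_Algebra"
begin

text \<open>
  The span of the modes \<open>v\<^sub>n\<close> is not closed under composition, but by the Jacobi identity every product
  \<open>u\<^sub>m v\<^sub>n\<close> agrees on a given finite set of vectors with a sum of single modes. Together with Schur's
  lemma in countable dimension, Jacobson's density argument then shows that sums of single modes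
  realise every linear map on finite-dimensional subspaces of \<open>M\<close>. Conjugation by \<open>\<phi>(g)\<close> sends
  \<open>v\<^sub>n\<close> to \<open>(g v)\<^sub>n\<close>, so averaging over \<open>G\<close> turns a sum of single modes of \<open>V\<close> into one of
  \<open>V\<^sup>G\<close>: the latter realise every map that commutes with the twisted group algebra on
  finite-dimensional submodules. This gives (2) and (3).

  For (1), density of the modes on the simple algebra \<open>V\<close> shows that \<open>V \<otimes> M \<rightarrow> M{z}\<close> is injective,
  whence the operators \<open>\<phi>(g)\<close> are linearly independent and Maschke averaging of rank-one maps
  \<open>W\<^sub>\<lambda> \<rightarrow> M\<close> produces a nonzero homomorphism. The decomposition itself is the usual
  representation theory of projective representations.
\<close>

section \<open>Linear maps on carriers\<close>

text \<open>The index from which the modes of a vector kill \<open>w\<close> varies with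
  \<open>w\<close>, so a product of modes can be rewritten as a sum of single modes only on finitely
  many vectors at once. The density argument tolerates this, because each of its steps looks only at
  a finite independent set and one further vector. The simple modules being finite-dimensional, a
  homomorphism from \<open>W \<chi>\<close> to \<open>M\<close> is determined by finitely many
  values and fits into this frame. What makes (2) and (3) work is that nonzero homomorphisms from
  different \<open>W \<chi>\<close> carry bases of the \<open>W \<chi>\<close> to one jointly
  independent family. Images of that family can thus be prescribed by modes of \<open>V\<close>.
  When the prescribed images come from homomorphisms as well, averaging over \<open>G\<close>
  changes them only by the factor \<open>card G\<close>. Independence of the operators
  \<open>\<phi> g\<close> is needed for (1) because it says that the twisted group algebra acts
  faithfully: only then does every simple module occur in \<open>M\<close>.\<close>

lemma lin_on_mem: "lin_on s1 W1 s2 W2 f \<Longrightarrow> x \<in> W1 \<Longrightarrow> f x \<in> W2"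
  and lin_on_add: "lin_on s1 W1 s2 W2 f \<Longrightarrow> x \<in> W1 \<Longrightarrow> y \<in> W1 \<Longrightarrow> f (x + y) = f x + f y"
  and lin_on_scale: "lin_on s1 W1 s2 W2 f \<Longrightarrow> x \<in> W1 \<Longrightarrow> f (s1 c x) = s2 c (f x)"
  by (auto simp: lin_on_def)

lemma lin_onI:
  assumes "\<And>x. x \<in> W1 \<Longrightarrow> f x \<in> W2" "\<And>x y. x \<in> W1 \<Longrightarrow> y \<in> W1 \<Longrightarrow> f (x + y) = f x + f y"
    "\<And>c x. x \<in> W1 \<Longrightarrow> f (s1 c x) = s2 c (f x)"
  shows "lin_on s1 W1 s2 W2 f"
  using assms by (auto simp: lin_on_def)

lemma lin_on_zero:
  fixes f :: "'a::ab_group_add \<Rightarrow> 'b::ab_group_add"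
  assumes "lin_on s1 W1 s2 W2 f" "0 \<in> W1"
  shows "f 0 = 0"
  using lin_on_add[OF assms(1), of 0 0] assms(2) by simp

lemma lin_on_diff:
  assumes "vector_space s1" "vector_space s2" "lin_on s1 W1 s2 W2 f" "module.subspace s1 W1"
    "x \<in> W1" "y \<in> W1"
  shows "f (x - y) = f x - f y"
proof -
  interpret s1: vector_space s1 by fact
  interpret s2: vector_space s2 by fact
  have "x - y = x + s1 (-1) y" by simp
  then have "f (x - y) = f x + s2 (-1) (f y)"
    using lin_on_add[OF assms(3,5) s1.subspace_scale[OF assms(4,6)]] lin_on_scale[OF assms(3,6)] by metis
  then show ?thesis by simp
qed

lemma lin_on_sum:
  fixes f :: "'a::ab_group_add \<Rightarrow> 'b::ab_group_add"
  assumes "vector_space s1" "lin_on s1 W1 s2 W2 f" "module.subspace s1 W1"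
    "\<And>i. i \<in> I \<Longrightarrow> g i \<in> W1"
  shows "f (\<Sum>i\<in>I. g i) = (\<Sum>i\<in>I. f (g i))"
proof -
  interpret s1: vector_space s1 by fact
  show ?thesis
    using assms(4)
  proof (induction I rule: infinite_finite_induct)
    case (insert i I)
    then show ?case
      by (simp add: lin_on_add[OF assms(2)] s1.subspace_sum[OF assms(3)])
  qed (simp_all add: lin_on_zero[OF assms(2) s1.subspace_0[OF assms(3)]])
qed

lemma lin_on_compose:
  "lin_on s1 W1 s2 W2 f \<Longrightarrow> lin_on s2 W2 s3 W3 g \<Longrightarrow> lin_on s1 W1 s3 W3 (\<lambda>x. g (f x))"
  by (auto simp: lin_on_def)

lemma lin_on_subspace_image:
  assumes "vector_space s1" "vector_space s2" "lin_on s1 W1 s2 W2 f" "module.subspace s1 W1"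
  shows "module.subspace s2 (f ` W1)"
proof -
  interpret s1: vector_space s1 by fact
  interpret s2: vector_space s2 by fact
  show ?thesis
  proof (rule s2.subspaceI)
    show "0 \<in> f ` W1"
      using lin_on_zero[OF assms(3)] s1.subspace_0[OF assms(4)] by (metis imageI)
  next
    fix x y assume "x \<in> f ` W1" "y \<in> f ` W1"
    then show "x + y \<in> f ` W1"
      using lin_on_add[OF assms(3)] s1.subspace_add[OF assms(4)] by (metis (no_types, lifting) image_iff)
  next
    fix c x assume "x \<in> f ` W1"
    then show "s2 c x \<in> f ` W1"
      using lin_on_scale[OF assms(3)] s1.subspace_scale[OF assms(4)] by (metis (no_types, lifting) image_iff)
  qed
qed

lemma lin_on_subspace_preimage:
  assumes "vector_space s1" "vector_space s2" "lin_on s1 W1 s2 W2 f" "module.subspace s1 W1"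
    "module.subspace s2 X"
  shows "module.subspace s1 {x \<in> W1. f x \<in> X}"
proof -
  interpret s1: vector_space s1 by fact
  interpret s2: vector_space s2 by fact
  show ?thesis
    using assms(4,5) by (intro s1.subspaceI)
      (auto simp: lin_on_zero[OF assms(3)] lin_on_add[OF assms(3)] lin_on_scale[OF assms(3)]
        s1.subspace_0 s1.subspace_add s1.subspace_scale s2.subspace_0 s2.subspace_add s2.subspace_scale)
qed

lemma lin_on_inj_iff:
  assumes "vector_space s1" "vector_space s2" "lin_on s1 W1 s2 W2 f" "module.subspace s1 W1"
  shows "inj_on f W1 \<longleftrightarrow> (\<forall>x\<in>W1. f x = 0 \<longrightarrow> x = 0)"
proof -
  interpret s1: vector_space s1 by fact
  show ?thesis
  proof
    assume "inj_on f W1"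
    then show "\<forall>x\<in>W1. f x = 0 \<longrightarrow> x = 0"
      using lin_on_zero[OF assms(3)] s1.subspace_0[OF assms(4)] by (metis inj_onD)
  next
    assume *: "\<forall>x\<in>W1. f x = 0 \<longrightarrow> x = 0"
    show "inj_on f W1"
    proof (rule inj_onI)
      fix x y assume xy: "x \<in> W1" "y \<in> W1" "f x = f y"
      then have "f (x - y) = 0" using lin_on_diff[OF assms] by simp
      then show "x = y" using * xy s1.subspace_diff[OF assms(4)] by fastforce
    qed
  qed
qed

lemma lin_on_inverse:
  assumes "vector_space s1" "vector_space s2" "lin_on s1 W1 s2 W2 f" "module.subspace s1 W1"
    "bij_betw f W1 W2"
  shows "lin_on s2 W2 s1 W1 (the_inv_into W1 f)"
proof -
  interpret s1: vector_space s1 by fact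
  have inj: "inj_on f W1" and im: "f ` W1 = W2"
    using assms(5) by (auto simp: bij_betw_def)
  have mem: "the_inv_into W1 f y \<in> W1" if "y \<in> W2" for y
    using the_inv_into_into[OF inj] that im by blast
  have ff: "f (the_inv_into W1 f y) = y" if "y \<in> W2" for y
    using f_the_inv_into_f[OF inj] that im by blast
  show ?thesis
  proof (rule lin_onI)
    fix x y assume xy: "x \<in> W2" "y \<in> W2"
    have "f (the_inv_into W1 f x + the_inv_into W1 f y) = x + y"
      using xy by (simp add: lin_on_add[OF assms(3)] mem ff)
    then show "the_inv_into W1 f (x + y) = the_inv_into W1 f x + the_inv_into W1 f y"
      using xy by (intro the_inv_into_f_eq[OF inj]) (auto intro: s1.subspace_add[OF assms(4)] mem)
  next
    fix c x assume x: "x \<in> W2"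
    have "f (s1 c (the_inv_into W1 f x)) = s2 c x"
      using x by (simp add: lin_on_scale[OF assms(3)] mem ff)
    then show "the_inv_into W1 f (s2 c x) = s1 c (the_inv_into W1 f x)"
      using x by (intro the_inv_into_f_eq[OF inj]) (auto intro: s1.subspace_scale[OF assms(4)] mem)
  qed (use mem in auto)
qed

lemma lin_on_eq_on_span:
  assumes "vector_space s1" "vector_space s2" "lin_on s1 W1 s2 W2 f" "lin_on s1 W1 s2 W2 g"
    "module.subspace s1 W1" "B \<subseteq> W1" "\<And>b. b \<in> B \<Longrightarrow> f b = g b" "x \<in> module.span s1 B"
  shows "f x = g x"
proof -
  interpret s1: vector_space s1 by fact
  interpret s2: vector_space s2 by fact
  have "s1.span B \<subseteq> {x \<in> W1. f x = g x}"
  proof (rule s1.span_minimal)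
    show "s1.subspace {x \<in> W1. f x = g x}"
      using assms(5) by (intro s1.subspaceI)
        (auto simp: lin_on_zero[OF assms(3)] lin_on_add[OF assms(3)] lin_on_scale[OF assms(3)]
          lin_on_zero[OF assms(4)] lin_on_add[OF assms(4)] lin_on_scale[OF assms(4)]
        s1.subspace_0 s1.subspace_add s1.subspace_scale)
  qed (use assms in auto)
  then show ?thesis using assms(8) by auto
qed

lemma lin_on_linear:
  assumes "vector_space s1" "vector_space s2"
  shows "lin_on s1 UNIV s2 UNIV f \<longleftrightarrow> Vector_Spaces.linear s1 s2 f"
  using assms by (auto simp: lin_on_def Vector_Spaces.linear_iff)

section \<open>Schur's lemma in countable dimension\<close>

text \<open>Both operator families are indexed by one set \<open>I\<close>, since intertwining needs
  the operators on the two sides to be paired. Kernel and image are stable; the witness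
  \<open>x\<close> excludes a kernel equal to \<open>W1\<close> and an image equal to 0.\<close>

lemma schur_bij:
  assumes "vector_space s1" "vector_space s2" "module.subspace s1 W1" "module.subspace s2 W2"
    and irr: "irreducible_under s1 W1 (A1 ` I)" "irreducible_under s2 W2 (A2 ` I)"
    and lin: "\<And>i. i \<in> I \<Longrightarrow> lin_on s1 W1 s1 W1 (A1 i)" "\<And>i. i \<in> I \<Longrightarrow> lin_on s2 W2 s2 W2 (A2 i)"
    and f: "lin_on s1 W1 s2 W2 f" "\<And>i x. i \<in> I \<Longrightarrow> x \<in> W1 \<Longrightarrow> f (A1 i x) = A2 i (f x)"
    and x: "x \<in> W1" "f x \<noteq> 0"
  shows "bij_betw f W1 W2"
proof -
  interpret s1: vector_space s1 by fact
  interpret s2: vector_space s2 by fact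
  have "{x \<in> W1. f x \<in> {0}} = {0} \<or> {x \<in> W1. f x \<in> {0}} = W1"
  proof (rule irr(1)[unfolded irreducible_under_def, THEN conjunct2, rule_format], intro conjI ballI)
    show "s1.subspace {x \<in> W1. f x \<in> {0}}"
      by (rule lin_on_subspace_preimage[OF assms(1,2) f(1) assms(3)]) simp
    fix a assume "a \<in> A1 ` I"
    then show "a ` {x \<in> W1. f x \<in> {0}} \<subseteq> {x \<in> W1. f x \<in> {0}}"
      using f(2) lin lin_on_zero[OF lin(2) s2.subspace_0[OF assms(4)]] by (auto simp: lin_on_def)
  qed auto
  with x have "inj_on f W1"
    unfolding lin_on_inj_iff[OF assms(1,2) f(1) assms(3)] by blast
  moreover have "f ` W1 = {0} \<or> f ` W1 = W2"
  proof (rule irr(2)[unfolded irreducible_under_def, THEN conjunct2, rule_format], intro conjI ballI)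
    show "s2.subspace (f ` W1)"
      by (rule lin_on_subspace_image[OF assms(1,2) f(1) assms(3)])
    show "f ` W1 \<subseteq> W2" using f(1) by (auto simp: lin_on_def)
    fix a assume "a \<in> A2 ` I"
    then show "a ` f ` W1 \<subseteq> f ` W1"
      using f(2) lin(1) by (auto simp: lin_on_def) (metis imageI)
  qed
  ultimately show ?thesis using x by (auto simp: bij_betw_def)
qed

text \<open>A finite part of \<open>C\<close> spans a finite-dimensional space, which meets
  \<open>B\<close> in a finite set; countably many such parts exhaust the span of
  \<open>C\<close>.\<close>

lemma (in vector_space) countable_independent:
  assumes "independent B" "B \<subseteq> span C" "countable C"
  shows "countable B"
proof -
  let ?\<F> = "{F. F \<subseteq> C \<and> finite F}"
  have "B \<subseteq> (\<Union>F\<in>?\<F>. B \<inter> span F)"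
  proof
    fix b assume "b \<in> B"
    with assms(2) have "b \<in> span C" by blast
    then obtain t r where "finite t" "t \<subseteq> C" "b = (\<Sum>a\<in>t. scale (r a) a)"
      unfolding span_explicit by blast
    then have "b \<in> span t" by (auto intro: span_sum span_scale span_base)
    with \<open>b \<in> B\<close> \<open>finite t\<close> \<open>t \<subseteq> C\<close> show "b \<in> (\<Union>F\<in>?\<F>. B \<inter> span F)" by blast
  qed
  moreover have "countable (B \<inter> span F)" if "F \<in> ?\<F>" for F
    using that independent_span_bound[of F "B \<inter> span F"] independent_mono[OF assms(1)]
    by (auto intro: countable_finite)
  moreover have "countable ?\<F>"
    using countable_Collect_finite_subset[OF assms(3)] by (simp add: conj_commute)
  ultimately show ?thesis by (meson countable_UN countable_subset)
qed

section \<open>Polynomials in one operator and the existence of an eigenvalue\<close>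

locale operator_poly = vector_space s for s :: "complex \<Rightarrow> 'a::ab_group_add \<Rightarrow> 'a" +
  fixes W T
  assumes W: "subspace W" and T: "lin_on s W s W T"
begin

text \<open>This is \<open>p(T) x\<close>, computed by Horner's scheme. As \<open>T\<close> is
  linear only on \<open>W\<close>, most laws below ask for \<open>x \<in> W\<close>.\<close>

definition poly_app :: "complex poly \<Rightarrow> 'a \<Rightarrow> 'a"
  where "poly_app p x = fold_coeffs (\<lambda>a y. s a x + T y) p 0"

lemma T_zero: "T 0 = 0"
  by (rule lin_on_zero[OF T subspace_0[OF W]])

lemma poly_app_0 [simp]: "poly_app 0 x = 0"
  by (simp add: poly_app_def)

lemma poly_app_pCons [simp]: "poly_app (pCons a p) x = s a x + T (poly_app p x)"
  by (cases "p = 0 \<and> a = 0") (auto simp: poly_app_def T_zero)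

lemma poly_app_mem: "x \<in> W \<Longrightarrow> poly_app p x \<in> W"
  by (induction p) (auto intro!: subspace_0[OF W] subspace_add[OF W] subspace_scale[OF W] lin_on_mem[OF T])

lemma poly_app_add: "x \<in> W \<Longrightarrow> poly_app (p + q) x = poly_app p x + poly_app q x"
proof (induction p arbitrary: q)
  case (pCons a p)
  obtain b q' where q: "q = pCons b q'" by (cases q)
  show ?case
    by (simp add: q pCons lin_on_add[OF T] poly_app_mem scale_left_distrib add_ac)
qed simp

lemma poly_app_smult: "x \<in> W \<Longrightarrow> poly_app (smult c p) x = s c (poly_app p x)"
  by (induction p) (auto simp: lin_on_scale[OF T] poly_app_mem scale_right_distrib)

lemma poly_app_sum: "x \<in> W \<Longrightarrow> poly_app (\<Sum>i\<in>I. p i) x = (\<Sum>i\<in>I. poly_app (p i) x)"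
  by (induction I rule: infinite_finite_induct) (auto simp: poly_app_add)

lemma lin_on_poly_app: "lin_on s W s W (poly_app p)"
proof (rule lin_onI)
  fix x y assume "x \<in> W" "y \<in> W"
  then show "poly_app p (x + y) = poly_app p x + poly_app p y"
    by (induction p) (auto simp: lin_on_add[OF T] poly_app_mem scale_right_distrib add_ac)
next
  fix c x assume "x \<in> W"
  then show "poly_app p (s c x) = s c (poly_app p x)"
    by (induction p) (auto simp: lin_on_scale[OF T] poly_app_mem scale_right_distrib mult.commute)
qed (rule poly_app_mem)

lemma poly_app_T: "x \<in> W \<Longrightarrow> poly_app p (T x) = T (poly_app p x)"
  by (induction p)
    (auto simp: T_zero lin_on_add[OF T] lin_on_scale[OF T] lin_on_mem[OF T] poly_app_mem subspace_scale[OF W])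

lemma poly_app_linear_factor:
  assumes "x \<in> W"
  shows "poly_app ([:-l, 1:] * p) x = T (poly_app p x) - s l (poly_app p x)"
  using assms by (simp add: poly_app_add[of x "smult (-l) p"] poly_app_smult del: smult_minus_left)

lemma poly_app_linear_factor':
  assumes "x \<in> W"
  shows "poly_app ([:-l, 1:] * p) x = poly_app p (T x - s l x)"
  using assms
  by (simp add: poly_app_linear_factor lin_on_diff[OF vector_space_axioms vector_space_axioms lin_on_poly_app W]
      lin_on_mem[OF T] subspace_scale[OF W] poly_app_T lin_on_scale[OF lin_on_poly_app] del: mult_pCons_left)

text \<open>Over the complex numbers \<open>p\<close> splits, so \<open>p(T)\<close> is a nonzero
  scalar times a product of operators \<open>T - l\<close>, each injective on \<open>W\<close> by
  assumption.\<close>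

lemma poly_app_nonzero:
  assumes inj: "\<And>l x. x \<in> W \<Longrightarrow> x \<noteq> 0 \<Longrightarrow> T x \<noteq> s l x"
    and x: "x \<in> W" "x \<noteq> 0"
  shows "p \<noteq> 0 \<Longrightarrow> poly_app p x \<noteq> 0"
proof (induction "degree p" arbitrary: p)
  case 0
  then obtain a where "p = [:a:]" by (metis degree_eq_zeroE)
  with 0 x show ?case by (simp add: T_zero)
next
  case (Suc n)
  then have "\<not> constant (poly p)"
    by (simp add: constant_degree)
  then obtain l where "poly p l = 0" using fundamental_theorem_of_algebra by blast
  then obtain q where q: "p = [:-l, 1:] * q" by (auto simp: poly_eq_0_iff_dvd dvd_def)
  then have "q \<noteq> 0" "degree q = n" using Suc by (auto simp del: mult_pCons_left simp: degree_mult_eq)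
  then have "poly_app q x \<noteq> 0" using Suc by blast
  then show ?case
    using inj[OF poly_app_mem[OF x(1)]] by (simp add: q poly_app_linear_factor[OF x(1)] del: mult_pCons_left)
qed

text \<open>Dixmier's argument: otherwise the vectors \<open>(T - l)\<^sup>-\<^sup>1 x\<close> would be uncountably many
  independent ones.\<close>

lemma eigenvector_exists:
  assumes C: "countable C" "W \<subseteq> span C"
    and bij: "\<And>l. (\<exists>x\<in>W. T x \<noteq> s l x) \<Longrightarrow> bij_betw (\<lambda>x. T x - s l x) W W"
    and W0: "W \<noteq> {0}"
  shows "\<exists>l. \<forall>x\<in>W. T x = s l x"
proof (rule ccontr)
  assume "\<not> ?thesis"
  then have bij: "bij_betw (\<lambda>x. T x - s l x) W W" for l using bij by blast
  obtain m where m: "m \<in> W" "m \<noteq> 0" using W0 subspace_0[OF W] by blast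
  \<comment> \<open>The vectors \<open>x l\<close> chosen from this are the resolvents of
    \<open>T\<close> at \<open>l\<close>, applied to one fixed nonzero \<open>m\<close>.\<close>
  have "\<exists>x\<in>W. T x - s l x = m" for l
  proof -
    have "m \<in> (\<lambda>x. T x - s l x) ` W" using bij[of l] m(1) by (simp add: bij_betw_def)
    then show ?thesis by auto
  qed
  then obtain x where x: "\<And>l. x l \<in> W" "\<And>l. T (x l) - s l (x l) = m" by metis
  have ne: "T y \<noteq> s l y" if "y \<in> W" "y \<noteq> 0" for y l
  proof
    assume "T y = s l y"
    then have "(\<lambda>x. T x - s l x) y = (\<lambda>x. T x - s l x) 0" by (simp add: T_zero)
    then show False using bij[of l] that subspace_0[OF W] by (auto simp: bij_betw_def inj_on_def)
  qed
  have inj: "inj x"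
  proof (rule injI)
    fix l k assume eq: "x l = x k"
    have "T (x k) - s l (x k) = T (x k) - s k (x k)" using x(2)[of l] x(2)[of k] eq by metis
    then have "s (l - k) (x l) = 0" using eq by (simp add: scale_left_diff_distrib)
    moreover have "x l \<noteq> 0" using x(2)[of l] m T_zero by auto
    ultimately show "l = k" by simp
  qed
  have "\<not> independent (range x)"
    using countable_independent[of "range x" C] x(1) C uncountable_UNIV_complex countable_image_inj_eq[OF inj]
    by blast
  then obtain t u where t: "finite t" "t \<subseteq> range x" "(\<Sum>v\<in>t. s (u v) v) = 0" "\<exists>v\<in>t. u v \<noteq> 0"
    by (auto simp: dependent_explicit)
  then obtain L where L: "t = x ` L" by (auto simp: subset_image_iff)
  have finL: "finite L" using t(1) L inj by (metis finite_imageD inj_on_subset subset_UNIV)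
  define c where "c l = u (x l)" for l
  have sum0: "(\<Sum>l\<in>L. s (c l) (x l)) = 0"
    using t(3) unfolding L c_def by (simp add: sum.reindex inj_on_subset[OF inj])
  obtain k where k: "k \<in> L" "c k \<noteq> 0" using t(4) L by (auto simp: c_def)
  define q where "q l = (\<Prod>j\<in>L - {l}. [:-j, 1:])" for l :: complex
  define P where "P = (\<Prod>j\<in>L. [:-j, 1:])"
  have P: "P = [:-l, 1:] * q l" if "l \<in> L" for l
    unfolding P_def q_def using prod.remove[OF finL that, of "\<lambda>j. [:-j, 1:]"] by simp
  \<comment> \<open>\<open>Q\<close> is the numerator of the partial fraction sum of the
    \<open>c l / (X - l)\<close> over the common denominator \<open>P\<close>. The relation between
    the resolvents makes \<open>Q(T)\<close> kill \<open>m\<close>, hence \<open>Q = 0\<close>; but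
    the value of \<open>Q\<close> at \<open>k\<close> is \<open>c k\<close> times a product of
    nonzero differences.\<close>
  define Q where "Q = (\<Sum>l\<in>L. smult (c l) (q l))"
  have "poly_app Q m = (\<Sum>l\<in>L. s (c l) (poly_app (q l) m))"
    using m by (simp add: Q_def poly_app_sum poly_app_smult)
  also have "\<dots> = (\<Sum>l\<in>L. poly_app P (s (c l) (x l)))"
    using x by (intro sum.cong)
      (auto simp: P poly_app_linear_factor' lin_on_scale[OF lin_on_poly_app] simp del: mult_pCons_left)
  also have "\<dots> = poly_app P (\<Sum>l\<in>L. s (c l) (x l))"
    using x by (intro lin_on_sum[OF vector_space_axioms lin_on_poly_app W, symmetric]) (auto intro: subspace_scale[OF W])
  also have "\<dots> = 0"
    unfolding sum0 by (rule lin_on_zero[OF lin_on_poly_app subspace_0[OF W]])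
  finally have "Q = 0" using poly_app_nonzero[of m Q] ne m by blast
  then have "0 = poly Q k" by simp
  also have "\<dots> = (\<Sum>l\<in>L. c l * poly (q l) k)" by (simp add: Q_def poly_sum)
  also have "\<dots> = (\<Sum>l\<in>L. if l = k then c k * poly (q k) k else 0)"
  proof (rule sum.cong)
    fix l assume l: "l \<in> L"
    show "c l * poly (q l) k = (if l = k then c k * poly (q k) k else 0)"
    proof (cases "l = k")
      case False
      then have "poly (q l) k = 0" using k finL by (auto simp: q_def poly_prod)
      with False show ?thesis by simp
    qed simp
  qed simp
  also have "\<dots> = c k * poly (q k) k" using k finL by simp
  finally have "poly (q k) k = 0" using k by simp
  then show False using finL by (auto simp: q_def poly_prod)
qed

end

text \<open>\<open>T - l\<close> commutes with \<open>Op\<close>, so it is zero or bijective on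
  \<open>W\<close>; the resolvent argument shows that it cannot be bijective for every
  \<open>l\<close>.\<close>

theorem schur_scalar:
  assumes "vector_space s" "module.subspace s W" "irreducible_under s W Op"
    and lin: "\<And>a. a \<in> Op \<Longrightarrow> lin_on s W s W a"
    and C: "countable C" "W \<subseteq> module.span s C"
    and lT: "lin_on s W s W T" and cT: "\<And>a x. a \<in> Op \<Longrightarrow> x \<in> W \<Longrightarrow> T (a x) = a (T x)"
  shows "\<exists>c. \<forall>x\<in>W. T x = s c x"
proof -
  interpret operator_poly s W T
    using assms by (simp add: operator_poly_def operator_poly_axioms_def)
  have "lin_on s W s W (\<lambda>x. T x - s l x)" for l
    by (rule lin_onI) (auto simp: lin_on_add[OF lT] lin_on_scale[OF lT] scale_right_distrib
        scale_right_diff_distrib algebra_simps intro!: subspace_diff[OF W] subspace_scale[OF W] lin_on_mem[OF lT])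
  moreover have "T (a x) - s l (a x) = a (T x - s l x)" if "a \<in> Op" "x \<in> W" for a l x
    using that cT lin_on_diff[OF assms(1,1) lin[OF that(1)] W] lin_on_scale[OF lin[OF that(1)]]
    by (simp add: lin_on_mem[OF lT] subspace_scale[OF W])
  ultimately have "bij_betw (\<lambda>x. T x - s l x) W W" if "\<exists>x\<in>W. T x \<noteq> s l x" for l
    using that assms(3) lin by (auto intro!: schur_bij[OF assms(1,1) W W, of "\<lambda>a. a" Op "\<lambda>a. a"])
  moreover have "W \<noteq> {0}" using assms(3) by (simp add: irreducible_under_def)
  ultimately show ?thesis using eigenvector_exists C by blast
qed

section \<open>Density\<close>

text \<open>Jacobson's density theorem for a set \<open>A\<close> that need not be closed under
  composition: \<open>mult\<close> provides a substitute for a product on a finite set only. The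
  induction over \<open>B\<close> asks for nothing more, as it compares operators on
  \<open>insert w B\<close>. The hypothesis \<open>schur\<close> says that the commutant consists of
  scalars.\<close>

theorem density:
  fixes s :: "complex \<Rightarrow> 'a::ab_group_add \<Rightarrow> 'a"
  assumes vs: "vector_space s"
    and lin: "\<And>a. a \<in> A \<Longrightarrow> lin_on s UNIV s UNIV a"
    and add: "\<And>a b. a \<in> A \<Longrightarrow> b \<in> A \<Longrightarrow> (\<lambda>x. a x + b x) \<in> A"
    and scl: "\<And>c a. a \<in> A \<Longrightarrow> (\<lambda>x. s c (a x)) \<in> A"
    and one: "(\<lambda>x. x) \<in> A"
    and mult: "\<And>a b F. a \<in> A \<Longrightarrow> b \<in> A \<Longrightarrow> finite F \<Longrightarrow> \<exists>c\<in>A. \<forall>x\<in>F. c x = a (b x)"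
    and irr: "\<And>N. module.subspace s N \<Longrightarrow> (\<And>a. a \<in> A \<Longrightarrow> a ` N \<subseteq> N) \<Longrightarrow> N = {0} \<or> N = UNIV"
    and schur: "\<And>T. lin_on s UNIV s UNIV T \<Longrightarrow> (\<And>a x. a \<in> A \<Longrightarrow> T (a x) = a (T x)) \<Longrightarrow>
      \<exists>c. \<forall>x. T x = s c x"
    and B: "finite B" "\<not> module.dependent s B"
  shows "\<exists>a\<in>A. \<forall>b\<in>B. a b = t b"
proof -
  interpret vector_space s by fact
  from B show ?thesis
  proof (induction B arbitrary: t rule: finite_induct)
    case empty
    show ?case using one by blast
  next
    case (insert w B)
    then have indB: "independent B" and w: "w \<notin> span B"
      by (auto simp: independent_insert)
    have IH: "\<exists>a\<in>A. \<forall>b\<in>B. a b = t b" for t using insert.IH[OF indB] .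
    have zero: "(\<lambda>x. 0) \<in> A" using scl[OF one, of 0] by simp
    have z0: "a 0 = 0" if "a \<in> A" for a using lin_on_zero[OF lin[OF that]] by simp
    \<comment> \<open>\<open>N\<close> collects the values at \<open>w\<close> of the operators that
      vanish on \<open>B\<close>. It is stable, so either these operators can correct the value at
      \<open>w\<close> arbitrarily, or all of them vanish at \<open>w\<close>.\<close>
    define K where "K = {a \<in> A. \<forall>b\<in>B. a b = 0}"
    define N where "N = (\<lambda>a. a w) ` K"
    have "N = {0} \<or> N = UNIV"
    proof (rule irr)
      show "subspace N"
      proof (rule subspaceI)
        show "0 \<in> N" unfolding N_def K_def using zero by force
      next
        fix x y assume "x \<in> N" "y \<in> N"
        then obtain a b where "a \<in> K" "b \<in> K" "x = a w" "y = b w" by (auto simp: N_def)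
        then show "x + y \<in> N"
          unfolding N_def K_def using add[of a b] by (intro image_eqI[of _ _ "\<lambda>x. a x + b x"]) auto
      next
        fix c :: complex and x assume "x \<in> N"
        then obtain a where "a \<in> K" "x = a w" by (auto simp: N_def)
        then show "s c x \<in> N"
          unfolding N_def K_def using scl[of a c] by (intro image_eqI[of _ _ "\<lambda>x. s c (a x)"]) auto
      qed
    next
      fix c assume c: "c \<in> A"
      show "c ` N \<subseteq> N"
      proof
        fix y assume "y \<in> c ` N"
        then obtain a where a: "a \<in> K" "y = c (a w)" by (auto simp: N_def)
        then obtain d where d: "d \<in> A" "\<forall>x\<in>insert w B. d x = c (a x)"
          using mult[OF c, of a "insert w B"] insert.hyps(1) by (auto simp: K_def)
        then have "d \<in> K" using a z0[OF c] by (auto simp: K_def)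
        then show "y \<in> N" using d(2) a(2) by (auto simp: N_def intro!: image_eqI[of _ _ d])
      qed
    qed
    then show ?case
    proof
      assume U: "N = UNIV"
      obtain a where a: "a \<in> A" "\<forall>b\<in>B. a b = t b" using IH by blast
      have "t w - a w \<in> N" using U by simp
      then obtain k where k: "k \<in> K" "t w - a w = k w" by (auto simp: N_def)
      then have "\<forall>b\<in>insert w B. a b + k b = t b" using a(2) by (auto simp: K_def algebra_simps)
      moreover have "(\<lambda>x. a x + k x) \<in> A" using add a(1) k(1) by (auto simp: K_def)
      ultimately show ?thesis by (metis (no_types, lifting))
    next
      assume N0: "N = {0}"
      \<comment> \<open>In this case the value of an operator at \<open>w\<close> is forced by its
        values on \<open>B\<close>.\<close>
      have uniq: "a w = a' w" if "a \<in> A" "a' \<in> A" "\<forall>b\<in>B. a b = a' b" for a a'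
      proof -
        have "(\<lambda>x. a x + s (-1) (a' x)) \<in> K"
          using that add[OF that(1) scl[OF that(2), of "-1"]] by (auto simp: K_def)
        then have "a w + s (-1) (a' w) \<in> N" by (auto simp: N_def)
        then show ?thesis using N0 by simp
      qed
      define E where "E b x a \<longleftrightarrow> a \<in> A \<and> (\<forall>b'\<in>B. a b' = (if b' = b then x else 0))" for b x a
      \<comment> \<open>For \<open>b \<in> B\<close>, this is the forced value at \<open>w\<close>
        of an operator that sends \<open>b\<close> to \<open>x\<close> and the rest of
        \<open>B\<close> to 0. As a function of \<open>x\<close> it is linear and commutes with
        \<open>A\<close>, hence scalar.\<close>
      define T where "T b x = (SOME a. E b x a) w" for b x
      have ex: "\<exists>a. E b x a" for b x unfolding E_def using IH[of "\<lambda>b'. if b' = b then x else 0"] by blast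
      have T: "T b x = a w" if "E b x a" for a b x
      proof -
        have "E b x (SOME a. E b x a)" using ex by (rule someI_ex)
        with that show ?thesis unfolding T_def E_def by (intro uniq) auto
      qed
      have linT: "lin_on s UNIV s UNIV (T b)" for b
      proof (rule lin_onI)
        fix x y
        obtain a a' where a: "E b x a" "E b y a'" using ex by metis
        have "E b (x + y) (\<lambda>z. a z + a' z)" using a add by (auto simp: E_def)
        then show "T b (x + y) = T b x + T b y" using T a by metis
      next
        fix c :: complex and x
        obtain a where a: "E b x a" using ex by metis
        have "E b (s c x) (\<lambda>z. s c (a z))" using a scl by (auto simp: E_def)
        then show "T b (s c x) = s c (T b x)" using T a by metis
      qed simp
      have comm: "T b (c x) = c (T b x)" if c: "c \<in> A" for b c x
      proof -
        obtain a where a: "E b x a" using ex by metis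
        then obtain d where d: "d \<in> A" "\<forall>x\<in>insert w B. d x = c (a x)"
          using mult[OF c, of a "insert w B"] insert.hyps(1) by (auto simp: E_def)
        then have "E b (c x) d" using a z0[OF c] by (auto simp: E_def)
        with T a d show ?thesis by simp
      qed
      have "\<forall>b. \<exists>c. \<forall>x. T b x = s c x" using schur[OF linT comm] by blast
      then obtain l where l: "\<And>b x. T b x = s (l b) x" by metis
      have "\<forall>b. \<exists>a. E b b a" using ex by blast
      then obtain a where a: "\<And>b. E b b (a b)" by metis
      have sumA: "(\<lambda>x. \<Sum>b\<in>S. a b x) \<in> A" if "finite S" for S
        using that a zero by (induction S) (auto simp: E_def intro: add)
      \<comment> \<open>The sum of the \<open>a b\<close> agrees with the identity on
        \<open>B\<close>, hence at \<open>w\<close> too. Each \<open>a b w\<close> is a multiple of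
        \<open>b\<close>, so \<open>w\<close> would lie in the span of \<open>B\<close>.\<close>
      have "(\<Sum>b\<in>B. a b w) = w"
      proof (rule uniq[OF sumA one, rule_format])
        fix b assume "b \<in> B"
        have "(\<Sum>b'\<in>B. a b' b) = (\<Sum>b'\<in>B. if b' = b then b else 0)"
          using a \<open>b \<in> B\<close> by (intro sum.cong) (auto simp: E_def)
        then show "(\<Sum>b'\<in>B. a b' b) = b" using \<open>b \<in> B\<close> insert.hyps(1) by simp
      qed (rule insert.hyps(1))
      moreover have "a b w = s (l b) b" for b using T[OF a, of b] l by simp
      ultimately have "(\<Sum>b\<in>B. s (l b) b) = w" by simp
      moreover have "(\<Sum>b\<in>B. s (l b) b) \<in> span B" by (intro span_sum span_scale span_base)
      ultimately show ?thesis using w by simp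
    qed
  qed
qed

section \<open>The Jacobi identity in components\<close>

lemma Sum_any_range:
  assumes "inj g" "\<And>d. d \<notin> range g \<Longrightarrow> h d = 0" "\<And>i::nat. i \<ge> I \<Longrightarrow> h (g i) = 0"
  shows "Sum_any h = (\<Sum>i<I. h (g i))"
proof -
  have "Sum_any h = sum h (g ` {..<I})"
  proof (rule Sum_any.expand_superset)
    show "{a. h a \<noteq> 0} \<subseteq> g ` {..<I}"
    proof
      fix a assume "a \<in> {a. h a \<noteq> 0}"
      then obtain i where "a = g i" "h (g i) \<noteq> 0" using assms(2)[of a] by auto
      then show "a \<in> g ` {..<I}" using assms(3)[of i] by (intro image_eqI[of _ _ i]) (auto simp flip: not_le)
    qed
  qed simp
  also have "\<dots> = (\<Sum>i<I. h (g i))"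
    by (simp add: sum.reindex inj_on_subset[OF assms(1)])
  finally show ?thesis .
qed

lemma Ints_diff_iff: "a \<in> \<int> \<Longrightarrow> a - b \<in> \<int> \<longleftrightarrow> b \<in> \<int>" for a b :: "'a::ring_1"
  using Ints_diff[of a "a - b"] Ints_diff[of a b] by auto

text \<open>The operator product carries no power of \<open>z_0\<close>, so that exponent comes from
  the delta function alone; expanding in nonnegative powers of \<open>z_2\<close> leaves the
  exponents \<open>(- p - 1, p - i, i)\<close>. From \<open>I\<close> on the terms vanish, so
  \<open>Sum_any\<close> is a genuine finite sum.\<close>

lemma series_left:
  fixes A :: "rat \<Rightarrow> rat \<Rightarrow> 'm::ab_group_add"
  assumes "vector_space s" "\<And>x i. i \<ge> I \<Longrightarrow> A x (n + of_nat i) = 0"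
  shows "series_mult s (\<lambda>(a, b, c). delta_coeff 0 b c a)
      (\<lambda>(a, b, c). if a = 0 then A (- b - 1) (- c - 1) else 0) (- p - 1, - m - 1, - n - 1) =
    (if p \<in> \<int> then \<Sum>i<I. s ((-1) ^ i * (of_rat p gchoose i)) (A (p + m - of_nat i) (n + of_nat i)) else 0)"
proof -
  interpret vector_space s by fact
  define g where "g i = (- p - 1, p - of_nat i, of_nat i :: rat)" for i :: nat
  have "inj g" by (auto simp: g_def inj_def)
  have *: "series_mult s (\<lambda>(a, b, c). delta_coeff 0 b c a)
      (\<lambda>(a, b, c). if a = 0 then A (- b - 1) (- c - 1) else 0) (- p - 1, - m - 1, - n - 1) =
    (\<Sum>i<I. s (delta_coeff 0 (p - of_nat i) (of_nat i) (- p - 1)) (A (p + m - of_nat i) (n + of_nat i)))"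
    unfolding series_mult_def
  proof (subst Sum_any_range[OF \<open>inj g\<close>, of _ I], goal_cases)
    case (1 d)
    obtain a b c where d: "d = (a, b, c)" by (cases d)
    show ?case
    proof (rule ccontr)
      assume "\<not> ?case"
      then have "a = - p - 1" "c \<in> \<nat>" "b + c = - a - 1"
        by (auto simp: d delta_coeff_def binomial_coeff_def split: if_splits)
      then have "d \<in> range g" by (auto simp: d g_def image_iff elim!: Nats_cases)
      with 1 show False by simp
    qed
  next
    case (2 i)
    then show ?case by (simp add: g_def assms(2) algebra_simps)
  next
    case 3
    show ?case by (rule sum.cong) (simp_all add: g_def algebra_simps)
  qed
  show ?thesis
    unfolding * by (auto simp: delta_coeff_def binomial_coeff_def)
qed

text \<open>Here \<open>z_1\<close> is the variable expanded in nonnegative powers. For integral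
  \<open>p\<close> the sign factor is \<open>(-1)^p\<close>, which comes from \<open>- z_0\<close>
  in the delta function.\<close>

lemma series_middle:
  fixes A :: "rat \<Rightarrow> rat \<Rightarrow> 'm::ab_group_add"
  assumes "vector_space s" "\<And>x i. i \<ge> I \<Longrightarrow> A x (m + of_nat i) = 0"
  shows "series_mult s (\<lambda>(a, b, c). (-1) powi (- \<lfloor>a\<rfloor> - 1) * delta_coeff 0 c b a)
      (\<lambda>(a, b, c). if a = 0 then A (- c - 1) (- b - 1) else 0) (- p - 1, - m - 1, - n - 1) =
    (if p \<in> \<int> then \<Sum>i<I. s ((-1) powi (- \<lfloor>- p - 1\<rfloor> - 1) * ((-1) ^ i * (of_rat p gchoose i)))
      (A (p + n - of_nat i) (m + of_nat i)) else 0)"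
proof -
  interpret vector_space s by fact
  define g where "g i = (- p - 1, of_nat i :: rat, p - of_nat i)" for i :: nat
  have "inj g" by (auto simp: g_def inj_def)
  have *: "series_mult s (\<lambda>(a, b, c). (-1) powi (- \<lfloor>a\<rfloor> - 1) * delta_coeff 0 c b a)
      (\<lambda>(a, b, c). if a = 0 then A (- c - 1) (- b - 1) else 0) (- p - 1, - m - 1, - n - 1) =
    (\<Sum>i<I. s ((-1) powi (- \<lfloor>- p - 1\<rfloor> - 1) * delta_coeff 0 (p - of_nat i) (of_nat i) (- p - 1))
      (A (p + n - of_nat i) (m + of_nat i)))"
    unfolding series_mult_def
  proof (subst Sum_any_range[OF \<open>inj g\<close>, of _ I], goal_cases)
    case (1 d)
    obtain a b c where d: "d = (a, b, c)" by (cases d)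
    show ?case
    proof (rule ccontr)
      assume "\<not> ?case"
      then have "a = - p - 1" "b \<in> \<nat>" "c + b = - a - 1"
        by (auto simp: d delta_coeff_def binomial_coeff_def split: if_splits)
      then have "d \<in> range g" by (auto simp: d g_def image_iff elim!: Nats_cases)
      with 1 show False by simp
    qed
  next
    case (2 i)
    then show ?case by (simp add: g_def assms(2) algebra_simps)
  next
    case 3
    show ?case by (rule sum.cong) (simp_all add: g_def algebra_simps)
  qed
  show ?thesis
    unfolding * by (auto simp: delta_coeff_def binomial_coeff_def)
qed

text \<open>The condition \<open>m - k \<in> \<int>\<close> is the support of the twisted delta
  function. By upper negation, \<open>(-1)^i\<close> times \<open>(i - m - 1) gchoose i\<close> is
  the familiar coefficient \<open>m gchoose i\<close>.\<close>

lemma series_right: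
  fixes A :: "rat \<Rightarrow> rat \<Rightarrow> 'm::ab_group_add"
  assumes "vector_space s" "\<And>x i. i \<ge> I \<Longrightarrow> A (p + of_nat i) x = 0"
  shows "series_mult s (\<lambda>(a, b, c). delta_coeff (- k) b a c)
      (\<lambda>(a, b, c). if b = 0 then A (- a - 1) (- c - 1) else 0) (- p - 1, - m - 1, - n - 1) =
    (if m - k \<in> \<int> then \<Sum>i<I. s ((-1) ^ i * (of_rat (of_nat i - m - 1) gchoose i))
      (A (p + of_nat i) (m + n - of_nat i)) else 0)"
proof -
  interpret vector_space s by fact
  define g where "g i = (of_nat i :: rat, - m - 1, m - of_nat i)" for i :: nat
  have "inj g" by (auto simp: g_def inj_def)
  have *: "series_mult s (\<lambda>(a, b, c). delta_coeff (- k) b a c)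
      (\<lambda>(a, b, c). if b = 0 then A (- a - 1) (- c - 1) else 0) (- p - 1, - m - 1, - n - 1) =
    (\<Sum>i<I. s (delta_coeff (- k) (- m - 1) (of_nat i) (m - of_nat i))
      (A (p + of_nat i) (m + n - of_nat i)))"
    unfolding series_mult_def
  proof (subst Sum_any_range[OF \<open>inj g\<close>, of _ I], goal_cases)
    case (1 d)
    obtain a b c where d: "d = (a, b, c)" by (cases d)
    show ?case
    proof (rule ccontr)
      assume "\<not> ?case"
      then have "b = - m - 1" "a \<in> \<nat>" "b + a = - c - 1"
        by (auto simp: d delta_coeff_def binomial_coeff_def split: if_splits)
      then have "d \<in> range g" by (auto simp: d g_def image_iff elim!: Nats_cases)
      with 1 show False by simp
    qed
  next
    case (2 i)
    then show ?case by (simp add: g_def assms(2) algebra_simps)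
  next
    case 3
    show ?case by (rule sum.cong) (simp_all add: g_def algebra_simps)
  qed
  have "- (m - of_nat i) - 1 + k = (of_nat i - 1) - (m - k)" for i
    by simp
  moreover have "(of_nat i - 1) - (m - k) \<in> \<int> \<longleftrightarrow> m - k \<in> \<int>" for i
    by (rule Ints_diff_iff) simp
  ultimately have "- (m - of_nat i) - 1 + k \<in> \<int> \<longleftrightarrow> m - k \<in> \<int>" for i
    by metis
  then show ?thesis
    unfolding * by (auto simp: delta_coeff_def binomial_coeff_def algebra_simps intro!: sum.neutral)
qed

text \<open>The coefficient of \<open>z\<^sub>0\<^sup>-\<^sup>p\<^sup>-\<^sup>1 z\<^sub>1\<^sup>-\<^sup>m\<^sup>-\<^sup>1 z\<^sub>2\<^sup>-\<^sup>n\<^sup>-\<^sup>1\<close>, with all sums cut off at \<open>I\<close>.\<close>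

definition jacobi_component ::
  "(complex \<Rightarrow> 'm::ab_group_add \<Rightarrow> 'm) \<Rightarrow> ('v \<Rightarrow> rat \<Rightarrow> 'v \<Rightarrow> 'v) \<Rightarrow> ('v \<Rightarrow> rat \<Rightarrow> 'm \<Rightarrow> 'm)
    \<Rightarrow> rat \<Rightarrow> 'v \<Rightarrow> 'v \<Rightarrow> 'm \<Rightarrow> rat \<Rightarrow> rat \<Rightarrow> rat \<Rightarrow> nat \<Rightarrow> bool"
  where "jacobi_component s YV YM k u v w p m n I \<longleftrightarrow>
    (if p \<in> \<int> then \<Sum>i<I. s ((-1) ^ i * (of_rat p gchoose i)) (YM u (p + m - of_nat i) (YM v (n + of_nat i) w)) else 0) -
    (if p \<in> \<int> then \<Sum>i<I. s ((-1) powi (- \<lfloor>- p - 1\<rfloor> - 1) * ((-1) ^ i * (of_rat p gchoose i)))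
      (YM v (p + n - of_nat i) (YM u (m + of_nat i) w)) else 0) =
    (if m - k \<in> \<int> then \<Sum>i<I. s ((-1) ^ i * (of_rat (of_nat i - m - 1) gchoose i))
      (YM (YV u (p + of_nat i) v) (m + n - of_nat i) w) else 0)"

definition jacobi_at ::
  "(complex \<Rightarrow> 'm::ab_group_add \<Rightarrow> 'm) \<Rightarrow> ('v \<Rightarrow> rat \<Rightarrow> 'v \<Rightarrow> 'v) \<Rightarrow> ('v \<Rightarrow> rat \<Rightarrow> 'm \<Rightarrow> 'm)
    \<Rightarrow> rat \<Rightarrow> 'v \<Rightarrow> 'v \<Rightarrow> 'm \<Rightarrow> rat \<times> rat \<times> rat \<Rightarrow> bool"
  where "jacobi_at s YV YM k u v w e \<longleftrightarrow>
    series_mult s (\<lambda>(a, b, c). delta_coeff 0 b c a)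
        (\<lambda>(a, b, c). if a = 0 then YM u (- b - 1) (YM v (- c - 1) w) else 0) e
    - series_mult s (\<lambda>(a, b, c). (-1) powi (- \<lfloor>a\<rfloor> - 1) * delta_coeff 0 c b a)
        (\<lambda>(a, b, c). if a = 0 then YM v (- c - 1) (YM u (- b - 1) w) else 0) e
    = series_mult s (\<lambda>(a, b, c). delta_coeff (- k) b a c)
        (\<lambda>(a, b, c). if b = 0 then YM (YV u (- a - 1) v) (- c - 1) w else 0) e"

lemma jacobi_identity_iff: "jacobi_identity s YV YM k u v w \<longleftrightarrow> (\<forall>e. jacobi_at s YV YM k u v w e)"
  unfolding jacobi_identity_def jacobi_at_def ..

lemma jacobi_at_component:
  assumes "vector_space s" "\<And>x n. YM x n 0 = 0" "\<And>n. YM 0 n w = 0"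
    and "\<And>i. i \<ge> I \<Longrightarrow> YM u (m + of_nat i) w = 0" "\<And>i. i \<ge> I \<Longrightarrow> YM v (n + of_nat i) w = 0"
      "\<And>i. i \<ge> I \<Longrightarrow> YV u (p + of_nat i) v = 0"
  shows "jacobi_at s YV YM k u v w (- p - 1, - m - 1, - n - 1) \<longleftrightarrow> jacobi_component s YV YM k u v w p m n I"
proof -
  have L: "YM u x (YM v (n + of_nat i) w) = 0" and M: "YM v x (YM u (m + of_nat i) w) = 0"
    and R: "YM (YV u (p + of_nat i) v) x w = 0" if "i \<ge> I" for x i
    using that by (simp_all add: assms(2-))
  note series = series_left[OF assms(1), of I "\<lambda>x y. YM u x (YM v y w)" n p m, OF L]
    series_middle[OF assms(1), of I "\<lambda>x y. YM v x (YM u y w)" m p n, OF M]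
    series_right[OF assms(1), of I "\<lambda>x y. YM (YV u x v) y w" p k m n, OF R]
  show ?thesis
    by (simp only: jacobi_at_def jacobi_component_def series)
qed

lemma truncation_index:
  fixes f :: "rat \<Rightarrow> 'a::zero"
  assumes "\<exists>N. \<forall>n\<ge>N. f n = 0"
  shows "\<exists>I. \<forall>i\<ge>I. f (x + of_nat i) = 0"
proof -
  obtain N where N: "\<forall>n\<ge>N. f n = 0" using assms by blast
  obtain I :: nat where I: "N - x \<le> of_nat I" using real_arch_simple by blast
  have "f (x + of_nat i) = 0" if "i \<ge> I" for i
  proof -
    have "(of_nat I :: rat) \<le> of_nat i" using that by simp
    with I have "N \<le> x + of_nat i" by linarith
    then show ?thesis using N by blast
  qed
  then show ?thesis by blast
qed

text \<open>Reduces the identity to finite sums: for each triple of exponents, truncation supplies a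
  cut-off \<open>I\<close> from which on the three inner modes vanish, and the cut-off may differ
  from triple to triple.\<close>

lemma jacobi_identityI:
  assumes "vector_space s" "\<And>x n. YM x n 0 = 0" "\<And>n. YM 0 n w = 0"
    and "\<exists>N. \<forall>n\<ge>N. YM u n w = 0" "\<exists>N. \<forall>n\<ge>N. YM v n w = 0" "\<exists>N. \<forall>n\<ge>N. YV u n v = 0"
    and J: "\<And>p m n I. (\<And>i. i \<ge> I \<Longrightarrow> YM u (m + of_nat i) w = 0) \<Longrightarrow>
      (\<And>i. i \<ge> I \<Longrightarrow> YM v (n + of_nat i) w = 0) \<Longrightarrow>
      (\<And>i. i \<ge> I \<Longrightarrow> YV u (p + of_nat i) v = 0) \<Longrightarrow> jacobi_component s YV YM k u v w p m n I"
  shows "jacobi_identity s YV YM k u v w"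
  unfolding jacobi_identity_iff
proof
  fix e :: "rat \<times> rat \<times> rat"
  define p m n where "p = - fst e - 1" and "m = - fst (snd e) - 1" and "n = - snd (snd e) - 1"
  have e: "e = (- p - 1, - m - 1, - n - 1)" by (simp add: p_def m_def n_def)
  obtain I1 I2 I3 where I: "\<forall>i\<ge>I1. YM u (m + of_nat i) w = 0" "\<forall>i\<ge>I2. YM v (n + of_nat i) w = 0"
    "\<forall>i\<ge>I3. YV u (p + of_nat i) v = 0"
    using truncation_index[OF assms(4)] truncation_index[OF assms(5)] truncation_index[OF assms(6)] by metis
  define I where "I = max I1 (max I2 I3)"
  have *: "YM u (m + of_nat i) w = 0" "YM v (n + of_nat i) w = 0" "YV u (p + of_nat i) v = 0" if "i \<ge> I" for i
    using that I by (auto simp: I_def)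
  then have "jacobi_component s YV YM k u v w p m n I" by (rule J)
  then show "jacobi_at s YV YM k u v w e"
    unfolding e using jacobi_at_component[of s YM w I u m v n YV p k, OF assms(1-3) *] by blast
qed

section \<open>Sums of modes\<close>

text \<open>Coefficients are left out because \<open>c v_n = (c v)_n\<close>: when \<open>U\<close>
  is a subspace, scalars are absorbed into the vectors.\<close>

inductive_set mode_sums :: "('v \<Rightarrow> rat \<Rightarrow> 'm::ab_group_add \<Rightarrow> 'm) \<Rightarrow> 'v set \<Rightarrow> ('m \<Rightarrow> 'm) set"
  for YM U where
    zero: "(\<lambda>w. 0) \<in> mode_sums YM U"
  | add: "v \<in> U \<Longrightarrow> a \<in> mode_sums YM U \<Longrightarrow> (\<lambda>w. YM v n w + a w) \<in> mode_sums YM U"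

lemma mode_sums_single: "v \<in> U \<Longrightarrow> YM v n \<in> mode_sums YM U"
  using mode_sums.add[OF _ mode_sums.zero, of v U YM n] by simp

lemma mode_sums_plus:
  assumes "a \<in> mode_sums YM U" "b \<in> mode_sums YM U"
  shows "(\<lambda>w. a w + b w) \<in> mode_sums YM U"
  using assms(1)
proof induction
  case (add v a n)
  then have "(\<lambda>w. YM v n w + (a w + b w)) \<in> mode_sums YM U" by (intro mode_sums.add)
  then show ?case by (simp add: add.assoc)
qed (simp add: assms(2))

lemma mode_sums_sum:
  assumes "\<And>i. i \<in> I \<Longrightarrow> a i \<in> mode_sums YM U"
  shows "(\<lambda>w. \<Sum>i\<in>I. a i w) \<in> mode_sums YM U"
  using assms by (induction I rule: infinite_finite_induct) (auto intro: mode_sums.zero mode_sums_plus)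

lemma finite_uniform_index:
  assumes "finite F" "\<And>w. w \<in> F \<Longrightarrow> \<exists>I. \<forall>i\<ge>I. P w i"
  shows "\<exists>I. \<forall>w\<in>F. \<forall>i\<ge>(I::nat). P w i"
  using eventually_ball_finite[OF assms(1), of "\<lambda>i w. P w i" sequentially] assms(2)
  unfolding eventually_sequentially by blast

section \<open>Twisted modules\<close>

locale full_twisted_module = twisted_module sV UNIV vac Y \<sigma> sM UNIV YM
  for sV :: "complex \<Rightarrow> 'v::ab_group_add \<Rightarrow> 'v" and vac Y \<sigma>
    and sM :: "complex \<Rightarrow> 'm::ab_group_add \<Rightarrow> 'm" and YM
begin

abbreviation "T \<equiv> aut_order UNIV \<sigma>"
abbreviation "E \<equiv> sigma_eigenspace sV UNIV \<sigma>"
abbreviation "YV \<equiv> rat_modes Y"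
abbreviation "MS \<equiv> mode_sums YM UNIV"

lemma order: "0 < T" "(\<sigma> ^^ T) v = v"
  using LeastI_ex[OF finite_order] by (auto simp: aut_order_def)

lemma lin_YM: "lin_on sM UNIV sM UNIV (YM v n)" and lin_YM_left: "lin_on sV UNIV sM UNIV (\<lambda>v. YM v n w)"
  using YM_bilinear[of n] by (auto simp: bilin_on_def)

lemma YM_simps [simp]:
  "YM v n (x + y) = YM v n x + YM v n y" "YM v n (sM c x) = sM c (YM v n x)" "YM v n 0 = 0"
  "YM (u + v) n x = YM u n x + YM v n x" "YM (sV c v) n x = sM c (YM v n x)" "YM 0 n x = 0"
  using lin_on_add[OF lin_YM] lin_on_scale[OF lin_YM] lin_on_zero[OF lin_YM]
    lin_on_add[OF lin_YM_left] lin_on_scale[OF lin_YM_left] lin_on_zero[OF lin_YM_left] by auto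

lemma YM_sum: "YM v n (\<Sum>i\<in>I. f i) = (\<Sum>i\<in>I. YM v n (f i))"
  by (rule lin_on_sum[OF M.vector_space_axioms lin_YM]) auto

lemma YM_sum_left: "YM (\<Sum>i\<in>I. f i) n x = (\<Sum>i\<in>I. YM (f i) n x)"
  by (rule lin_on_sum[OF vector_space_axioms lin_YM_left]) auto

lemma YV_truncated: "\<exists>N. \<forall>n\<ge>N. YV u n v = 0"
proof -
  obtain N where N: "\<forall>n\<ge>N. Y u n v = 0" using Y_truncated[of u v] by auto
  have "YV u n v = 0" if "n \<ge> of_int N" for n
    using N that by (auto simp: rat_modes_def le_floor_iff)
  then show ?thesis by blast
qed

text \<open>Discrete Fourier transform over the powers of \<sigma>: with
  \<open>\<omega> = exp(2 pi i / T)\<close>, the vector \<open>f r\<close> is the mean over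
  \<open>j < T\<close> of \<open>\<omega>^(r j)\<close> times the \<open>j\<close>-th power of
  \<sigma> applied to \<open>u\<close>, an eigenvector for \<open>\<omega>^(-r)\<close>.\<close>

lemma eigen_decomposition:
  "\<exists>f. (\<forall>r<T. f r \<in> E r) \<and> u = (\<Sum>r<T. f r)"
proof -
  define \<omega> :: complex where "\<omega> = exp (2 * of_real pi * \<i> / of_nat T)"
  have T0: "of_nat T \<noteq> (0 :: complex)" using order(1) by simp
  have pow: "\<omega> ^ k = exp (2 * of_real pi * \<i> * of_nat k / of_nat T)" for k
    unfolding \<omega>_def exp_of_nat_mult[symmetric] by (simp add: mult_ac)
  have powT: "\<omega> ^ T = 1" using T0 by (simp add: pow)
  have w0: "\<omega> \<noteq> 0" by (simp add: \<omega>_def)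
  have ne1: "\<omega> ^ j \<noteq> 1" if "0 < j" "j < T" for j
  proof
    assume "\<omega> ^ j = 1"
    then have "cos (2 * pi * real j / real T) = 1"
      using Re_exp[of "2 * of_real pi * \<i> * of_nat j / of_nat T"] by (simp add: pow Im_divide_of_nat)
    then obtain n :: int where "2 * pi * real j / real T = of_int n * 2 * pi"
      unfolding cos_one_2pi_int by blast
    then have "(2 * pi) * (real j / real T) = (2 * pi) * of_int n" by (simp add: mult_ac)
    then have "real j / real T = of_int n"
      unfolding mult_cancel_left using pi_neq_zero by simp
    moreover have "0 < real j / real T" "real j / real T < 1" using that by auto
    ultimately show False by simp
  qed
  have lin: "lin_on sV UNIV sV UNIV (\<sigma> ^^ j)" for j
    using automorphism by (induction j) (auto simp: va_automorphism_def lin_on_def)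
  define g where "g r j = sV (\<omega> ^ (r * j) / of_nat T) ((\<sigma> ^^ j) u)" for r j
  define f where "f r = (\<Sum>j<T. g r j)" for r
  have "f r \<in> E r" for r
  proof -
    \<comment> \<open>Applying \<sigma> shifts \<open>j\<close> by one; both \<omega> and \<sigma>
      have \<open>T\<close>-th power 1, so the shifted sum over a full period is unchanged.\<close>
    have \<sigma>g: "\<sigma> (g r j) = sV (1 / \<omega> ^ r) (g r (Suc j))" for j
      using automorphism w0
      by (simp add: g_def va_automorphism_def lin_on_def power_add)
    have "g r T = g r 0"
      using order(2) powT by (simp add: g_def mult.commute[of r] power_mult)
    then have shift: "(\<Sum>j<T. g r (Suc j)) = f r"
      using sum.lessThan_Suc[of "g r" T] sum.lessThan_Suc_shift[of "g r" T] by (simp add: f_def)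
    have "\<sigma> (f r) = (\<Sum>j<T. \<sigma> (g r j))"
      unfolding f_def using automorphism
      by (intro lin_on_sum[OF vector_space_axioms, where ?W1.0 = UNIV]) (auto simp: va_automorphism_def)
    also have "\<dots> = sV (1 / \<omega> ^ r) (f r)"
      unfolding \<sigma>g shift[symmetric] by (simp add: scale_sum_right)
    also have "1 / \<omega> ^ r = exp (- (2 * of_real pi * \<i> * of_nat r / of_nat T))"
      unfolding pow exp_minus by (simp add: field_simps)
    finally show ?thesis by (simp add: sigma_eigenspace_def)
  qed
  moreover have "u = (\<Sum>r<T. f r)"
  proof -
    have geo: "(\<Sum>r<T. \<omega> ^ (r * j)) = (if j = 0 then of_nat T else 0)" if "j < T" for j
    proof (cases "j = 0")
      case False
      have "(\<Sum>r<T. (\<omega> ^ j) ^ r) = ((\<omega> ^ j) ^ T - 1) / (\<omega> ^ j - 1)"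
        using ne1[of j] False that by (intro geometric_sum) auto
      also have "(\<omega> ^ j) ^ T = 1" using powT by (metis power_mult mult.commute power_one)
      finally show ?thesis using False by (simp add: power_mult[symmetric] mult.commute)
    qed simp
    have "(\<Sum>r<T. f r) = (\<Sum>j<T. \<Sum>r<T. g r j)" unfolding f_def by (rule sum.swap)
    also have "\<dots> = (\<Sum>j<T. sV ((\<Sum>r<T. \<omega> ^ (r * j)) / of_nat T) ((\<sigma> ^^ j) u))"
      unfolding g_def by (simp add: scale_sum_left sum_divide_distrib)
    also have "\<dots> = (\<Sum>j<T. if j = 0 then u else 0)"
      using T0 by (intro sum.cong) (auto simp: geo)
    also have "\<dots> = u" using order(1) by simp
    finally show ?thesis by simp
  qed
  ultimately show ?thesis by blast
qed

text \<open>The axiom truncates only eigenvectors of \<sigma>; a general vector is a finite sum of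
  them.\<close>

lemma truncated: "\<exists>N. \<forall>n\<ge>N. YM u n w = 0"
proof -
  obtain f where f: "\<And>r. r < T \<Longrightarrow> f r \<in> E r" "u = (\<Sum>r<T. f r)" using eigen_decomposition by blast
  have "\<forall>r\<in>{..<T}. \<exists>N. \<forall>n\<ge>N. YM (f r) n w = 0" using YM_truncated f(1) by auto
  then have "eventually (\<lambda>n. \<forall>r\<in>{..<T}. YM (f r) n w = 0) at_top"
    by (intro eventually_ball_finite) (auto simp: eventually_at_top_linorder)
  then show ?thesis
    unfolding eventually_at_top_linorder f(2) YM_sum_left by (metis (no_types, lifting) sum.neutral)
qed

text \<open>Going far enough within a coset of the integers makes \<open>u\<close> and all its later
  modes kill \<open>F\<close>. This choice removes the term of the Jacobi identity in which
  \<open>u\<close> acts first.\<close>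

lemma annihilating_shift:
  assumes "finite F"
  shows "\<exists>s. s - r \<in> \<int> \<and> (\<forall>w\<in>F. \<forall>i. YM u (s + of_nat i) w = 0)"
proof -
  obtain L where L: "\<forall>w\<in>F. \<forall>i\<ge>L. YM u (r + of_nat i) w = 0"
    using finite_uniform_index[OF assms, of "\<lambda>w i. YM u (r + of_nat i) w = 0"]
      truncation_index[OF truncated] by blast
  have "YM u (r + of_nat L + of_nat i) w = 0" if "w \<in> F" for w i
    using L that by (metis add.assoc le_add1 of_nat_add)
  then show ?thesis by (intro exI[of _ "r + of_nat L"]) simp
qed

text \<open>Weak associativity: the modes \<open>u_(m+i)\<close> kill \<open>w\<close>, so the
  second product in the Jacobi identity drops out and only products with \<open>v\<close> acting
  first remain.\<close>

lemma associativity_component: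
  assumes u: "r < T" "u \<in> E r" and m: "m - of_nat r / of_nat T \<in> \<int>" and p: "p \<in> \<int>"
    and tu: "\<And>i. YM u (m + of_nat i) w = 0" and tv: "\<And>i. i \<ge> I \<Longrightarrow> YM v (n + of_nat i) w = 0"
    and tuv: "\<And>i. i \<ge> I \<Longrightarrow> YV u (p + of_nat i) v = 0"
  shows "(\<Sum>i<I. sM ((-1) ^ i * (of_rat p gchoose i)) (YM u (p + m - of_nat i) (YM v (n + of_nat i) w))) =
    (\<Sum>i<I. sM ((-1) ^ i * (of_rat (of_nat i - m - 1) gchoose i))
      (YM (YV u (p + of_nat i) v) (m + n - of_nat i) w))"
proof -
  have "jacobi_component sM YV YM (of_nat r / of_nat T) u v w p m n I"
    using jacobi_at_component[OF M.vector_space_axioms, of YM w I u m v n YV p "of_nat r / of_nat T"]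
      twisted_jacobi[OF u UNIV_I UNIV_I, of v w] tu tv tuv
    by (simp add: jacobi_identity_iff)
  then show ?thesis using m p tu by (simp add: jacobi_component_def)
qed

lemma MS_scale: "a \<in> MS \<Longrightarrow> (\<lambda>w. sM c (a w)) \<in> MS"
proof (induction rule: mode_sums.induct)
  case (add v a n)
  then have "(\<lambda>w. YM (sV c v) n w + sM c (a w)) \<in> MS" by (intro mode_sums.add) auto
  then show ?case by (simp add: M.scale_right_distrib)
qed (simp add: mode_sums.zero)

lemma MS_lin: "a \<in> MS \<Longrightarrow> lin_on sM UNIV sM UNIV a"
  by (induction rule: mode_sums.induct) (auto simp: lin_on_def M.scale_right_distrib)

lemma MS_id: "(\<lambda>w. w) \<in> MS"
proof -
  have "YM vac (-1) = (\<lambda>w. w)" by (rule ext) (simp add: YM_vac)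
  then show ?thesis using mode_sums_single[of vac UNIV YM "-1"] by simp
qed

text \<open>Associativity expresses a combination of products by single modes, and its leading term
  can be made \<open>u_m v_n\<close>. The other products contain \<open>v_(n+i)\<close> with
  \<open>i > 0\<close>, which is closer to the truncation point; hence the induction on the number
  \<open>K\<close> of steps after which the modes of \<open>v\<close> vanish on
  \<open>F\<close>.\<close>

lemma product_eigen:
  assumes u: "r < T" "u \<in> E r" and F: "finite F"
  shows "\<exists>a\<in>MS. \<forall>w\<in>F. a w = YM u m (YM v n w)"
proof (cases "m - of_nat r / of_nat T \<in> \<int>")
  case False
  then have "YM u m x = 0" for x using modes_eigen[OF u] by simp
  then show ?thesis using mode_sums.zero by force
next
  case True
  let ?r = "of_nat r / of_nat T :: rat"
  obtain s where sZ: "s - ?r \<in> \<int>" and s: "\<And>w i. w \<in> F \<Longrightarrow> YM u (s + of_nat i) w = 0"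
    using annihilating_shift[OF F] by metis
  have main: "\<exists>a\<in>MS. \<forall>w\<in>F. a w = YM u m (YM v n w)"
    if "m - ?r \<in> \<int>" "\<forall>w\<in>F. \<forall>i\<ge>K. YM v (n + of_nat i) w = 0" for K m n
    using that
  proof (induction K arbitrary: m n)
    case 0
    have "\<forall>w\<in>F. YM v n w = 0" using 0(2) by (metis add_0_right of_nat_0 order_refl)
    then show ?case using mode_sums.zero by force
  next
    case (Suc K)
    \<comment> \<open>Since \<open>p + s = m\<close>, the term \<open>i = 0\<close> of the
      associativity relation is \<open>u_m v_n\<close>. It is integral because \<open>m\<close> and
      \<open>s\<close> lie in the same coset.\<close>
    define p where "p = m - s"
    have p: "p \<in> \<int>" using Ints_diff[OF Suc.prems(1) sZ] by (simp add: p_def)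
    obtain J where J: "\<forall>i\<ge>J. YV u (p + of_nat i) v = 0"
      using truncation_index[OF YV_truncated] by blast
    \<comment> \<open>Beyond both truncation points, and positive so that the term
      \<open>i = 0\<close> can be split off.\<close>
    define I where "I = Suc (max J K)"
    have "\<exists>a\<in>MS. \<forall>w\<in>F. a w = YM u (m - of_nat (Suc i)) (YM v (n + of_nat (Suc i)) w)" for i
    proof (rule Suc.IH)
      have "m - ?r - of_nat (Suc i) \<in> \<int>" by (rule Ints_diff[OF Suc.prems(1)]) simp
      then show "m - of_nat (Suc i) - ?r \<in> \<int>" by (simp add: algebra_simps)
      show "\<forall>w\<in>F. \<forall>j\<ge>K. YM v (n + of_nat (Suc i) + of_nat j) w = 0"
      proof (intro ballI allI impI)
        fix w j assume "w \<in> F" "K \<le> j"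
        then have "YM v (n + of_nat (Suc i + j)) w = 0" by (intro Suc.prems(2)[rule_format]) simp_all
        then show "YM v (n + of_nat (Suc i) + of_nat j) w = 0" by (simp only: of_nat_add add.assoc)
      qed
    qed
    then obtain a where a: "\<And>i. a i \<in> MS"
      "\<And>i w. w \<in> F \<Longrightarrow> a i w = YM u (m - of_nat (Suc i)) (YM v (n + of_nat (Suc i)) w)" by metis
    define cL cR where "cL i = (-1) ^ i * (of_rat p gchoose i :: complex)"
      and "cR i = (-1) ^ i * (of_rat (of_nat i - s - 1) gchoose i :: complex)" for i :: nat
    define b where "b w = (\<Sum>i<I. sM (cR i) (YM (YV u (p + of_nat i) v) (s + n - of_nat i) w)) +
      sM (-1) (\<Sum>i<max J K. sM (cL (Suc i)) (a i w))" for w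
    have "b \<in> MS"
      unfolding b_def by (intro mode_sums_plus mode_sums_sum MS_scale a mode_sums_single) auto
    moreover have "b w = YM u m (YM v n w)" if w: "w \<in> F" for w
    proof -
      have "(\<Sum>i<I. sM (cL i) (YM u (p + s - of_nat i) (YM v (n + of_nat i) w))) =
        (\<Sum>i<I. sM (cR i) (YM (YV u (p + of_nat i) v) (s + n - of_nat i) w))"
        unfolding cL_def cR_def using Suc.prems(2) J w s
        by (intro associativity_component[OF u sZ p]) (auto simp: I_def)
      moreover have "(\<Sum>i<I. sM (cL i) (YM u (p + s - of_nat i) (YM v (n + of_nat i) w))) =
        YM u m (YM v n w) + (\<Sum>i<max J K. sM (cL (Suc i)) (a i w))"
        unfolding I_def sum.lessThan_Suc_shift
        using a(2)[OF w] by (simp add: cL_def p_def)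
      ultimately show ?thesis by (simp add: b_def diff_eq_eq)
    qed
    ultimately show ?case by blast
  qed
  obtain K where "\<forall>w\<in>F. \<forall>i\<ge>K. YM v (n + of_nat i) w = 0"
    using finite_uniform_index[OF F, of "\<lambda>w i. YM v (n + of_nat i) w = 0"]
      truncation_index[OF truncated] by blast
  with main True show ?thesis by blast
qed

lemma product:
  assumes F: "finite F"
  shows "\<exists>a\<in>MS. \<forall>w\<in>F. a w = YM u m (YM v n w)"
proof -
  obtain f where f: "\<And>r. r < T \<Longrightarrow> f r \<in> E r" "u = (\<Sum>r<T. f r)" using eigen_decomposition by blast
  have "\<forall>r\<in>{..<T}. \<exists>a\<in>MS. \<forall>w\<in>F. a w = YM (f r) m (YM v n w)" using product_eigen[OF _ f(1) F] by blast
  then obtain a where a: "\<And>r. r < T \<Longrightarrow> a r \<in> MS" "\<And>r w. r < T \<Longrightarrow> w \<in> F \<Longrightarrow> a r w = YM (f r) m (YM v n w)"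
    by (metis lessThan_iff)
  have "(\<lambda>w. \<Sum>r<T. a r w) \<in> MS" using a(1) by (intro mode_sums_sum) auto
  moreover have "\<forall>w\<in>F. (\<Sum>r<T. a r w) = YM u m (YM v n w)"
    using a(2) unfolding f(2) YM_sum_left by (auto intro: sum.cong)
  ultimately show ?thesis by (intro bexI[of _ "\<lambda>w. \<Sum>r<T. a r w"])
qed

lemma MS_mult:
  assumes "a \<in> MS" "b \<in> MS" "finite F"
  shows "\<exists>c\<in>MS. \<forall>x\<in>F. c x = a (b x)"
  using assms(1)
proof induction
  case (add v a n)
  have "\<exists>c\<in>MS. \<forall>x\<in>F. c x = YM v n (b x)"
    using assms(2)
  proof induction
    case (add u b m)
    obtain c where c: "c \<in> MS" "\<forall>x\<in>F. c x = YM v n (YM u m x)" using product[OF assms(3)] by blast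
    obtain d where d: "d \<in> MS" "\<forall>x\<in>F. d x = YM v n (b x)" using add.IH by blast
    have "\<forall>x\<in>F. c x + d x = YM v n (YM u m x + b x)" using c d by simp
    then show ?case using mode_sums_plus[OF c(1) d(1)] by (rule rev_bexI[rotated])
  qed (auto intro!: bexI[OF _ mode_sums.zero])
  then obtain c where c: "c \<in> MS" "\<forall>x\<in>F. c x = YM v n (b x)" by blast
  obtain d where d: "d \<in> MS" "\<forall>x\<in>F. d x = a (b x)" using add.IH by blast
  have "\<forall>x\<in>F. c x + d x = YM v n (b x) + a (b x)" using c d by simp
  then show ?case using mode_sums_plus[OF c(1) d(1)] by (rule rev_bexI[rotated])
qed (auto intro!: bexI[OF _ mode_sums.zero])

end

section \<open>Schur's lemma and density for an irreducible twisted module\<close>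

locale irreducible_full_module = full_twisted_module sV vac Y \<sigma> sM YM
  for sV :: "complex \<Rightarrow> 'v::ab_group_add \<Rightarrow> 'v" and vac Y \<sigma>
    and sM :: "complex \<Rightarrow> 'm::ab_group_add \<Rightarrow> 'm" and YM +
  assumes irr: "irreducible_under sM UNIV (va_modes UNIV YM)" and cd: "countable_dim sV UNIV"
begin

lemma MS_stable_trivial:
  assumes "M.subspace N" "\<And>a. a \<in> MS \<Longrightarrow> a ` N \<subseteq> N"
  shows "N = {0} \<or> N = UNIV"
  using irr assms mode_sums_single[of _ UNIV YM] unfolding irreducible_under_def va_modes_def by blast

text \<open>The values \<open>a w\<close> already form a submodule: a product needs to be replaced
  by a mode sum only on the single vector \<open>w\<close>. It contains \<open>w\<close> because the
  mode of the vacuum of index -1 is the identity.\<close>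

lemma cyclic:
  assumes "w \<noteq> 0"
  shows "\<exists>a\<in>MS. a w = x"
proof -
  let ?N = "(\<lambda>a. a w) ` MS"
  have "?N = {0} \<or> ?N = UNIV"
  proof (rule MS_stable_trivial)
    show "M.subspace ?N"
    proof (rule M.subspaceI)
      show "0 \<in> ?N" using mode_sums.zero by force
    next
      fix x y assume "x \<in> ?N" "y \<in> ?N"
      then obtain a b where "a \<in> MS" "b \<in> MS" "x = a w" "y = b w" by auto
      then show "x + y \<in> ?N" by (intro image_eqI[OF _ mode_sums_plus[of a _ _ b]]) auto
    next
      fix c x assume "x \<in> ?N"
      then obtain a where "a \<in> MS" "x = a w" by auto
      then show "sM c x \<in> ?N" by (intro image_eqI[OF _ MS_scale[of a]]) auto
    qed
  next
    fix a assume "a \<in> MS"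
    show "a ` ?N \<subseteq> ?N"
    proof
      fix x assume "x \<in> a ` ?N"
      then obtain b where "b \<in> MS" "x = a (b w)" by blast
      then obtain c where "c \<in> MS" "c w = x" using MS_mult[OF \<open>a \<in> MS\<close>, of b "{w}"] by auto
      then show "x \<in> ?N" by blast
    qed
  qed
  moreover have "w \<in> ?N" using MS_id by (force simp: image_iff)
  ultimately have "x \<in> ?N" using assms by blast
  then show ?thesis by blast
qed

text \<open>One nonzero vector generates \<open>M\<close> under sums of single modes. Each
  \<open>v_n w\<close> expands over a countable basis of \<open>V\<close>, and the indices
  \<open>n\<close> are rational, hence countable in number.\<close>

lemma countable_spanning: "\<exists>C. countable C \<and> UNIV \<subseteq> M.span C"
proof -
  obtain B where B: "countable B" "span B = UNIV" using cd by (auto simp: countable_dim_def)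
  obtain w where w: "w \<noteq> (0::'m)" using irr by (auto simp: irreducible_under_def)
  let ?C = "(\<lambda>(b, n). YM b n w) ` (B \<times> UNIV)"
  have YM_span: "YM v n w \<in> M.span ?C" for v n
  proof -
    have "v \<in> span B" using B by simp
    then show ?thesis
    proof (induction rule: span_induct_alt)
      case (step c x y)
      have "YM x n w \<in> ?C" using step(1) by force
      then show ?case using step by (simp add: M.span_add M.span_scale M.span_base)
    qed (simp add: M.span_zero)
  qed
  have "a w \<in> M.span ?C" if "a \<in> MS" for a
    using that by induction (intro M.span_zero M.span_add YM_span; assumption)+
  then have "x \<in> M.span ?C" for x using cyclic[OF w, of x] by blast
  then have "UNIV \<subseteq> M.span ?C" by blast
  moreover have "countable ?C" using B(1) by (intro countable_image countable_SIGMA) auto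
  ultimately show ?thesis by blast
qed

lemma schur:
  assumes "lin_on sM UNIV sM UNIV f" "\<And>v n x. f (YM v n x) = YM v n (f x)"
  shows "\<exists>c. \<forall>x. f x = sM c x"
proof -
  obtain C where "countable C" "UNIV \<subseteq> M.span C" using countable_spanning by blast
  then have "\<exists>c. \<forall>x\<in>UNIV. f x = sM c x"
    by (intro schur_scalar[OF M.vector_space_axioms M.subspace_UNIV irr, where C = C])
      (use assms lin_YM in \<open>auto simp: va_modes_def\<close>)
  then show ?thesis by simp
qed

theorem modes_dense:
  assumes "finite B" "M.independent B"
  shows "\<exists>a\<in>MS. \<forall>b\<in>B. a b = t b"
proof -
  have schur: "\<exists>c. \<forall>x. f x = sM c x"
    if "lin_on sM UNIV sM UNIV f" "\<And>a x. a \<in> MS \<Longrightarrow> f (a x) = a (f x)" for f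
    using that schur mode_sums_single[of _ UNIV YM] by auto
  show ?thesis
  proof (rule density[where s = sM and A = MS])
    show "lin_on sM UNIV sM UNIV a" if "a \<in> MS" for a by (rule MS_lin[OF that])
    show "(\<lambda>x. a x + b x) \<in> MS" if "a \<in> MS" "b \<in> MS" for a b by (rule mode_sums_plus[OF that])
    show "(\<lambda>x. sM c (a x)) \<in> MS" if "a \<in> MS" for c a by (rule MS_scale[OF that])
    show "\<exists>c\<in>MS. \<forall>x\<in>F. c x = a (b x)" if "a \<in> MS" "b \<in> MS" "finite F" for a b F by (rule MS_mult[OF that])
    show "N = {0} \<or> N = UNIV" if "M.subspace N" "\<And>a. a \<in> MS \<Longrightarrow> a ` N \<subseteq> N" for N
      by (rule MS_stable_trivial[OF that])
    show "\<exists>c. \<forall>x. f x = sM c x"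
      if "lin_on sM UNIV sM UNIV f" "\<And>a x. a \<in> MS \<Longrightarrow> f (a x) = a (f x)" for f by (rule schur[OF that])
  qed (use assms MS_id M.vector_space_axioms in auto)
qed

end

lemma aut_order_id [simp]: "aut_order U id = 1"
  unfolding aut_order_def by (rule Least_equality) auto

text \<open>For the identity automorphism the order is 1 and the only eigenspace is
  \<open>U\<close>, so the twisted axioms collapse to the untwisted ones.\<close>

lemma (in vertex_algebra) va_moduleI:
  assumes "vector_space s" "module.subspace s W" "\<And>n. bilin_on sV U s W s W (\<lambda>v. YM v n)"
    and nonint: "\<And>v n w. v \<in> U \<Longrightarrow> w \<in> W \<Longrightarrow> n \<notin> \<int> \<Longrightarrow> YM v n w = 0"
    and trunc: "\<And>v w. v \<in> U \<Longrightarrow> w \<in> W \<Longrightarrow> \<exists>N. \<forall>n\<ge>N. YM v n w = 0"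
    and vac: "\<And>n w. w \<in> W \<Longrightarrow> YM vac n w = (if n = -1 then w else 0)"
    and jac: "\<And>u v w. u \<in> U \<Longrightarrow> v \<in> U \<Longrightarrow> w \<in> W \<Longrightarrow> jacobi_identity s (rat_modes Y) YM 0 u v w"
  shows "va_module sV U vac Y s W YM"
proof -
  interpret s: vector_space s by fact
  show ?thesis
  proof unfold_locales
    show "va_automorphism sV U vac Y id" by (auto simp: va_automorphism_def lin_on_def)
    show "\<exists>n>0. \<forall>v\<in>U. (id ^^ n) v = v" by auto
  qed (use assms in \<open>auto simp: sigma_eigenspace_def\<close>)
qed

text \<open>Regarding the algebra as a module over itself makes the density theorem available for
  \<open>V\<close> as well as for \<open>M\<close>.\<close>

lemma (in vertex_algebra) va_module_adjoint: "va_module sV U vac Y sV U (rat_modes Y)"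
proof (rule va_moduleI[OF vector_space_axioms subspace_U])
  show "bilin_on sV U sV U sV U (\<lambda>v. rat_modes Y v n)" for n
    using Y_bilinear[of "\<lfloor>n\<rfloor>"] subspace_U
    by (cases "n \<in> \<int>") (auto simp: bilin_on_def lin_on_def rat_modes_def subspace_0)
  show "\<exists>N. \<forall>n\<ge>N. rat_modes Y u n w = 0" if uw: "u \<in> U" "w \<in> U" for u w
  proof -
    obtain N where N: "\<forall>n\<ge>N. Y u n w = 0" using Y_truncated[OF uw] by blast
    have "rat_modes Y u n w = 0" if "n \<ge> of_int N" for n
      using N that by (auto simp: rat_modes_def le_floor_iff)
    then show ?thesis by blast
  qed
  show "rat_modes Y vac n w = (if n = -1 then w else 0)" if "w \<in> U" for n w
  proof (cases "n \<in> \<int>")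
    case True
    then obtain k where k: "n = of_int k" by (auto elim: Ints_cases)
    then have "n = -1 \<longleftrightarrow> k = -1" by (metis of_int_1 of_int_eq_iff of_int_minus)
    then show ?thesis using Y_vac[OF that] by (simp add: k rat_modes_def)
  qed (auto simp: rat_modes_def)
qed (auto simp: rat_modes_def jacobi)

context irreducible_full_module
begin

text \<open>Injectivity of \<open>V \<otimes> M \<rightarrow> M{z}\<close>: its kernel is stable under the action of \<open>V\<close> on the first factor,
  which is dense by simplicity.\<close>

lemma modes_separate:
  fixes e :: "'i \<Rightarrow> 'v" and y :: "'i \<Rightarrow> 'm"
  assumes simple: "irreducible_under sV UNIV (va_modes UNIV Y)"
    and J: "finite J" and e: "independent (e ` J)" "inj_on e J"
    and zero: "\<And>n. (\<Sum>j\<in>J. YM (e j) n (y j)) = 0" and j: "j \<in> J"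
  shows "y j = 0"
proof -
  interpret V: full_twisted_module sV vac Y id sV YV
    unfolding full_twisted_module_def by (rule va_module_adjoint)
  interpret V: irreducible_full_module sV vac Y id sV YV
  proof
    have "irreducible_under sV UNIV (va_modes UNIV YV)"
      unfolding irreducible_under_def
    proof (intro conjI allI impI)
      show "UNIV \<noteq> {0::'v}" using simple by (simp add: irreducible_under_def)
      fix N assume N: "subspace N \<and> N \<subseteq> UNIV \<and> (\<forall>a\<in>va_modes UNIV YV. a ` N \<subseteq> N)"
      have "Y v n ` N \<subseteq> N" for v n
      proof -
        have "YV v (of_int n) ` N \<subseteq> N" using N by (auto simp: va_modes_def)
        moreover have "YV v (of_int n) = Y v n" by (auto simp: rat_modes_def fun_eq_iff)
        ultimately show ?thesis by simp
      qed
      then have "\<forall>a\<in>va_modes UNIV Y. a ` N \<subseteq> N" by (auto simp: va_modes_def)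
      then show "N = {0} \<or> N = UNIV"
        using N simple unfolding irreducible_under_def by blast
    qed
    then show "irreducible_under sV UNIV (va_modes UNIV YV)" .
  qed (rule cd)
  have eigen: "(\<Sum>j\<in>J. YM (YV u q (e j)) n (y j)) = 0"
    if u: "r < T" "u \<in> E r" and zero: "\<And>n. (\<Sum>j\<in>J. YM (e j) n (y j)) = 0" for e :: "'i \<Rightarrow> 'v" and r u q n
  proof (cases "q \<in> \<int>")
    case False
    then show ?thesis by (simp add: rat_modes_def)
  next
    case True
    let ?r = "of_nat r / of_nat T :: rat"
    obtain s where sZ: "s - ?r \<in> \<int>" and s: "\<And>j i. j \<in> J \<Longrightarrow> YM u (s + of_nat i) (y j) = 0"
      using annihilating_shift[OF finite_imageI[OF J]] by (metis imageI)
    have main: "(\<Sum>j\<in>J. YM (YV u q (e j)) n (y j)) = 0"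
      if "q \<in> \<int>" "\<forall>j\<in>J. \<forall>i\<ge>K. YV u (q + of_nat i) (e j) = 0" for K q n
      using that
    proof (induction K arbitrary: q n)
      case 0
      have "\<forall>j\<in>J. YV u q (e j) = 0" using 0(2) by (metis add_0_right of_nat_0 order_refl)
      then show ?case by simp
    next
      case (Suc K)
      \<comment> \<open>With \<open>s + t = n\<close>, the term \<open>i = 0\<close> on the right of
        associativity is the wanted one. The terms with \<open>i > 0\<close> contain
        \<open>u_(q+i) (e j)\<close> and vanish by induction; the left side vanishes because its
        inner sums over \<open>J\<close> are instances of the given relation.\<close>
      define t where "t = n - s"
      obtain L where L: "\<forall>j\<in>J. \<forall>i\<ge>L. YM (e j) (t + of_nat i) (y j) = 0"
        using finite_uniform_index[OF J, of "\<lambda>j i. YM (e j) (t + of_nat i) (y j) = 0"]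
          truncation_index[OF truncated] by blast
      define I where "I = Suc (max L K)"
      define cL cR where "cL i = (-1) ^ i * (of_rat q gchoose i :: complex)"
        and "cR i = (-1) ^ i * (of_rat (of_nat i - s - 1) gchoose i :: complex)" for i :: nat
      have IH: "(\<Sum>j\<in>J. YM (YV u (q + of_nat (Suc i)) (e j)) n' (y j)) = 0" for i n'
      proof (rule Suc.IH)
        show "q + of_nat (Suc i) \<in> \<int>" by (rule Ints_add[OF Suc.prems(1)]) simp
        show "\<forall>j\<in>J. \<forall>k\<ge>K. YV u (q + of_nat (Suc i) + of_nat k) (e j) = 0"
        proof (intro ballI allI impI)
          fix j k assume "j \<in> J" "K \<le> k"
          then have "YV u (q + of_nat (Suc i + k)) (e j) = 0" by (intro Suc.prems(2)[rule_format]) simp_all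
          then show "YV u (q + of_nat (Suc i) + of_nat k) (e j) = 0" by (simp only: of_nat_add add.assoc)
        qed
      qed
      have "0 = (\<Sum>i<I. sM (cL i) (YM u (q + s - of_nat i) (\<Sum>j\<in>J. YM (e j) (t + of_nat i) (y j))))"
        by (simp add: zero)
      also have "\<dots> = (\<Sum>j\<in>J. \<Sum>i<I. sM (cL i) (YM u (q + s - of_nat i) (YM (e j) (t + of_nat i) (y j))))"
        by (subst sum.swap) (simp add: YM_sum M.scale_sum_right)
      also have "\<dots> = (\<Sum>j\<in>J. \<Sum>i<I. sM (cR i) (YM (YV u (q + of_nat i) (e j)) (s + t - of_nat i) (y j)))"
        unfolding cL_def cR_def using Suc.prems(1,2) L s
        by (intro sum.cong associativity_component[OF u sZ]) (auto simp: I_def)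
      also have "\<dots> = (\<Sum>i<I. sM (cR i) (\<Sum>j\<in>J. YM (YV u (q + of_nat i) (e j)) (s + t - of_nat i) (y j)))"
        by (subst sum.swap) (simp add: M.scale_sum_right)
      also have "\<dots> = (\<Sum>j\<in>J. YM (YV u q (e j)) n (y j))"
        unfolding I_def sum.lessThan_Suc_shift IH by (simp add: cR_def t_def)
      finally show ?case by simp
    qed
    obtain K where "\<forall>j\<in>J. \<forall>i\<ge>K. YV u (q + of_nat i) (e j) = 0"
      using finite_uniform_index[OF J, of "\<lambda>j i. YV u (q + of_nat i) (e j) = 0"]
        truncation_index[OF YV_truncated] by blast
    with main True show ?thesis by blast
  qed
  have step: "(\<Sum>j\<in>J. YM (YV u q (e j)) n (y j)) = 0" if zero: "\<And>n. (\<Sum>j\<in>J. YM (e j) n (y j)) = 0"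
    for u q n and e :: "'i \<Rightarrow> 'v"
  proof -
    obtain f where f: "\<And>r. r < T \<Longrightarrow> f r \<in> E r" "u = (\<Sum>r<T. f r)" using eigen_decomposition by blast
    have "(\<Sum>j\<in>J. YM (YV u q (e j)) n (y j)) = (\<Sum>r<T. \<Sum>j\<in>J. YM (YV (f r) q (e j)) n (y j))"
      unfolding f(2) V.YM_sum_left YM_sum_left by (rule sum.swap)
    also have "\<dots> = 0" using eigen[OF _ f(1) zero] by (intro sum.neutral) auto
    finally show ?thesis .
  qed
  have "\<forall>n. (\<Sum>j\<in>J. YM (a (e j)) n (y j)) = 0" if "a \<in> V.MS" for a
    using that by induction (simp_all add: step[OF zero] sum.distrib)
  \<comment> \<open>Density in \<open>V\<close> provides a sum of modes sending \<open>e j\<close>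
    to the vacuum and the other \<open>e i\<close> to 0; mode -1 of the vacuum then isolates
    \<open>y j\<close>.\<close>
  moreover obtain a where a: "a \<in> V.MS" "\<forall>b\<in>e ` J. a b = (if b = e j then vac else 0)"
    using V.modes_dense[of "e ` J" "\<lambda>b. if b = e j then vac else 0"] e J by auto
  ultimately have "0 = (\<Sum>i\<in>J. YM (a (e i)) (-1) (y i))"
    by metis
  also have "\<dots> = (\<Sum>i\<in>J. YM (if e i = e j then vac else 0) (-1) (y i))"
    using a(2) by (intro sum.cong) auto
  also have "\<dots> = (\<Sum>i\<in>J. if i = j then y i else 0)"
    using e(2) j YM_vac by (intro sum.cong) (auto simp: inj_on_def)
  also have "\<dots> = y j" using J j by simp
  finally show ?thesis by simp
qed

end

section \<open>Projective representations\<close>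

locale twisted_group =
  fixes G :: "('v \<Rightarrow> 'v) set" and \<alpha> :: "('v \<Rightarrow> 'v) \<Rightarrow> ('v \<Rightarrow> 'v) \<Rightarrow> complex"
  assumes finite_G: "finite G" and id_G: "id \<in> G"
    and comp_G: "g \<in> G \<Longrightarrow> h \<in> G \<Longrightarrow> g \<circ> h \<in> G"
    and inv_G: "g \<in> G \<Longrightarrow> inv g \<in> G" and bij_G: "g \<in> G \<Longrightarrow> bij g"
    and \<alpha>_nz: "g \<in> G \<Longrightarrow> h \<in> G \<Longrightarrow> \<alpha> g h \<noteq> 0"
begin

lemma inv_comp [simp]: "g \<in> G \<Longrightarrow> inv g \<circ> g = id" "g \<in> G \<Longrightarrow> g \<circ> inv g = id"
  using bij_G by (auto simp: bij_def surj_iff inj_iff)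

lemma bij_betw_translate:
  assumes "h \<in> G"
  shows "bij_betw (\<lambda>g. h \<circ> g) G G"
proof (rule bij_betw_byWitness[where f' = "\<lambda>g. inv h \<circ> g"])
  show "\<forall>g\<in>G. inv h \<circ> (h \<circ> g) = g" "\<forall>g\<in>G. h \<circ> (inv h \<circ> g) = g"
    using assms inv_comp by (simp_all flip: comp_assoc)
qed (use assms comp_G inv_G in auto)

lemma card_G_nz: "card G \<noteq> 0"
  using finite_G id_G by auto

end

text \<open>One notion covers \<open>M\<close> itself, the modules \<open>W \<chi>\<close>, the
  irreducible pieces of \<open>M\<close> and their coordinate models. It records the action of the
  basis elements only; the algebra action is recovered from it by linear extension.\<close>

locale proj_rep = twisted_group G \<alpha> + vector_space s
  for G :: "('v \<Rightarrow> 'v) set" and \<alpha> and s :: "complex \<Rightarrow> 'w::ab_group_add \<Rightarrow> 'w" +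
  fixes W :: "'w set" and R :: "('v \<Rightarrow> 'v) \<Rightarrow> 'w \<Rightarrow> 'w"
  assumes W: "subspace W" and R_lin: "g \<in> G \<Longrightarrow> lin_on s W s W (R g)"
    and R_id: "w \<in> W \<Longrightarrow> R id w = w"
    and R_mult: "g \<in> G \<Longrightarrow> h \<in> G \<Longrightarrow> w \<in> W \<Longrightarrow> R g (R h w) = s (\<alpha> g h) (R (g \<circ> h) w)"
begin

lemma R_mem: "g \<in> G \<Longrightarrow> w \<in> W \<Longrightarrow> R g w \<in> W"
  using R_lin by (rule lin_on_mem)

text \<open>The true inverse of \<open>R g\<close>: it differs from \<open>R (inv g)\<close> by a
  scalar because the representation is projective.\<close>

definition Rinv :: "('v \<Rightarrow> 'v) \<Rightarrow> 'w \<Rightarrow> 'w"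
  where "Rinv g w = s (1 / \<alpha> g (inv g)) (R (inv g) w)"

lemma Rinv_mem: "g \<in> G \<Longrightarrow> w \<in> W \<Longrightarrow> Rinv g w \<in> W"
  by (simp add: Rinv_def subspace_scale[OF W] R_mem inv_G)

lemma Rinv_lin:
  assumes "g \<in> G"
  shows "lin_on s W s W (Rinv g)"
  by (rule lin_onI)
    (use assms in \<open>auto simp: Rinv_mem, auto simp: Rinv_def lin_on_add[OF R_lin] lin_on_scale[OF R_lin]
      inv_G scale_right_distrib mult.commute\<close>)

lemma R_Rinv: "g \<in> G \<Longrightarrow> w \<in> W \<Longrightarrow> R g (Rinv g w) = w"
  by (simp add: Rinv_def lin_on_scale[OF R_lin] R_mem inv_G R_mult R_id \<alpha>_nz)

lemma R_inj:
  assumes "g \<in> G" "v \<in> W" "w \<in> W" "R g v = R g w"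
  shows "v = w"
proof -
  have "s (\<alpha> (inv g) g) v = s (\<alpha> (inv g) g) w"
    using arg_cong[OF assms(4), of "R (inv g)"] assms(1-3) by (simp add: R_mult inv_G R_id)
  then show ?thesis using \<alpha>_nz inv_G assms(1) by simp
qed

text \<open>Proved by applying the injective operator \<open>R (h \<circ> g)\<close>. The factor
  \<open>\<alpha> h g\<close> is exactly what turns \<open>R (h \<circ> g)\<close> into
  \<open>R h\<close> after \<open>R g\<close> when an average is reindexed.\<close>

lemma Rinv_comp:
  assumes "g \<in> G" "h \<in> G" "w \<in> W"
  shows "Rinv (h \<circ> g) (R h w) = s (\<alpha> h g) (Rinv g w)"
proof (rule R_inj)
  show "R (h \<circ> g) (Rinv (h \<circ> g) (R h w)) = R (h \<circ> g) (s (\<alpha> h g) (Rinv g w))"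
    using assms by (simp add: R_Rinv comp_G R_mem lin_on_scale[OF R_lin] Rinv_mem flip: R_mult)
qed (use assms in \<open>auto simp: comp_G Rinv_mem R_mem subspace_scale[OF W]\<close>)

definition irr :: bool where "irr \<longleftrightarrow> irreducible_under s W (R ` G)"

lemma orbit_stable:
  assumes "w \<in> W" "h \<in> G"
  shows "R h ` span ((\<lambda>g. R g w) ` G) \<subseteq> span ((\<lambda>g. R g w) ` G)"
proof -
  let ?S = "span ((\<lambda>g. R g w) ` G)"
  have sub: "?S \<subseteq> W"
    using assms by (intro span_minimal W) (auto intro: R_mem)
  have "?S \<subseteq> {x \<in> W. R h x \<in> ?S}"
  proof (rule span_minimal)
    show "subspace {x \<in> W. R h x \<in> ?S}"
      by (rule lin_on_subspace_preimage[OF vector_space_axioms vector_space_axioms R_lin[OF assms(2)] W]) simp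
    show "(\<lambda>g. R g w) ` G \<subseteq> {x \<in> W. R h x \<in> ?S}"
    proof safe
      fix g assume g: "g \<in> G"
      then show "R g w \<in> W" using assms by (simp add: R_mem)
      have "R (h \<circ> g) w \<in> ?S" using comp_G[OF assms(2) g] by (intro span_base) blast
      then show "R h (R g w) \<in> ?S" using g assms by (simp add: R_mult span_scale)
    qed
  qed
  then show ?thesis by blast
qed

lemma orbit_mem: "w \<in> W \<Longrightarrow> w \<in> span ((\<lambda>g. R g w) ` G)"
  using span_base[of "R id w" "(\<lambda>g. R g w) ` G"] id_G R_id by force

text \<open>The orbit of a nonzero vector is finite, and its span is stable, hence all of
  \<open>W\<close>.\<close>

lemma finite_basis:
  assumes irr
  shows "\<exists>B. finite B \<and> independent B \<and> span B = W"
proof -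
  obtain w where w: "w \<in> W" "w \<noteq> 0"
    using assms subspace_0[OF W] unfolding irr_def irreducible_under_def by blast
  let ?O = "(\<lambda>g. R g w) ` G"
  have sub: "span ?O \<subseteq> W"
    using w by (intro span_minimal W) (auto intro: R_mem)
  have "span ?O = {0} \<or> span ?O = W"
    using assms[unfolded irr_def irreducible_under_def] orbit_stable[OF w(1)] sub by auto
  then have span: "span ?O = W" using orbit_mem[OF w(1)] w(2) by blast
  obtain B where "B \<subseteq> ?O" "independent B" "?O \<subseteq> span B"
    by (rule maximal_independent_subset)
  moreover from this have "span B = span ?O"
    by (meson span_eq span_superset subset_trans)
  ultimately show ?thesis using finite_G span by (meson finite_imageI finite_subset)
qed

lemma basis_finite:
  assumes irr "independent B" "span B = W"
  shows "finite B"
proof -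
  obtain C where "finite C" "span C = W" using finite_basis[OF assms(1)] by blast
  then show ?thesis using independent_span_bound[of C B] assms(2,3) span_superset[of B] by auto
qed

lemma nontrivial: "irr \<Longrightarrow> \<exists>w\<in>W. w \<noteq> 0"
  using subspace_0[OF W] unfolding irr_def irreducible_under_def by blast

lemma sum_representation: "independent B \<Longrightarrow> finite B \<Longrightarrow> x \<in> span B \<Longrightarrow> (\<Sum>b\<in>B. s (representation B x b) b) = x"
  by (rule sum_representation_eq) auto

end

locale rep_pair = r1: proj_rep G \<alpha> s1 W1 R1 + r2: proj_rep G \<alpha> s2 W2 R2
  for G :: "('v \<Rightarrow> 'v) set" and \<alpha> and s1 :: "complex \<Rightarrow> 'a::ab_group_add \<Rightarrow> 'a" and W1 R1
    and s2 :: "complex \<Rightarrow> 'b::ab_group_add \<Rightarrow> 'b" and W2 R2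
begin

definition hom :: "('a \<Rightarrow> 'b) \<Rightarrow> bool"
  where "hom f \<longleftrightarrow> lin_on s1 W1 s2 W2 f \<and> (\<forall>g\<in>G. \<forall>x\<in>W1. f (R1 g x) = R2 g (f x))"

definition isomorphic :: bool
  where "isomorphic \<longleftrightarrow> (\<exists>f. hom f \<and> bij_betw f W1 W2)"

text \<open>Maschke's averaging without the division by \<open>card G\<close>; that factor reappears
  wherever the average is evaluated.\<close>

definition avg :: "('a \<Rightarrow> 'b) \<Rightarrow> 'a \<Rightarrow> 'b"
  where "avg f x = (\<Sum>g\<in>G. R2 g (f (r1.Rinv g x)))"

lemma avg_lin:
  assumes "lin_on s1 W1 s2 W2 f"
  shows "lin_on s1 W1 s2 W2 (avg f)"
proof (rule lin_onI)
  have mem: "f (r1.Rinv g x) \<in> W2" if "g \<in> G" "x \<in> W1" for g x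
    using that r1.Rinv_mem lin_on_mem[OF assms] by blast
  show "avg f x \<in> W2" if "x \<in> W1" for x
    unfolding avg_def using that by (intro r2.subspace_sum[OF r2.W] r2.R_mem mem)
  show "avg f (x + y) = avg f x + avg f y" if "x \<in> W1" "y \<in> W1" for x y
    using that unfolding avg_def
    by (simp add: lin_on_add[OF r1.Rinv_lin] lin_on_add[OF assms] r1.Rinv_mem lin_on_add[OF r2.R_lin] mem sum.distrib)
  show "avg f (s1 c x) = s2 c (avg f x)" if "x \<in> W1" for c x
    using that unfolding avg_def r2.scale_sum_right
    by (simp add: lin_on_scale[OF r1.Rinv_lin] lin_on_scale[OF assms] r1.Rinv_mem lin_on_scale[OF r2.R_lin] mem)
qed

lemma avg_hom:
  assumes f: "lin_on s1 W1 s2 W2 f"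
  shows "hom (avg f)"
  unfolding hom_def
proof (intro conjI ballI avg_lin[OF f])
  fix h x assume h: "h \<in> G" and x: "x \<in> W1"
  have mem: "f (r1.Rinv g x) \<in> W2" if "g \<in> G" for g
    using that x r1.Rinv_mem lin_on_mem[OF f] by blast
  have "avg f (R1 h x) = (\<Sum>g\<in>G. R2 (h \<circ> g) (f (r1.Rinv (h \<circ> g) (R1 h x))))"
    unfolding avg_def by (rule sum.reindex_bij_betw[OF r1.bij_betw_translate[OF h], symmetric])
  also have "\<dots> = (\<Sum>g\<in>G. R2 h (R2 g (f (r1.Rinv g x))))"
    using h x by (intro sum.cong)
      (simp_all add: r1.Rinv_comp lin_on_scale[OF f] r1.Rinv_mem lin_on_scale[OF r2.R_lin] r1.comp_G mem r2.R_mult)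
  also have "\<dots> = R2 h (avg f x)"
    unfolding avg_def
    by (rule lin_on_sum[OF r2.vector_space_axioms r2.R_lin[OF h] r2.W, symmetric]) (use mem r2.R_mem in blast)
  finally show "avg f (R1 h x) = R2 h (avg f x)" .
qed

lemma schur:
  assumes "r1.irr" "r2.irr" "hom f" "x \<in> W1" "f x \<noteq> 0"
  shows "bij_betw f W1 W2"
  using assms unfolding r1.irr_def r2.irr_def hom_def
  by (intro schur_bij[OF r1.vector_space_axioms r2.vector_space_axioms r1.W r2.W,
        where I = G and ?A1.0 = R1 and ?A2.0 = R2]) (auto simp: r1.R_lin r2.R_lin)

text \<open>The coordinate form of \<open>b\<close> tensored with \<open>y\<close>. Averages of
  these maps yield Schur's orthogonality relations.\<close>

definition rank_one :: "'a set \<Rightarrow> 'a \<Rightarrow> 'b \<Rightarrow> 'a \<Rightarrow> 'b"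
  where "rank_one B b y x = s2 (r1.representation B x b) y"

lemma rank_one_lin:
  assumes "r1.independent B" "r1.span B = W1" "y \<in> W2"
  shows "lin_on s1 W1 s2 W2 (rank_one B b y)"
  by (rule lin_onI) (use assms in \<open>auto simp: rank_one_def r2.subspace_scale[OF r2.W] r1.representation_add
      r1.representation_scale r2.scale_left_distrib\<close>)

lemma avg_rank_one:
  assumes "y \<in> W2"
  shows "avg (rank_one B b y) x = (\<Sum>g\<in>G. s2 (r1.representation B (r1.Rinv g x) b) (R2 g y))"
  unfolding avg_def rank_one_def using assms by (simp add: lin_on_scale[OF r2.R_lin])

lemma avg_rank_one_eq_0:
  assumes "r1.irr" "r2.irr" "\<not> isomorphic" "r1.independent B" "r1.span B = W1" "y \<in> W2" "x \<in> W1"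
  shows "avg (rank_one B b y) x = 0"
  using schur[OF assms(1,2) avg_hom[OF rank_one_lin[OF assms(4-6)]] assms(7)] assms(3)
    avg_hom[OF rank_one_lin[OF assms(4-6)]] unfolding isomorphic_def by blast

text \<open>The left side pairs the characters of the two representations, the first taken at
  inverses. Expanding the traces turns it into matrix entries of averaged rank-one maps, which
  Schur's lemma controls.\<close>

lemma trace_pairing:
  assumes "r2.independent C" "r2.span C = W2" "r1.span B = W1"
  shows "(\<Sum>g\<in>G. (\<Sum>b\<in>B. r1.representation B (r1.Rinv g b) b) * (\<Sum>c\<in>C. r2.representation C (R2 g c) c)) =
    (\<Sum>b\<in>B. \<Sum>c\<in>C. r2.representation C (avg (rank_one B b c) b) c)"
proof -
  have "r2.representation C (avg (rank_one B b c) b) c =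
    (\<Sum>g\<in>G. r1.representation B (r1.Rinv g b) b * r2.representation C (R2 g c) c)"
    if "b \<in> B" "c \<in> C" for b c
  proof -
    have c: "c \<in> W2" using assms(2) that r2.span_base by blast
    have mem: "R2 g c \<in> r2.span C" if "g \<in> G" for g using r2.R_mem[OF that c] assms(2) by simp
    show ?thesis
      unfolding avg_rank_one[OF c] using assms(1) mem
      by (simp add: r2.representation_sum r2.representation_scale r2.span_scale)
  qed
  then have "(\<Sum>b\<in>B. \<Sum>c\<in>C. r2.representation C (avg (rank_one B b c) b) c) =
    (\<Sum>b\<in>B. \<Sum>c\<in>C. \<Sum>g\<in>G. r1.representation B (r1.Rinv g b) b * r2.representation C (R2 g c) c)"
    by (intro sum.cong) auto
  also have "\<dots> = (\<Sum>b\<in>B. \<Sum>g\<in>G. \<Sum>c\<in>C. r1.representation B (r1.Rinv g b) b * r2.representation C (R2 g c) c)"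
    by (intro sum.cong refl sum.swap)
  also have "\<dots> = (\<Sum>g\<in>G. \<Sum>b\<in>B. \<Sum>c\<in>C. r1.representation B (r1.Rinv g b) b * r2.representation C (R2 g c) c)"
    by (rule sum.swap)
  finally show ?thesis by (simp add: sum_product)
qed

end

section \<open>Orthogonality within one irreducible representation\<close>

context proj_rep
begin

sublocale self: rep_pair G \<alpha> s W R s W R ..

lemma avg_rank_one_self:
  assumes irr "independent B" "span B = W" "y \<in> W"
  shows "\<exists>c. \<forall>x\<in>W. self.avg (self.rank_one B b y) x = s c x"
proof (rule schur_scalar[OF vector_space_axioms W, where C = B])
  show "irreducible_under s W (R ` G)" using assms(1) by (simp add: irr_def)
  show "countable B" using basis_finite[OF assms(1-3)] by (rule countable_finite)
  have *: "self.hom (self.avg (self.rank_one B b y))"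
    by (rule self.avg_hom[OF self.rank_one_lin[OF assms(2-4)]])
  then show "lin_on s W s W (self.avg (self.rank_one B b y))" by (simp add: self.hom_def)
  show "self.avg (self.rank_one B b y) (a x) = a (self.avg (self.rank_one B b y) x)" if "a \<in> R ` G" "x \<in> W" for a x
    using * that by (auto simp: self.hom_def)
qed (use assms R_lin in auto)

text \<open>The scalar by which the averaged rank-one map acts on an irreducible \<open>W\<close>.
  Taking traces identifies it as \<open>card G / dim W\<close> times the coordinate of
  \<open>y\<close> at \<open>b\<close>; below only its linearity in \<open>y\<close> and the sum
  over \<open>b\<close> are established.\<close>

definition coform :: "'w set \<Rightarrow> 'w \<Rightarrow> 'w \<Rightarrow> complex"
  where "coform B b y = (SOME c. \<forall>x\<in>W. self.avg (self.rank_one B b y) x = s c x)"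

lemma coform:
  assumes irr "independent B" "span B = W" "y \<in> W" "x \<in> W"
  shows "self.avg (self.rank_one B b y) x = s (coform B b y) x"
  using someI_ex[OF avg_rank_one_self[OF assms(1-4)]] assms(5) unfolding coform_def by blast

lemma coform_lin:
  assumes irr "independent B" "span B = W"
  shows "lin_on s W (*) UNIV (coform B b)"
proof -
  obtain x where x: "x \<in> W" "x \<noteq> 0" using nontrivial[OF assms(1)] by blast
  note c = coform[OF assms _ x(1), of _ b]
  show ?thesis
  proof (rule lin_onI)
    fix y z assume yz: "y \<in> W" "z \<in> W"
    then have "s (coform B b (y + z)) x = s (coform B b y + coform B b z) x"
      by (simp add: subspace_add[OF W] scale_left_distrib self.avg_rank_one lin_on_add[OF R_lin] scale_right_distrib
          sum.distrib flip: c)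
    then show "coform B b (y + z) = coform B b y + coform B b z" using x(2) by simp
  next
    fix k y assume y: "y \<in> W"
    have "s (coform B b (s k y)) x = s k (s (coform B b y) x)"
      using y by (simp add: subspace_scale[OF W] self.avg_rank_one lin_on_scale[OF R_lin] scale_sum_right mult.commute
          flip: c del: scale_scale) (simp add: mult.commute)
    then show "coform B b (s k y) = k * coform B b y" using x(2) by simp
  qed simp
qed

text \<open>The rank-one maps with \<open>y = b\<close> add up to the identity, whose average is
  multiplication by \<open>card G\<close>.\<close>

lemma sum_coform:
  assumes irr "independent B" "span B = W"
  shows "(\<Sum>b\<in>B. coform B b b) = of_nat (card G)"
proof -
  obtain x where x: "x \<in> W" "x \<noteq> 0" using nontrivial[OF assms(1)] by blast
  have B: "finite B" "B \<subseteq> W" using basis_finite[OF assms] assms(3) span_superset by auto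
  have "s (\<Sum>b\<in>B. coform B b b) x = (\<Sum>b\<in>B. self.avg (self.rank_one B b b) x)"
    using x B(2) by (simp add: scale_sum_left coform[OF assms] subset_iff)
  also have "\<dots> = (\<Sum>g\<in>G. \<Sum>b\<in>B. s (representation B (Rinv g x) b) (R g b))"
    using B(2) by (subst sum.swap) (simp add: self.avg_rank_one subset_iff)
  also have "\<dots> = (\<Sum>g\<in>G. R g (\<Sum>b\<in>B. s (representation B (Rinv g x) b) b))"
  proof (rule sum.cong[OF refl])
    fix g assume g: "g \<in> G"
    show "(\<Sum>b\<in>B. s (representation B (Rinv g x) b) (R g b)) = R g (\<Sum>b\<in>B. s (representation B (Rinv g x) b) b)"
      using B(2) by (subst lin_on_sum[OF vector_space_axioms R_lin[OF g] W])
        (auto intro!: subspace_scale[OF W] sum.cong simp: lin_on_scale[OF R_lin[OF g]])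
  qed
  also have "\<dots> = (\<Sum>g\<in>G. x)"
    using x assms B(1) by (intro sum.cong) (auto simp: sum_representation Rinv_mem R_Rinv)
  also have "\<dots> = s (of_nat (card G)) x" by (simp add: sum_constant_scale)
  finally show ?thesis using x(2) by simp
qed

lemma coform_nonzero:
  assumes irr "independent B" "span B = W"
  shows "\<exists>b\<in>B. coform B b b \<noteq> 0"
proof (rule ccontr)
  assume "\<not> ?thesis"
  then have "(\<Sum>b\<in>B. coform B b b) = 0" by (intro sum.neutral) simp
  then show False using card_G_nz by (simp add: sum_coform[OF assms])
qed

lemma trace_pairing_self:
  assumes irr "independent B" "span B = W"
  shows "(\<Sum>g\<in>G. (\<Sum>b\<in>B. representation B (Rinv g b) b) * (\<Sum>c\<in>B. representation B (R g c) c)) = of_nat (card G)"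
proof -
  have B: "finite B" "B \<subseteq> W" using basis_finite[OF assms] assms(3) span_superset by auto
  have "(\<Sum>c\<in>B. representation B (self.avg (self.rank_one B b c) b) c) = coform B b b" if b: "b \<in> B" for b
  proof -
    have "(\<Sum>c\<in>B. representation B (self.avg (self.rank_one B b c) b) c) = (\<Sum>c\<in>B. if b = c then coform B b b else 0)"
      using b B(2) assms
      by (intro sum.cong) (auto simp: coform subset_iff representation_scale span_base representation_basis)
    then show ?thesis using b B(1) by simp
  qed
  then show ?thesis unfolding self.trace_pairing[OF assms(2,3,3)] by (simp add: sum_coform[OF assms])
qed

text \<open>Exposes the basis that \<open>trace_on\<close> selects by choice; it is the same for all
  operators, so traces of several of them can be compared.\<close>

lemma trace_basis:
  assumes irr
  obtains B where "independent B" "span B = W" "finite B"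
    "\<And>f. trace_on s W f = (\<Sum>b\<in>B. representation B (f b) b)"
proof -
  define B where "B = (SOME B. independent B \<and> span B = W)"
  have "\<exists>B. independent B \<and> span B = W" using finite_basis[OF assms] by blast
  from someI_ex[OF this] have B: "independent B" "span B = W" by (auto simp: B_def)
  show ?thesis
    by (rule that[OF B basis_finite[OF assms B]]) (simp add: trace_on_def B_def Let_def)
qed

end

context rep_pair
begin

text \<open>For non-isomorphic representations the character pairing is 0, while equal traces would
  make it the pairing of the first one with itself, which is \<open>card G\<close>.\<close>

theorem isomorphic_if_trace_eq:
  assumes irr: "r1.irr" "r2.irr" and eq: "\<And>g. g \<in> G \<Longrightarrow> trace_on s1 W1 (R1 g) = trace_on s2 W2 (R2 g)"
  shows isomorphic
proof (rule ccontr)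
  assume niso: "\<not> isomorphic"
  obtain B where B: "r1.independent B" "r1.span B = W1" "finite B"
    "\<And>f. trace_on s1 W1 f = (\<Sum>b\<in>B. r1.representation B (f b) b)"
    using r1.trace_basis[OF irr(1)] by blast
  obtain C where C: "r2.independent C" "r2.span C = W2" "finite C"
    "\<And>f. trace_on s2 W2 f = (\<Sum>b\<in>C. r2.representation C (f b) b)"
    using r2.trace_basis[OF irr(2)] by blast
  have sub: "B \<subseteq> W1" "C \<subseteq> W2" using r1.span_superset[of B] r2.span_superset[of C] B(2) C(2) by auto
  have "of_nat (card G) =
    (\<Sum>g\<in>G. (\<Sum>b\<in>B. r1.representation B (r1.Rinv g b) b) * (\<Sum>c\<in>B. r1.representation B (R1 g c) c))"
    using r1.trace_pairing_self[OF irr(1) B(1,2)] by simp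
  also have "\<dots> = (\<Sum>g\<in>G. (\<Sum>b\<in>B. r1.representation B (r1.Rinv g b) b) * (\<Sum>c\<in>C. r2.representation C (R2 g c) c))"
    by (intro sum.cong refl arg_cong2[of _ _ _ _ "(*)"]) (use eq B(4) C(4) in auto)
  also have "\<dots> = 0"
    unfolding trace_pairing[OF C(1,2) B(2)]
    by (intro sum.neutral ballI)
      (use sub in \<open>simp add: avg_rank_one_eq_0[OF irr niso B(1,2)] subset_iff r2.representation_zero\<close>)
  finally show False using r1.card_G_nz by simp
qed

end

section \<open>Modules for the twisted group algebra\<close>

lemma tga_basis_in: "g \<in> G \<Longrightarrow> tga_basis g \<in> tga_carrier G"
  by (auto simp: tga_basis_def tga_carrier_def)

lemma (in vector_space) sum_scale_delta:
  assumes "finite A" "a \<in> A"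
  shows "(\<Sum>x\<in>A. scale (if x = a then 1 else 0) (f x)) = f a"
proof -
  have "(\<Sum>x\<in>A. scale (if x = a then 1 else 0) (f x)) = (\<Sum>x\<in>A. if x = a then f x else 0)"
    by (intro sum.cong) auto
  then show ?thesis using assms by simp
qed

lemma fscale_sum_apply: "(\<Sum>x\<in>A. fscale s (c x) (f x)) y = (\<Sum>x\<in>A. s (c x) (f x y))"
  by (induction A rule: infinite_finite_induct) (auto simp: fscale_def)

context twisted_group
begin

lemma tga_mult_basis:
  assumes "g \<in> G" "h \<in> G"
  shows "tga_mult G \<alpha> (tga_basis g) (tga_basis h) = fscale (*) (\<alpha> g h) (tga_basis (g \<circ> h))"
proof
  fix k
  let ?P = "{(x, y). x \<in> G \<and> y \<in> G \<and> x \<circ> y = k}"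
  have "finite ?P" by (rule finite_subset[of _ "G \<times> G"]) (use finite_G in auto)
  have "tga_mult G \<alpha> (tga_basis g) (tga_basis h) k = (\<Sum>p\<in>?P. if p = (g, h) then \<alpha> g h else 0)"
    unfolding tga_mult_def by (intro sum.cong) (auto simp: tga_basis_def split: if_splits)
  also have "\<dots> = (if (g, h) \<in> ?P then \<alpha> g h else 0)" using \<open>finite ?P\<close> by simp
  also have "\<dots> = fscale (*) (\<alpha> g h) (tga_basis (g \<circ> h)) k"
    using assms by (auto simp: fscale_def tga_basis_def)
  finally show "tga_mult G \<alpha> (tga_basis g) (tga_basis h) k = fscale (*) (\<alpha> g h) (tga_basis (g \<circ> h)) k" .
qed

lemma tga_expand:
  assumes "tga_module G \<alpha> s W \<rho>" "a \<in> tga_carrier G" "w \<in> W"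
  shows "\<rho> a w = (\<Sum>g\<in>G. s (a g) (\<rho> (tga_basis g) w))"
proof -
  interpret t: tga_module G \<alpha> s W \<rho> by fact
  interpret f: vector_space "fscale (*) :: complex \<Rightarrow> 'v tga \<Rightarrow> _"
    by (intro vector_space_fscale vector_space_times)
  have lin: "lin_on (fscale (*)) (tga_carrier G) s W (\<lambda>a. \<rho> a w)"
    using t.action_bilinear assms(3) by (auto simp: bilin_on_def)
  have sub: "f.subspace (tga_carrier G)"
    by (rule f.subspaceI) (auto simp: tga_carrier_def fscale_def)
  have "a = (\<Sum>g\<in>G. fscale (*) (a g) (tga_basis g))"
  proof
    fix k
    have "(\<Sum>g\<in>G. a g * tga_basis g k) = (\<Sum>g\<in>G. if g = k then a g else 0)"
      by (intro sum.cong) (auto simp: tga_basis_def)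
    also have "\<dots> = a k" using assms(2) finite_G by (auto simp: tga_carrier_def)
    finally show "a k = (\<Sum>g\<in>G. fscale (*) (a g) (tga_basis g)) k"
      unfolding fscale_sum_apply by simp
  qed
  then have "\<rho> a w = \<rho> (\<Sum>g\<in>G. fscale (*) (a g) (tga_basis g)) w" by simp
  also have "\<dots> = (\<Sum>g\<in>G. \<rho> (fscale (*) (a g) (tga_basis g)) w)"
    by (rule lin_on_sum[OF f.vector_space_axioms lin sub]) (auto intro: f.subspace_scale[OF sub] tga_basis_in)
  also have "\<dots> = (\<Sum>g\<in>G. s (a g) (\<rho> (tga_basis g) w))"
    by (intro sum.cong refl lin_on_scale[OF lin] tga_basis_in)
  finally show ?thesis .
qed

lemma tga_module_proj_rep:
  assumes "tga_module G \<alpha> s W \<rho>"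
  shows "proj_rep G \<alpha> s W (\<lambda>g. \<rho> (tga_basis g))"
proof -
  interpret t: tga_module G \<alpha> s W \<rho> by fact
  show ?thesis
  proof unfold_locales
    show "lin_on s W s W (\<rho> (tga_basis g))" if "g \<in> G" for g
      using t.action_bilinear tga_basis_in[OF that] by (auto simp: bilin_on_def)
    show "\<rho> (tga_basis g) (\<rho> (tga_basis h) w) = s (\<alpha> g h) (\<rho> (tga_basis (g \<circ> h)) w)"
      if "g \<in> G" "h \<in> G" "w \<in> W" for g h w
    proof -
      have lin: "lin_on (fscale (*)) (tga_carrier G) s W (\<lambda>a. \<rho> a w)"
        using t.action_bilinear that(3) by (auto simp: bilin_on_def)
      show ?thesis
        using t.action_mult[OF tga_basis_in[OF that(1)] tga_basis_in[OF that(2)] that(3)]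
        by (simp add: tga_mult_basis that(1,2) lin_on_scale[OF lin tga_basis_in[OF comp_G[OF that(1,2)]]])
    qed
  qed (auto simp: t.subspace_W t.action_one)
qed

lemma tga_subspace_stable:
  assumes "tga_module G \<alpha> s W \<rho>" "module.subspace s N" "N \<subseteq> W" "\<forall>g\<in>G. \<rho> (tga_basis g) ` N \<subseteq> N"
    "a \<in> tga_carrier G"
  shows "\<rho> a ` N \<subseteq> N"
proof -
  interpret t: tga_module G \<alpha> s W \<rho> by fact
  show ?thesis
    using assms(3,4) by (auto simp: tga_expand[OF assms(1,5)] subset_iff
        intro!: t.subspace_sum[OF assms(2)] t.subspace_scale[OF assms(2)])
qed

lemma simple_tga_module_irreducible:
  assumes "simple_tga_module G \<alpha> s W \<rho>"
  shows "irreducible_under s W ((\<lambda>g. \<rho> (tga_basis g)) ` G)"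
  unfolding irreducible_under_def
proof (intro conjI allI impI)
  have t: "tga_module G \<alpha> s W \<rho>" and irr: "irreducible_under s W (\<rho> ` tga_carrier G)"
    using assms by (auto simp: simple_tga_module_def)
  show "W \<noteq> {0}" using irr by (simp add: irreducible_under_def)
  fix N assume N: "module.subspace s N \<and> N \<subseteq> W \<and> (\<forall>a\<in>(\<lambda>g. \<rho> (tga_basis g)) ` G. a ` N \<subseteq> N)"
  then have "\<rho> a ` N \<subseteq> N" if "a \<in> tga_carrier G" for a
    using tga_subspace_stable[OF t _ _ _ that] by simp
  with N show "N = {0} \<or> N = W"
    using irr unfolding irreducible_under_def by blast
qed

end

context proj_rep
begin

definition tga_rep :: "'v tga \<Rightarrow> 'w \<Rightarrow> 'w"
  where "tga_rep a w = (\<Sum>g\<in>G. s (a g) (R g w))"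

lemma tga_rep_basis: "g \<in> G \<Longrightarrow> tga_rep (tga_basis g) w = R g w"
  unfolding tga_rep_def tga_basis_def by (rule sum_scale_delta[OF finite_G])

lemma tga_rep_mem: "w \<in> W \<Longrightarrow> tga_rep a w \<in> W"
  unfolding tga_rep_def by (intro subspace_sum[OF W] subspace_scale[OF W] R_mem)

lemma tga_rep_lin: "lin_on s W s W (tga_rep a)"
proof (rule lin_onI)
  show "tga_rep a (x + y) = tga_rep a x + tga_rep a y" if "x \<in> W" "y \<in> W" for x y
    using that by (simp add: tga_rep_def lin_on_add[OF R_lin] scale_right_distrib sum.distrib)
  show "tga_rep a (s c x) = s c (tga_rep a x)" if "x \<in> W" for c x
    using that by (simp add: tga_rep_def lin_on_scale[OF R_lin] scale_sum_right mult.commute)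
qed (rule tga_rep_mem)

lemma tga_rep_mult:
  assumes "w \<in> W"
  shows "tga_rep (tga_mult G \<alpha> a b) w = tga_rep a (tga_rep b w)"
proof -
  have "tga_rep a (tga_rep b w) = (\<Sum>g\<in>G. \<Sum>h\<in>G. s (a g) (R g (s (b h) (R h w))))"
    unfolding tga_rep_def
  proof (rule sum.cong[OF refl])
    fix g assume g: "g \<in> G"
    have "R g (\<Sum>h\<in>G. s (b h) (R h w)) = (\<Sum>h\<in>G. R g (s (b h) (R h w)))"
      by (rule lin_on_sum[OF vector_space_axioms R_lin[OF g] W]) (intro subspace_scale[OF W] R_mem assms)
    then show "s (a g) (R g (\<Sum>h\<in>G. s (b h) (R h w))) = (\<Sum>h\<in>G. s (a g) (R g (s (b h) (R h w))))"
      by (simp add: scale_sum_right)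
  qed
  also have "\<dots> = (\<Sum>g\<in>G. \<Sum>h\<in>G. s (a g * b h * \<alpha> g h) (R (g \<circ> h) w))"
    using assms by (intro sum.cong refl) (simp add: lin_on_scale[OF R_lin] R_mem R_mult mult.assoc)
  also have "\<dots> = (\<Sum>(g, h)\<in>G \<times> G. s (a g * b h * \<alpha> g h) (R (g \<circ> h) w))"
    by (rule sum.cartesian_product)
  also have "\<dots> = (\<Sum>k\<in>G. \<Sum>(g, h)\<in>{p \<in> G \<times> G. fst p \<circ> snd p = k}. s (a g * b h * \<alpha> g h) (R (g \<circ> h) w))"
    by (rule sum.group[symmetric]) (use finite_G comp_G in auto)
  also have "\<dots> = (\<Sum>k\<in>G. s (tga_mult G \<alpha> a b k) (R k w))"
  proof (rule sum.cong[OF refl])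
    fix k assume "k \<in> G"
    have eq: "{p \<in> G \<times> G. fst p \<circ> snd p = k} = {(g, h). g \<in> G \<and> h \<in> G \<and> g \<circ> h = k}" by auto
    show "(\<Sum>(g, h)\<in>{p \<in> G \<times> G. fst p \<circ> snd p = k}. s (a g * b h * \<alpha> g h) (R (g \<circ> h) w)) =
      s (tga_mult G \<alpha> a b k) (R k w)"
      unfolding tga_mult_def eq scale_sum_left by (intro sum.cong) auto
  qed
  finally show ?thesis by (simp add: tga_rep_def)
qed

lemma tga_module_rep: "tga_module G \<alpha> s W tga_rep"
proof unfold_locales
  show "bilin_on (fscale (*)) (tga_carrier G) s W s W tga_rep"
    unfolding bilin_on_def
  proof (intro conjI ballI tga_rep_lin)
    fix y assume "y \<in> W"
    then show "lin_on (fscale (*)) (tga_carrier G) s W (\<lambda>a. tga_rep a y)"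
      by (intro lin_onI tga_rep_mem)
        (simp_all add: tga_rep_def scale_left_distrib sum.distrib fscale_def scale_sum_right)
  qed
qed (auto simp: W tga_rep_mult tga_rep_basis id_G R_id)

lemma simple_tga_module_rep:
  assumes irr
  shows "simple_tga_module G \<alpha> s W tga_rep"
  unfolding simple_tga_module_def
proof
  show "irreducible_under s W (tga_rep ` tga_carrier G)"
    unfolding irreducible_under_def
  proof (intro conjI allI impI)
    show "W \<noteq> {0}" using assms by (simp add: irr_def irreducible_under_def)
    fix N assume N: "subspace N \<and> N \<subseteq> W \<and> (\<forall>a\<in>tga_rep ` tga_carrier G. a ` N \<subseteq> N)"
    have "R g ` N \<subseteq> N" if "g \<in> G" for g
      using N tga_basis_in[OF that] tga_rep_basis[OF that] by (metis (no_types, lifting) image_cong image_eqI)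
    with N show "N = {0} \<or> N = W" using assms unfolding irr_def irreducible_under_def by blast
  qed
qed (rule tga_module_rep)

lemma transport:
  assumes h: "vector_space s'" "lin_on s W s' UNIV h" "inj_on h W"
  defines "R' \<equiv> \<lambda>g y. h (R g (the_inv_into W h y))"
  shows "proj_rep G \<alpha> s' (h ` W) R'" "irr \<Longrightarrow> irreducible_under s' (h ` W) (R' ` G)"
    "x \<in> W \<Longrightarrow> R' g (h x) = h (R g x)"
proof -
  interpret s': vector_space s' by fact
  have inv: "the_inv_into W h (h x) = x" if "x \<in> W" for x by (rule the_inv_into_f_f[OF h(3) that])
  have R': "R' g (h x) = h (R g x)" if "x \<in> W" for g x by (simp add: R'_def inv that)
  then show "x \<in> W \<Longrightarrow> R' g (h x) = h (R g x)" .
  have h': "lin_on s W s' (h ` W) h" using h(2) by (auto simp: lin_on_def)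
  have sub: "s'.subspace (h ` W)" by (rule lin_on_subspace_image[OF vector_space_axioms h(1,2) W])
  show "proj_rep G \<alpha> s' (h ` W) R'"
  proof unfold_locales
    fix g assume g: "g \<in> G"
    have "lin_on s' (h ` W) s W (the_inv_into W h)"
      by (rule lin_on_inverse[OF vector_space_axioms h(1) h' W]) (use h(3) in \<open>simp add: bij_betw_def\<close>)
    from lin_on_compose[OF lin_on_compose[OF this R_lin[OF g]] h']
    show "lin_on s' (h ` W) s' (h ` W) (R' g)" by (simp add: R'_def)
  next
    fix g k y assume "g \<in> G" "k \<in> G" "y \<in> h ` W"
    then show "R' g (R' k y) = s' (\<alpha> g k) (R' (g \<circ> k) y)"
      by (auto simp: R' R_mem R_mult lin_on_scale[OF h(2)] comp_G)
  qed (use sub in \<open>auto simp: R' R_id\<close>)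
  show "irreducible_under s' (h ` W) (R' ` G)" if irr: irr
    unfolding irreducible_under_def
  proof (intro conjI allI impI)
    obtain w where w: "w \<in> W" "w \<noteq> 0" using nontrivial[OF irr] by blast
    then have "h w \<noteq> 0" using h(3) lin_on_inj_iff[OF vector_space_axioms h(1,2) W] by blast
    then show "h ` W \<noteq> {0}" using w(1) by blast
    fix N assume N: "s'.subspace N \<and> N \<subseteq> h ` W \<and> (\<forall>a\<in>R' ` G. a ` N \<subseteq> N)"
    let ?P = "{x \<in> W. h x \<in> N}"
    have "?P = {0} \<or> ?P = W"
    proof (rule irr[unfolded irr_def irreducible_under_def, THEN conjunct2, rule_format], intro conjI ballI)
      show "subspace ?P" using N by (intro lin_on_subspace_preimage[OF vector_space_axioms h(1,2) W]) simp
      fix a assume "a \<in> R ` G"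
      then obtain g where g: "g \<in> G" "a = R g" by blast
      have "h (R g x) \<in> N" if "x \<in> W" "h x \<in> N" for x
      proof -
        have "R' g (h x) \<in> N" using N g that by blast
        then show ?thesis using R' that by simp
      qed
      then show "a ` ?P \<subseteq> ?P" using g by (auto intro: R_mem)
    qed auto
    then have "h ` ?P = {0} \<or> h ` ?P = h ` W"
    proof
      assume "?P = {0}"
      then show ?thesis using lin_on_zero[OF h(2) subspace_0[OF W]] by simp
    qed simp
    moreover have "h ` ?P = N" using N by auto
    ultimately show "N = {0} \<or> N = h ` W" by (simp only:)
  qed
qed

text \<open>\<open>irreducible_characters\<close> refers to modules carried by functions on
  \<open>nat\<close>, so an irreducible subspace of \<open>M\<close> must be copied there before its
  character is known to belong to \<open>\<Lambda>\<close>.\<close>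

lemma coordinate_model:
  assumes irr
  shows "\<exists>(W' :: (nat \<Rightarrow> complex) set) \<rho>' h. simple_tga_module G \<alpha> (fscale (*)) W' \<rho>' \<and>
    lin_on s W (fscale (*)) W' h \<and> bij_betw h W W' \<and> (\<forall>g\<in>G. \<forall>x\<in>W. h (R g x) = \<rho>' (tga_basis g) (h x))"
proof -
  obtain B where B: "finite B" "independent B" "span B = W" using finite_basis[OF assms] by blast
  obtain e where e: "bij_betw e {0..<card B} B" using ex_bij_betw_nat_finite[OF B(1)] by blast
  define h :: "'w \<Rightarrow> nat \<Rightarrow> complex"
    where "h x i = (if i < card B then representation B x (e i) else 0)" for x i
  have vs: "vector_space (fscale (*) :: complex \<Rightarrow> (nat \<Rightarrow> complex) \<Rightarrow> _)"
    by (intro vector_space_fscale vector_space_times)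
  have lin: "lin_on s W (fscale (*)) UNIV h"
    using B by (intro lin_onI) (auto simp: h_def fscale_def fun_eq_iff representation_add representation_scale)
  have inj: "inj_on h W"
    unfolding lin_on_inj_iff[OF vector_space_axioms vs lin W]
  proof (intro ballI impI)
    fix x assume x: "x \<in> W" "h x = 0"
    have "representation B x b = 0" if "b \<in> B" for b
    proof -
      have "b \<in> e ` {0..<card B}" using e \<open>b \<in> B\<close> by (simp add: bij_betw_def)
      then obtain i where "i < card B" "b = e i" by auto
      then show ?thesis using fun_cong[OF x(2), of i] by (simp add: h_def)
    qed
    then have "(\<Sum>b\<in>B. s (representation B x b) b) = 0" by simp
    then show "x = 0" using sum_representation[OF B(2,1)] x(1) B(3) by simp
  qed
  define R' where "R' = (\<lambda>g y. h (R g (the_inv_into W h y)))"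
  note t = transport[OF vs lin inj, folded R'_def]
  interpret t: proj_rep G \<alpha> "fscale (*)" "h ` W" R' by (rule t(1))
  have "simple_tga_module G \<alpha> (fscale (*)) (h ` W) t.tga_rep"
    by (rule t.simple_tga_module_rep) (use t(2)[OF assms] in \<open>simp add: t.irr_def\<close>)
  moreover have "lin_on s W (fscale (*)) (h ` W) h" using lin by (auto simp: lin_on_def)
  moreover have "bij_betw h W (h ` W)" using inj by (simp add: bij_betw_def)
  moreover have "h (R g x) = t.tga_rep (tga_basis g) (h x)" if "g \<in> G" "x \<in> W" for g x
  proof -
    have "R' g (h x) = h (R g x)" using t(3)[OF that(2), of g] by (simp add: R'_def)
    then show ?thesis by (simp only: t.tga_rep_basis[OF that(1)])
  qed
  ultimately show ?thesis by blast
qed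

end

lemma representation_lin_on:
  assumes "vector_space s1" "vector_space s2"
    and B: "finite B" "\<not> module.dependent s1 B" "module.span s1 B = W1"
    and C: "\<not> module.dependent s2 C" "module.span s2 C = W2"
    and h: "lin_on s1 W1 s2 W2 h" and x: "x \<in> W1"
  shows "module.representation s2 C (h x) c =
    (\<Sum>b\<in>B. module.representation s1 B x b * module.representation s2 C (h b) c)"
proof -
  interpret s1: vector_space s1 by fact
  interpret s2: vector_space s2 by fact
  have W1: "s1.subspace W1" using B(3) by auto
  have BW: "B \<subseteq> W1" using B(3) s1.span_superset by blast
  have "x = (\<Sum>b\<in>B. s1 (s1.representation B x b) b)"
    using s1.sum_representation_eq[OF B(2), of x B] x B by auto
  then have "h x = h (\<Sum>b\<in>B. s1 (s1.representation B x b) b)" by simp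
  also have "\<dots> = (\<Sum>b\<in>B. s2 (s1.representation B x b) (h b))"
    using BW by (subst lin_on_sum[OF assms(1) h W1])
      (auto simp: lin_on_scale[OF h] subset_iff intro: s1.subspace_scale[OF W1])
  finally have "h x = (\<Sum>b\<in>B. s2 (s1.representation B x b) (h b))" .
  moreover have "h b \<in> s2.span C" if "b \<in> B" for b using lin_on_mem[OF h] that BW C(2) by blast
  ultimately show ?thesis
    by (simp add: s2.representation_sum[OF C(1)] s2.representation_scale[OF C(1)] s2.span_scale)
qed

text \<open>Invariance of the trace under cyclic exchange: the matrix of \<open>h\<close> after
  \<open>f\<close> is multiplied with that of the inverse \<open>k\<close> of \<open>h\<close>, in
  either order.\<close>

lemma trace_isomorphism:
  assumes "vector_space s1" "vector_space s2"
    and B: "finite B" "\<not> module.dependent s1 B" "module.span s1 B = W1"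
    and C: "finite C" "\<not> module.dependent s2 C" "module.span s2 C = W2"
    and h: "lin_on s1 W1 s2 W2 h" "bij_betw h W1 W2"
    and f: "lin_on s1 W1 s1 W1 f" "\<And>x. x \<in> W1 \<Longrightarrow> h (f x) = f' (h x)"
  shows "(\<Sum>b\<in>B. module.representation s1 B (f b) b) = (\<Sum>c\<in>C. module.representation s2 C (f' c) c)"
proof -
  interpret s1: vector_space s1 by fact
  interpret s2: vector_space s2 by fact
  define k where "k = the_inv_into W1 h"
  have "s1.subspace W1" using B(3) by auto
  then have k: "lin_on s2 W2 s1 W1 k" unfolding k_def by (rule lin_on_inverse[OF assms(1,2) h(1) _ h(2)])
  have hk: "h (k y) = y" if "y \<in> W2" for y
    using h(2) that f_the_inv_into_f[of h W1 y] by (auto simp: k_def bij_betw_def)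
  have kh: "k (h x) = x" if "x \<in> W1" for x
    using h(2) that the_inv_into_f_f[of h W1 x] by (auto simp: k_def bij_betw_def)
  have sub: "b \<in> B \<Longrightarrow> b \<in> W1" "c \<in> C \<Longrightarrow> c \<in> W2" for b c
    using B(3) C(3) s1.span_base s2.span_base by auto
  let ?r = "s1.representation B" and ?q = "s2.representation C"
  have "(\<Sum>c\<in>C. ?q (f' c) c) = (\<Sum>c\<in>C. \<Sum>b\<in>B. ?r (k c) b * ?q (h (f b)) c)"
  proof (rule sum.cong[OF refl])
    fix c assume c: "c \<in> C"
    have kc: "k c \<in> W1" by (rule lin_on_mem[OF k sub(2)[OF c]])
    have "f' c = h (f (k c))" using f(2)[OF kc] hk sub(2)[OF c] by simp
    then show "?q (f' c) c = (\<Sum>b\<in>B. ?r (k c) b * ?q (h (f b)) c)"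
      using representation_lin_on[OF assms(1,2) B C(2,3) lin_on_compose[OF f(1) h(1)] kc] by simp
  qed
  also have "\<dots> = (\<Sum>b\<in>B. \<Sum>c\<in>C. ?q (h (f b)) c * ?r (k c) b)"
    by (subst sum.swap) (simp add: mult.commute)
  also have "\<dots> = (\<Sum>b\<in>B. ?r (f b) b)"
    using representation_lin_on[OF assms(2,1) C B(2,3) k lin_on_mem[OF h(1) lin_on_mem[OF f(1)]]]
      kh lin_on_mem[OF f(1)] sub(1) by simp
  finally show ?thesis by simp
qed

lemma (in rep_pair) trace_eq_if_isomorphic:
  assumes "r1.irr" "r2.irr" isomorphic "g \<in> G"
  shows "trace_on s1 W1 (R1 g) = trace_on s2 W2 (R2 g)"
proof -
  obtain B where B: "r1.independent B" "r1.span B = W1" "finite B"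
    "\<And>f. trace_on s1 W1 f = (\<Sum>b\<in>B. r1.representation B (f b) b)"
    using r1.trace_basis[OF assms(1)] by blast
  obtain C where C: "r2.independent C" "r2.span C = W2" "finite C"
    "\<And>f. trace_on s2 W2 f = (\<Sum>b\<in>C. r2.representation C (f b) b)"
    using r2.trace_basis[OF assms(2)] by blast
  obtain h where h: "lin_on s1 W1 s2 W2 h" "bij_betw h W1 W2" "\<And>x. x \<in> W1 \<Longrightarrow> h (R1 g x) = R2 g (h x)"
    using assms(3,4) by (auto simp: isomorphic_def hom_def)
  show ?thesis
    unfolding B(4) C(4)
    by (rule trace_isomorphism[OF r1.vector_space_axioms r2.vector_space_axioms B(3,1,2) C(3,1,2) h(1,2)
          r1.R_lin[OF assms(4)] h(3)])
qed

section \<open>Isotypic decomposition\<close>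

lemma (in proj_rep) trace_combination:
  assumes irr "\<And>x. x \<in> W \<Longrightarrow> f x = (\<Sum>g\<in>G. s (a g) (R g x))"
  shows "trace_on s W f = (\<Sum>g\<in>G. a g * trace_on s W (R g))"
proof -
  obtain B where B: "independent B" "span B = W" "finite B"
    "\<And>f. trace_on s W f = (\<Sum>b\<in>B. representation B (f b) b)"
    using trace_basis[OF assms(1)] by blast
  have "representation B (f b) b = (\<Sum>g\<in>G. a g * representation B (R g b) b)" if "b \<in> B" for b
  proof -
    have b: "b \<in> W" using that B(2) span_base by blast
    have "R g b \<in> span B" if "g \<in> G" for g using R_mem[OF that b] B(2) by simp
    then show ?thesis
      by (simp add: assms(2)[OF b] representation_sum[OF B(1)] representation_scale[OF B(1)] span_scale)
  qed
  then show ?thesis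
    unfolding B(4) by (simp add: sum_distrib_left) (rule sum.swap)
qed

text \<open>The representation theory, stripped of vertex algebras. Of the assumptions beyond the
  projective representation on \<open>M\<close>, only \<open>faithful\<close> has content; the
  others describe the chosen simple modules and homomorphism spaces.\<close>

locale tga_decomposition = M: proj_rep G \<alpha> sM UNIV \<phi>
  for G :: "('v \<Rightarrow> 'v) set" and \<alpha> and sM :: "complex \<Rightarrow> 'm::ab_group_add \<Rightarrow> 'm" and \<phi> +
  fixes \<Lambda> :: "('v tga \<Rightarrow> complex) set"
    and sW :: "complex \<Rightarrow> 'w::ab_group_add \<Rightarrow> 'w"
    and W :: "('v tga \<Rightarrow> complex) \<Rightarrow> 'w set"
    and \<rho> :: "('v tga \<Rightarrow> complex) \<Rightarrow> 'v tga \<Rightarrow> 'w \<Rightarrow> 'w"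
    and N :: "('v tga \<Rightarrow> complex) \<Rightarrow> ('w \<Rightarrow> 'm) set"
  assumes faithful: "(\<And>m. (\<Sum>g\<in>G. sM (c g) (\<phi> g m)) = 0) \<Longrightarrow> g \<in> G \<Longrightarrow> c g = 0"
    and \<Lambda>: "\<Lambda> = irreducible_characters G \<alpha>"
    and W: "\<chi> \<in> \<Lambda> \<Longrightarrow> simple_tga_module G \<alpha> sW (W \<chi>) (\<rho> \<chi>)"
    and char: "\<chi> \<in> \<Lambda> \<Longrightarrow> tga_character G sW (W \<chi>) (\<rho> \<chi>) = \<chi>"
    and N: "\<chi> \<in> \<Lambda> \<Longrightarrow> N \<chi> = tga_hom G sW (W \<chi>) (\<rho> \<chi>) sM UNIV (tga_action G sM \<phi>)"
begin

definition R :: "('v tga \<Rightarrow> complex) \<Rightarrow> ('v \<Rightarrow> 'v) \<Rightarrow> 'w \<Rightarrow> 'w"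
  where "R \<chi> g = \<rho> \<chi> (tga_basis g)"

lemma tga_W: "\<chi> \<in> \<Lambda> \<Longrightarrow> tga_module G \<alpha> sW (W \<chi>) (\<rho> \<chi>)"
  using W by (auto simp: simple_tga_module_def)

lemma rep_W: "\<chi> \<in> \<Lambda> \<Longrightarrow> proj_rep G \<alpha> sW (W \<chi>) (R \<chi>)"
  using M.tga_module_proj_rep[OF tga_W] by (simp add: R_def[abs_def])

lemma irr_W:
  assumes "\<chi> \<in> \<Lambda>"
  shows "proj_rep.irr G sW (W \<chi>) (R \<chi>)"
proof -
  interpret r: proj_rep G \<alpha> sW "W \<chi>" "R \<chi>" by (rule rep_W[OF assms])
  show ?thesis
    unfolding r.irr_def using M.simple_tga_module_irreducible[OF W[OF assms]] by (simp add: R_def[abs_def])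
qed

lemma pair_M: "\<chi> \<in> \<Lambda> \<Longrightarrow> rep_pair G \<alpha> sW (W \<chi>) (R \<chi>) sM UNIV \<phi>"
  by (simp add: rep_pair_def rep_W M.proj_rep_axioms)

lemma pair_W: "\<chi> \<in> \<Lambda> \<Longrightarrow> \<psi> \<in> \<Lambda> \<Longrightarrow> rep_pair G \<alpha> sW (W \<chi>) (R \<chi>) sW (W \<psi>) (R \<psi>)"
  by (simp add: rep_pair_def rep_W)

lemma tga_action_eq: "tga_action G sM \<phi> = M.tga_rep"
  by (intro ext) (simp add: tga_action_def M.tga_rep_def)

lemma \<rho>_expand: "\<chi> \<in> \<Lambda> \<Longrightarrow> a \<in> tga_carrier G \<Longrightarrow> x \<in> W \<chi> \<Longrightarrow> \<rho> \<chi> a x = (\<Sum>g\<in>G. sW (a g) (R \<chi> g x))"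
  unfolding R_def by (rule M.tga_expand[OF tga_W])

lemma N_iff:
  assumes "\<chi> \<in> \<Lambda>"
  shows "f \<in> N \<chi> \<longleftrightarrow> lin_on sW (W \<chi>) sM UNIV f \<and> (\<forall>x. x \<notin> W \<chi> \<longrightarrow> f x = 0) \<and>
    (\<forall>g\<in>G. \<forall>x\<in>W \<chi>. f (R \<chi> g x) = \<phi> g (f x))"
proof -
  interpret r: proj_rep G \<alpha> sW "W \<chi>" "R \<chi>" by (rule rep_W[OF assms])
  have "(\<forall>a\<in>tga_carrier G. \<forall>x\<in>W \<chi>. f (\<rho> \<chi> a x) = M.tga_rep a (f x)) \<longleftrightarrow>
    (\<forall>g\<in>G. \<forall>x\<in>W \<chi>. f (R \<chi> g x) = \<phi> g (f x))" if f: "lin_on sW (W \<chi>) sM UNIV f"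
  proof (intro iffI ballI)
    fix g x assume *: "\<forall>a\<in>tga_carrier G. \<forall>x\<in>W \<chi>. f (\<rho> \<chi> a x) = M.tga_rep a (f x)" "g \<in> G" "x \<in> W \<chi>"
    show "f (R \<chi> g x) = \<phi> g (f x)"
      using *(1)[rule_format, OF tga_basis_in[OF *(2)] *(3)] by (simp add: R_def M.tga_rep_basis[OF *(2)])
  next
    fix a x assume *: "\<forall>g\<in>G. \<forall>x\<in>W \<chi>. f (R \<chi> g x) = \<phi> g (f x)" "a \<in> tga_carrier G" "x \<in> W \<chi>"
    have "f (\<rho> \<chi> a x) = (\<Sum>g\<in>G. f (sW (a g) (R \<chi> g x)))"
      unfolding \<rho>_expand[OF assms *(2,3)]
      by (rule lin_on_sum[OF r.vector_space_axioms f r.W]) (intro r.subspace_scale[OF r.W] r.R_mem *(3))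
    also have "\<dots> = M.tga_rep a (f x)"
      using * by (simp add: M.tga_rep_def lin_on_scale[OF f] r.R_mem)
    finally show "f (\<rho> \<chi> a x) = M.tga_rep a (f x)" .
  qed
  then show ?thesis
    unfolding N[OF assms] tga_hom_def tga_action_eq by blast
qed

lemma N_lin: "\<chi> \<in> \<Lambda> \<Longrightarrow> f \<in> N \<chi> \<Longrightarrow> lin_on sW (W \<chi>) sM UNIV f"
  and N_outside: "\<chi> \<in> \<Lambda> \<Longrightarrow> f \<in> N \<chi> \<Longrightarrow> x \<notin> W \<chi> \<Longrightarrow> f x = 0"
  and N_equiv: "\<chi> \<in> \<Lambda> \<Longrightarrow> f \<in> N \<chi> \<Longrightarrow> g \<in> G \<Longrightarrow> x \<in> W \<chi> \<Longrightarrow> f (R \<chi> g x) = \<phi> g (f x)"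
  using N_iff by blast+

lemma vector_space_hom: "vector_space (fscale sM :: complex \<Rightarrow> ('w \<Rightarrow> 'm) \<Rightarrow> _)"
  by (intro vector_space_fscale M.vector_space_axioms)

sublocale F: vector_space "fscale sM :: complex \<Rightarrow> ('w \<Rightarrow> 'm) \<Rightarrow> _"
  by (rule vector_space_hom)

lemma subspace_N: "\<chi> \<in> \<Lambda> \<Longrightarrow> F.subspace (N \<chi>)"
  by (rule F.subspaceI)
    (auto simp: N_iff fscale_def lin_on_def M.scale_right_distrib lin_on_add[OF M.R_lin] lin_on_scale[OF M.R_lin]
      lin_on_zero[OF M.R_lin] mult.commute)

text \<open>\<open>hom\<close> says nothing about values off the carrier, whereas elements of
  \<open>N \<chi>\<close> have to vanish there.\<close>

lemma restrict_hom:
  assumes "\<chi> \<in> \<Lambda>" "rep_pair.hom G sW (W \<chi>) (R \<chi>) sM UNIV \<phi> f"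
  shows "(\<lambda>x. if x \<in> W \<chi> then f x else 0) \<in> N \<chi>"
proof -
  interpret rep_pair G \<alpha> sW "W \<chi>" "R \<chi>" sM UNIV \<phi> by (rule pair_M[OF assms(1)])
  show ?thesis
    using assms(2) unfolding N_iff[OF assms(1)] hom_def
    by (auto simp: lin_on_def r1.R_mem r1.subspace_add[OF r1.W] r1.subspace_scale[OF r1.W])
qed

lemma character_eq_if_isomorphic:
  assumes "\<chi> \<in> \<Lambda>" "\<psi> \<in> \<Lambda>" "rep_pair.isomorphic G sW (W \<chi>) (R \<chi>) sW (W \<psi>) (R \<psi>)"
  shows "\<chi> = \<psi>"
proof -
  interpret rep_pair G \<alpha> sW "W \<chi>" "R \<chi>" sW "W \<psi>" "R \<psi>" by (rule pair_W[OF assms(1,2)])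
  have "trace_on sW (W \<chi>) (\<rho> \<chi> a) = trace_on sW (W \<psi>) (\<rho> \<psi> a)" if "a \<in> tga_carrier G" for a
    using r1.trace_combination[OF irr_W[OF assms(1)] \<rho>_expand[OF assms(1) that]]
      r2.trace_combination[OF irr_W[OF assms(2)] \<rho>_expand[OF assms(2) that]]
      trace_eq_if_isomorphic[OF irr_W[OF assms(1)] irr_W[OF assms(2)] assms(3)] by simp
  then have "tga_character G sW (W \<chi>) (\<rho> \<chi>) = tga_character G sW (W \<psi>) (\<rho> \<psi>)"
    by (auto simp: tga_character_def)
  then show ?thesis using char assms by simp
qed

text \<open>If all homomorphisms vanished, so would the averages of the rank-one maps. Read at a
  fixed \<open>x\<close>, such an average is a combination of the \<open>\<phi> g m\<close> whose
  coefficients do not depend on \<open>m\<close>; by \<open>faithful\<close> they are 0, and those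
  at the identity are the coordinates of \<open>x\<close>.\<close>

theorem N_nonzero:
  assumes \<chi>: "\<chi> \<in> \<Lambda>"
  shows "\<exists>f\<in>N \<chi>. \<exists>x\<in>W \<chi>. f x \<noteq> 0"
proof (rule ccontr)
  assume "\<not> ?thesis"
  then have zero: "f x = 0" if "f \<in> N \<chi>" "x \<in> W \<chi>" for f x using that by blast
  interpret rep_pair G \<alpha> sW "W \<chi>" "R \<chi>" sM UNIV \<phi> by (rule pair_M[OF \<chi>])
  have irr: "r1.irr" by (rule irr_W[OF \<chi>])
  obtain B where B: "finite B" "r1.independent B" "r1.span B = W \<chi>" using r1.finite_basis[OF irr] by blast
  obtain x where x: "x \<in> W \<chi>" "x \<noteq> 0" using r1.nontrivial[OF irr] by blast
  have "r1.representation B (r1.Rinv id x) b = 0" for b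
  proof (rule faithful[OF _ M.id_G])
    fix m
    have "hom (avg (rank_one B b m))" using B by (intro avg_hom rank_one_lin) auto
    from restrict_hom[OF \<chi> this] have "avg (rank_one B b m) x = 0" using zero x(1) by fastforce
    then show "(\<Sum>g\<in>G. sM (r1.representation B (r1.Rinv g x) b) (\<phi> g m)) = 0"
      by (simp add: avg_rank_one)
  qed
  then have "(\<Sum>b\<in>B. sW (r1.representation B (r1.Rinv id x) b) b) = 0" by simp
  then have "r1.Rinv id x = 0" using r1.sum_representation[OF B(2,1)] B(3) r1.Rinv_mem x(1) M.id_G by simp
  then have "x = R \<chi> id 0" using r1.R_Rinv[OF M.id_G x(1)] by simp
  then show False using x lin_on_zero[OF r1.R_lin[OF M.id_G] r1.subspace_0[OF r1.W]] by simp
qed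

text \<open>Each \<open>x \<in> W \<chi>\<close> gives an algebra element acting as the rank-one operator \<open>y \<mapsto> l y \<cdot> x\<close>
  on the \<open>\<chi>\<close>-isotypic part and as \<open>0\<close> on the others.\<close>

lemma rank_one_elements:
  assumes \<chi>: "\<chi> \<in> \<Lambda>"
  shows "\<exists>l. lin_on sW (W \<chi>) (*) UNIV l \<and> (\<exists>y\<in>W \<chi>. l y \<noteq> 0) \<and>
    (\<forall>x\<in>W \<chi>. \<exists>c. \<forall>\<psi>\<in>\<Lambda>. \<forall>f\<in>N \<psi>. \<forall>y\<in>W \<psi>.
      M.tga_rep c (f y) = (if \<psi> = \<chi> then sM (l y) (f x) else 0))"
proof -
  interpret r: proj_rep G \<alpha> sW "W \<chi>" "R \<chi>" by (rule rep_W[OF \<chi>])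
  have irr: "r.irr" by (rule irr_W[OF \<chi>])
  obtain B where B: "finite B" "r.independent B" "r.span B = W \<chi>" using r.finite_basis[OF irr] by blast
  obtain b where b: "b \<in> B" "r.coform B b b \<noteq> 0" using r.coform_nonzero[OF irr B(2,3)] by blast
  have bW: "b \<in> W \<chi>" using b(1) B(3) r.span_base by blast
  have "\<exists>c. \<forall>\<psi>\<in>\<Lambda>. \<forall>f\<in>N \<psi>. \<forall>y\<in>W \<psi>.
      M.tga_rep c (f y) = (if \<psi> = \<chi> then sM (r.coform B b y) (f x) else 0)" if x: "x \<in> W \<chi>" for x
  proof (intro exI ballI)
    fix \<psi> f y assume \<psi>: "\<psi> \<in> \<Lambda>" and f: "f \<in> N \<psi>" and y: "y \<in> W \<psi>"
    interpret p: rep_pair G \<alpha> sW "W \<chi>" "R \<chi>" sW "W \<psi>" "R \<psi>" by (rule pair_W[OF \<chi> \<psi>])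
    \<comment> \<open>With these coefficients the algebra element sends \<open>y\<close> to the
      average of a rank-one map evaluated at \<open>x\<close>. Schur's lemma makes that average a
      scalar for \<open>\<psi> = \<chi>\<close>, and 0 for other characters.\<close>
    let ?c = "\<lambda>g. r.representation B (r.Rinv g x) b"
    note lin = N_lin[OF \<psi> f]
    have "M.tga_rep ?c (f y) = (\<Sum>g\<in>G. f (sW (?c g) (R \<psi> g y)))"
      unfolding M.tga_rep_def using y by (simp add: lin_on_scale[OF lin] p.r2.R_mem N_equiv[OF \<psi> f])
    also have "\<dots> = f (\<Sum>g\<in>G. sW (?c g) (R \<psi> g y))"
      by (rule lin_on_sum[OF r.vector_space_axioms lin p.r2.W, symmetric])
        (intro r.subspace_scale[OF p.r2.W] p.r2.R_mem y)
    also have "(\<Sum>g\<in>G. sW (?c g) (R \<psi> g y)) = p.avg (p.rank_one B b y) x"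
      by (rule p.avg_rank_one[OF y, symmetric])
    also have "f \<dots> = (if \<psi> = \<chi> then sM (r.coform B b y) (f x) else 0)"
    proof (cases "\<psi> = \<chi>")
      case True
      then show ?thesis
        using r.coform[OF irr B(2,3) _ x, of y b] y x lin by (simp add: lin_on_scale)
    next
      case False
      then have "\<not> p.isomorphic" using character_eq_if_isomorphic[OF \<chi> \<psi>] by blast
      then have "p.avg (p.rank_one B b y) x = 0"
        using p.avg_rank_one_eq_0[OF irr irr_W[OF \<psi>] _ B(2,3) y x] by blast
      then show ?thesis using False lin_on_zero[OF lin r.subspace_0[OF p.r2.W]] by simp
    qed
    finally show "M.tga_rep ?c (f y) = (if \<psi> = \<chi> then sM (r.coform B b y) (f x) else 0)" .
  qed
  then show ?thesis using r.coform_lin[OF irr B(2,3), of b] b(2) bW by blast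
qed

text \<open>Translating the relation by \<open>\<phi> g\<close> and applying a rank-one element
  removes every character but \<chi>, and leaves a relation between the homomorphisms in
  \<open>F \<chi>\<close> with coefficients \<open>l (R \<chi> g (w \<chi> f))\<close>. A single
  linear form \<open>l\<close> sees too little of \<open>w \<chi> f\<close>, so all translates are
  used.\<close>

theorem independence:
  assumes K: "finite K" "K \<subseteq> \<Lambda>" and F: "\<And>\<chi>. \<chi> \<in> K \<Longrightarrow> finite (F \<chi>) \<and> F \<chi> \<subseteq> N \<chi> \<and> F.independent (F \<chi>)"
    and w: "\<And>\<chi> f. \<chi> \<in> K \<Longrightarrow> f \<in> F \<chi> \<Longrightarrow> w \<chi> f \<in> W \<chi>"
    and zero: "(\<Sum>\<chi>\<in>K. \<Sum>f\<in>F \<chi>. f (w \<chi> f)) = 0"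
    and \<chi>: "\<chi> \<in> K" and f: "f \<in> F \<chi>"
  shows "w \<chi> f = 0"
proof -
  have \<chi>\<Lambda>: "\<chi> \<in> \<Lambda>" using \<chi> K by blast
  interpret r: proj_rep G \<alpha> sW "W \<chi>" "R \<chi>" by (rule rep_W[OF \<chi>\<Lambda>])
  obtain l y where l: "lin_on sW (W \<chi>) (*) UNIV l" "y \<in> W \<chi>" "l y \<noteq> 0"
    "\<And>x. x \<in> W \<chi> \<Longrightarrow> \<exists>c. \<forall>\<psi>\<in>\<Lambda>. \<forall>f\<in>N \<psi>. \<forall>y\<in>W \<psi>.
      M.tga_rep c (f y) = (if \<psi> = \<chi> then sM (l y) (f x) else 0)"
    using rank_one_elements[OF \<chi>\<Lambda>] by blast
  have lw: "l (R \<chi> g (w \<chi> f)) = 0" if g: "g \<in> G" for g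
  proof -
    have "(\<Sum>f\<in>F \<chi>. fscale sM (l (R \<chi> g (w \<chi> f))) f) x = 0" for x
    proof (cases "x \<in> W \<chi>")
      case False
      then have "f x = 0" if "f \<in> F \<chi>" for f using that F[OF \<chi>] N_outside[OF \<chi>\<Lambda>] by blast
      then show ?thesis by (auto simp: fscale_sum_apply intro!: sum.neutral)
    next
      case True
      then obtain c where c: "\<And>\<psi> f y. \<psi> \<in> \<Lambda> \<Longrightarrow> f \<in> N \<psi> \<Longrightarrow> y \<in> W \<psi> \<Longrightarrow>
        M.tga_rep c (f y) = (if \<psi> = \<chi> then sM (l y) (f x) else 0)" using l(4) by blast
      have "0 = M.tga_rep c (\<phi> g (\<Sum>\<psi>\<in>K. \<Sum>f\<in>F \<psi>. f (w \<psi> f)))"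
        unfolding zero using lin_on_zero[OF M.R_lin[OF g]] lin_on_zero[OF M.tga_rep_lin] by simp
      also have "\<dots> = (\<Sum>\<psi>\<in>K. \<Sum>f\<in>F \<psi>. M.tga_rep c (\<phi> g (f (w \<psi> f))))"
        by (simp add: lin_on_sum[OF M.vector_space_axioms M.R_lin[OF g]]
            lin_on_sum[OF M.vector_space_axioms M.tga_rep_lin])
      also have "\<dots> = (\<Sum>\<psi>\<in>K. if \<psi> = \<chi> then \<Sum>f\<in>F \<chi>. sM (l (R \<chi> g (w \<chi> f))) (f x) else 0)"
      proof (rule sum.cong[OF refl])
        fix \<psi> assume \<psi>: "\<psi> \<in> K"
        then have \<psi>\<Lambda>: "\<psi> \<in> \<Lambda>" using K by blast
        interpret q: proj_rep G \<alpha> sW "W \<psi>" "R \<psi>" by (rule rep_W[OF \<psi>\<Lambda>])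
        have "M.tga_rep c (\<phi> g (f (w \<psi> f))) = (if \<psi> = \<chi> then sM (l (R \<chi> g (w \<chi> f))) (f x) else 0)"
          if f: "f \<in> F \<psi>" for f
        proof -
          have fN: "f \<in> N \<psi>" using f F[OF \<psi>] by blast
          have "\<phi> g (f (w \<psi> f)) = f (R \<psi> g (w \<psi> f))" by (rule N_equiv[OF \<psi>\<Lambda> fN g w[OF \<psi> f], symmetric])
          then show ?thesis using c[OF \<psi>\<Lambda> fN q.R_mem[OF g w[OF \<psi> f]]] by auto
        qed
        then show "(\<Sum>f\<in>F \<psi>. M.tga_rep c (\<phi> g (f (w \<psi> f)))) =
          (if \<psi> = \<chi> then \<Sum>f\<in>F \<chi>. sM (l (R \<chi> g (w \<chi> f))) (f x) else 0)" by auto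
      qed
      also have "\<dots> = (\<Sum>f\<in>F \<chi>. sM (l (R \<chi> g (w \<chi> f))) (f x))" using K(1) \<chi> by simp
      finally show ?thesis by (simp add: fscale_sum_apply)
    qed
    then have "(\<Sum>f\<in>F \<chi>. fscale sM (l (R \<chi> g (w \<chi> f))) f) = 0" by (simp add: fun_eq_iff)
    then show ?thesis using F.independentD[of "F \<chi>" "F \<chi>" "\<lambda>f. l (R \<chi> g (w \<chi> f))" f] F[OF \<chi>] f by auto
  qed
  \<comment> \<open>The common kernel of the translates of \<open>l\<close> is stable and misses
    \<open>y\<close>, so irreducibility makes it zero.\<close>
  define P where "P = {x \<in> W \<chi>. \<forall>g\<in>G. l (R \<chi> g x) = 0}"
  have "P = {0} \<or> P = W \<chi>"
  proof (rule irr_W[OF \<chi>\<Lambda>, unfolded r.irr_def irreducible_under_def, THEN conjunct2, rule_format], intro conjI ballI)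
    show "r.subspace P"
      by (rule r.subspaceI)
        (auto simp: P_def r.subspace_0[OF r.W] r.subspace_add[OF r.W] r.subspace_scale[OF r.W] r.R_mem
          lin_on_zero[OF r.R_lin] lin_on_add[OF r.R_lin] lin_on_scale[OF r.R_lin]
          lin_on_zero[OF l(1)] lin_on_add[OF l(1)] lin_on_scale[OF l(1)])
    fix a assume "a \<in> R \<chi> ` G"
    then obtain h where h: "h \<in> G" "a = R \<chi> h" by blast
    then show "a ` P \<subseteq> P"
      by (auto simp: P_def r.R_mem r.R_mult M.comp_G lin_on_scale[OF l(1)])
  qed (auto simp: P_def)
  moreover have "y \<notin> P" using l(2,3) M.id_G r.R_id by (force simp: P_def)
  moreover have "w \<chi> f \<in> P" using lw w[OF \<chi> f] by (auto simp: P_def)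
  ultimately show ?thesis using l(2) by blast
qed

text \<open>The character of a coordinate copy of \<open>S\<close> is some
  \<open>\<psi> \<in> \<Lambda>\<close>. Equality of traces then makes \<open>W \<psi>\<close>
  isomorphic to that copy, and going back through the coordinates gives a homomorphism from
  \<open>W \<psi>\<close> into \<open>S\<close>.\<close>

lemma irreducible_sub_in_isotypic:
  assumes S: "M.subspace S" "\<And>g. g \<in> G \<Longrightarrow> \<phi> g ` S \<subseteq> S" "irreducible_under sM S (\<phi> ` G)"
  shows "\<exists>\<chi>\<in>\<Lambda>. \<exists>f\<in>N \<chi>. \<exists>x\<in>W \<chi>. f x \<in> S \<and> f x \<noteq> 0"
proof -
  interpret S: proj_rep G \<alpha> sM S \<phi>
  proof unfold_locales
    show "lin_on sM S sM S (\<phi> g)" if "g \<in> G" for g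
      using M.R_lin[OF that] S(2)[OF that] by (auto simp: lin_on_def)
  qed (use S(1) M.R_id M.R_mult in auto)
  have irrS: "S.irr" using S(3) by (simp add: S.irr_def)
  obtain W' :: "(nat \<Rightarrow> complex) set" and \<rho>' h where W': "simple_tga_module G \<alpha> (fscale (*)) W' \<rho>'"
    and h: "lin_on sM S (fscale (*)) W' h" "bij_betw h S W'"
      "\<And>g x. g \<in> G \<Longrightarrow> x \<in> S \<Longrightarrow> h (\<phi> g x) = \<rho>' (tga_basis g) (h x)"
    using S.coordinate_model[OF irrS] by blast
  define \<psi> where "\<psi> = tga_character G (fscale (*)) W' \<rho>'"
  have \<psi>: "\<psi> \<in> \<Lambda>" unfolding \<Lambda> irreducible_characters_def \<psi>_def using W' by blast
  have t': "tga_module G \<alpha> (fscale (*)) W' \<rho>'" using W' by (simp add: simple_tga_module_def)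
  interpret p: rep_pair G \<alpha> sW "W \<psi>" "R \<psi>" "fscale (*)" W' "\<lambda>g. \<rho>' (tga_basis g)"
    by (simp add: rep_pair_def rep_W[OF \<psi>] M.tga_module_proj_rep[OF t'])
  have irr': "p.r2.irr" unfolding p.r2.irr_def by (rule M.simple_tga_module_irreducible[OF W'])
  have "trace_on sW (W \<psi>) (R \<psi> g) = trace_on (fscale (*)) W' (\<rho>' (tga_basis g))" if "g \<in> G" for g
    using fun_cong[OF char[OF \<psi>], of "tga_basis g"] tga_basis_in[OF that]
    by (simp add: \<psi>_def tga_character_def R_def)
  from p.isomorphic_if_trace_eq[OF irr_W[OF \<psi>] irr' this]
  obtain e where e: "p.hom e" "bij_betw e (W \<psi>) W'" by (auto simp: p.isomorphic_def)
  define k where "k = the_inv_into S h"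
  have k: "lin_on (fscale (*)) W' sM S k"
    unfolding k_def by (rule lin_on_inverse[OF M.vector_space_axioms p.r2.vector_space_axioms h(1) S(1) h(2)])
  have hk: "h (k y) = y" if "y \<in> W'" for y
    using h(2) that f_the_inv_into_f[of h S y] by (auto simp: k_def bij_betw_def)
  have kh: "k (h x) = x" if "x \<in> S" for x
    using h(2) that the_inv_into_f_f[of h S x] by (auto simp: k_def bij_betw_def)
  interpret q: rep_pair G \<alpha> sW "W \<psi>" "R \<psi>" sM UNIV \<phi> by (rule pair_M[OF \<psi>])
  have eW: "e x \<in> W'" if "x \<in> W \<psi>" for x using e(1) that lin_on_mem by (auto simp: p.hom_def)
  have "q.hom (\<lambda>x. k (e x))"
    unfolding q.hom_def
  proof (intro conjI ballI)
    have "lin_on sW (W \<psi>) sM S (\<lambda>x. k (e x))"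
      by (rule lin_on_compose[OF _ k]) (use e(1) in \<open>simp add: p.hom_def\<close>)
    then show "lin_on sW (W \<psi>) sM UNIV (\<lambda>x. k (e x))" by (simp add: lin_on_def)
    fix g x assume gx: "g \<in> G" "x \<in> W \<psi>"
    have kx: "k (e x) \<in> S" using lin_on_mem[OF k] eW gx(2) by blast
    have "e (R \<psi> g x) = \<rho>' (tga_basis g) (h (k (e x)))" using e(1) gx hk eW by (simp add: p.hom_def)
    also have "\<dots> = h (\<phi> g (k (e x)))" by (rule h(3)[OF gx(1) kx, symmetric])
    finally show "k (e (R \<psi> g x)) = \<phi> g (k (e x))"
      using kh S(2)[OF gx(1)] kx by auto
  qed
  from restrict_hom[OF \<psi> this] have N: "(\<lambda>x. if x \<in> W \<psi> then k (e x) else 0) \<in> N \<psi>" .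
  obtain s where s: "s \<in> S" "s \<noteq> 0" using S.nontrivial[OF irrS] by blast
  have "h s \<in> e ` W \<psi>" using lin_on_mem[OF h(1) s(1)] e(2) by (simp add: bij_betw_def)
  then obtain x where x: "x \<in> W \<psi>" "e x = h s" by auto
  then have "k (e x) = s" using kh s by simp
  then show ?thesis using N \<psi> x(1) s by (intro bexI[OF _ \<psi>] bexI[OF _ N] bexI[OF _ x(1)]) auto
qed

text \<open>\<open>M\<close> may be infinite-dimensional, but the orbit of \<open>z\<close> spans a
  finite-dimensional stable subspace. Among finite independent sets whose span is nonzero, stable
  and inside \<open>K\<close>, one of least size spans an irreducible subspace.\<close>

lemma irreducible_sub_exists:
  assumes K: "M.subspace K" "\<And>g. g \<in> G \<Longrightarrow> \<phi> g ` K \<subseteq> K" "z \<in> K" "z \<noteq> 0"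
  shows "\<exists>S. M.subspace S \<and> S \<subseteq> K \<and> (\<forall>g\<in>G. \<phi> g ` S \<subseteq> S) \<and> irreducible_under sM S (\<phi> ` G)"
proof -
  define P where "P B \<longleftrightarrow> finite B \<and> M.independent B \<and> M.span B \<noteq> {0} \<and> M.span B \<subseteq> K \<and>
    (\<forall>g\<in>G. \<phi> g ` M.span B \<subseteq> M.span B)" for B
  have "\<exists>B. P B"
  proof -
    let ?O = "(\<lambda>g. \<phi> g z) ` G"
    obtain B where B: "B \<subseteq> ?O" "M.independent B" "?O \<subseteq> M.span B" by (rule M.maximal_independent_subset)
    have span: "M.span B = M.span ?O" using B by (meson M.span_eq M.span_superset subset_trans)
    have "M.span ?O \<subseteq> K" using K by (intro M.span_minimal) auto
    then have "P B"
      using B(1,2) span M.orbit_mem[of z] M.orbit_stable[of z] K(4) M.finite_G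
      by (auto simp: P_def intro: finite_subset)
    then show ?thesis ..
  qed
  then obtain B where B: "P B" "\<And>C. P C \<Longrightarrow> card B \<le> card C"
    using ex_has_least_nat[of P _ card] by metis
  let ?S = "M.span B"
  have "irreducible_under sM ?S (\<phi> ` G)"
    unfolding irreducible_under_def
  proof (intro conjI allI impI)
    show "?S \<noteq> {0}" using B(1) by (simp add: P_def)
    fix T assume T: "M.subspace T \<and> T \<subseteq> ?S \<and> (\<forall>a\<in>\<phi> ` G. a ` T \<subseteq> T)"
    obtain C where C: "C \<subseteq> T" "M.independent C" "T \<subseteq> M.span C" by (rule M.maximal_independent_subset)
    have spanC: "M.span C = T" using C T by (metis M.span_subspace)
    have bound: "finite D \<and> card D \<le> card B" if "M.independent D" "D \<subseteq> ?S" for D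
      using M.independent_span_bound[OF _ that] B(1) by (simp add: P_def)
    show "T = {0} \<or> T = ?S"
    proof (rule ccontr)
      assume "\<not> (T = {0} \<or> T = ?S)"
      then have "T \<noteq> {0}" "\<not> ?S \<subseteq> T" using T by (simp, metis subset_antisym)
      then obtain x where x: "x \<in> ?S" "x \<notin> T" by (meson subsetI)
      have "?S \<subseteq> K" using B(1) by (simp add: P_def)
      then have "T \<subseteq> K" using T by (meson subset_trans)
      moreover have "finite C" using bound[OF C(2)] C(1) T by (meson subset_trans)
      ultimately have "P C" using \<open>T \<noteq> {0}\<close> C(2) T by (simp add: P_def spanC)
      then have le: "card B \<le> card C" by (rule B(2))
      have "M.independent (insert x C)" using x(2) spanC C(2) by (simp add: M.independent_insert M.span_base)
      then have "card (insert x C) \<le> card B" using bound[of "insert x C"] x(1) C(1) T by auto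
      moreover have "finite C" "x \<notin> C" using bound[of C] C T x(2) by auto
      ultimately show False using le by simp
    qed
  qed
  then show ?thesis using B(1) by (intro exI[of _ ?S]) (auto simp: P_def)
qed

definition isotypic :: "'m set"
  where "isotypic = {f w |f w \<chi>. \<chi> \<in> \<Lambda> \<and> f \<in> N \<chi> \<and> w \<in> W \<chi>}"

text \<open>By Maschke averaging \<open>span isotypic\<close> has a stable complement; it contains no irreducible
  subspace, hence vanishes.\<close>

theorem isotypic_spans: "M.span isotypic = UNIV"
proof (rule ccontr)
  assume "M.span isotypic \<noteq> UNIV"
  then obtain x0 where x0: "x0 \<notin> M.span isotypic" by blast
  let ?Z = "M.span isotypic"
  interpret MM: vector_space_pair sM sM ..
  have stable: "\<phi> g x \<in> ?Z" if g: "g \<in> G" and x: "x \<in> ?Z" for g x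
  proof -
    have "?Z \<subseteq> {x \<in> UNIV. \<phi> g x \<in> ?Z}"
    proof (rule M.span_minimal)
      show "M.subspace {x \<in> UNIV. \<phi> g x \<in> ?Z}"
        by (rule lin_on_subspace_preimage[OF M.vector_space_axioms M.vector_space_axioms M.R_lin[OF g]]) auto
      show "isotypic \<subseteq> {x \<in> UNIV. \<phi> g x \<in> ?Z}"
      proof
        fix x assume "x \<in> isotypic"
        then obtain f w \<chi> where *: "x = f w" "\<chi> \<in> \<Lambda>" "f \<in> N \<chi>" "w \<in> W \<chi>" by (auto simp: isotypic_def)
        interpret r: proj_rep G \<alpha> sW "W \<chi>" "R \<chi>" by (rule rep_W[OF *(2)])
        have "\<phi> g x = f (R \<chi> g w)" using N_equiv[OF *(2,3) g *(4)] *(1) by simp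
        moreover have "f (R \<chi> g w) \<in> isotypic" using * r.R_mem[OF g *(4)] by (auto simp: isotypic_def)
        ultimately show "x \<in> {x \<in> UNIV. \<phi> g x \<in> ?Z}" by (simp add: M.span_base)
      qed
    qed
    then show ?thesis using x by blast
  qed
  obtain p where p: "range p \<subseteq> ?Z" "Vector_Spaces.linear sM sM p" "\<And>v. v \<in> ?Z \<Longrightarrow> p v = v"
    using MM.linear_exists_left_inverse_on[of "\<lambda>x. x" ?Z] M.linear_id by (auto simp: id_def inj_on_def)
  \<comment> \<open>\<open>p\<close> projects linearly onto \<open>?Z\<close>. Its average commutes
    with the group, still maps into \<open>?Z\<close>, and acts there as multiplication by
    \<open>card G\<close>.\<close>
  define k where "k = M.self.avg p"
  have linp: "lin_on sM UNIV sM UNIV p" using p(2) lin_on_linear[OF M.vector_space_axioms M.vector_space_axioms] by blast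
  have "M.self.hom k" unfolding k_def by (rule M.self.avg_hom[OF linp])
  then have k: "lin_on sM UNIV sM UNIV k" "\<And>g x. g \<in> G \<Longrightarrow> k (\<phi> g x) = \<phi> g (k x)" by (auto simp: M.self.hom_def)
  have kZ: "k x \<in> ?Z" for x
    unfolding k_def M.self.avg_def using p(1) by (intro M.span_sum stable) auto
  have kid: "k x = sM (of_nat (card G)) x" if "x \<in> ?Z" for x
  proof -
    have "M.Rinv g x \<in> ?Z" if "g \<in> G" for g
      unfolding M.Rinv_def using \<open>x \<in> ?Z\<close> that by (intro M.span_scale stable M.inv_G)
    then have "k x = (\<Sum>g\<in>G. x)"
      unfolding k_def M.self.avg_def by (intro sum.cong) (auto simp: p(3) M.R_Rinv)
    then show ?thesis by (simp add: M.sum_constant_scale)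
  qed
  define K where "K = {x \<in> UNIV. k x \<in> {0}}"
  \<comment> \<open>The component of \<open>x0\<close> in the complement, scaled by
    \<open>card G\<close>; it is nonzero because \<open>x0\<close> lies outside
    \<open>?Z\<close>.\<close>
  define z where "z = sM (of_nat (card G)) x0 - k x0"
  have "M.subspace K"
    unfolding K_def by (rule lin_on_subspace_preimage[OF M.vector_space_axioms M.vector_space_axioms k(1)]) auto
  moreover have "\<phi> g ` K \<subseteq> K" if "g \<in> G" for g
    using k(2)[OF that] lin_on_zero[OF M.R_lin[OF that]] by (auto simp: K_def)
  moreover have "z \<in> K"
    using kid[OF kZ, of x0]
    by (simp add: K_def z_def lin_on_diff[OF M.vector_space_axioms M.vector_space_axioms k(1)] lin_on_scale[OF k(1)])
  moreover have "z \<noteq> 0"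
  proof
    assume "z = 0"
    then have "sM (of_nat (card G)) x0 \<in> ?Z" using kZ by (simp add: z_def)
    then have "sM (1 / of_nat (card G)) (sM (of_nat (card G)) x0) \<in> ?Z" by (rule M.span_scale)
    then show False using x0 M.card_G_nz by simp
  qed
  ultimately obtain S where S: "M.subspace S" "S \<subseteq> K" "\<And>g. g \<in> G \<Longrightarrow> \<phi> g ` S \<subseteq> S" "irreducible_under sM S (\<phi> ` G)"
    using irreducible_sub_exists by metis
  obtain \<chi> f x where x: "\<chi> \<in> \<Lambda>" "f \<in> N \<chi>" "x \<in> W \<chi>" "f x \<in> S" "f x \<noteq> 0"
    using irreducible_sub_in_isotypic[OF S(1,3,4)] by blast
  have "f x \<in> ?Z" using x(1-3) by (intro M.span_base) (auto simp: isotypic_def)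
  then have "k (f x) = sM (of_nat (card G)) (f x)" by (rule kid)
  moreover have "k (f x) = 0" using x(4) S(2) by (auto simp: K_def)
  ultimately show False using x(5) M.card_G_nz by simp
qed

end

section \<open>Tensor products\<close>

context
  fixes s1 :: "complex \<Rightarrow> 'a::ab_group_add \<Rightarrow> 'a" and W1 :: "'a set"
    and s2 :: "complex \<Rightarrow> 'b::ab_group_add \<Rightarrow> 'b" and W2 :: "'b set"
begin

abbreviation (input) "tens \<equiv> tensor s1 W1 s2 W2"
abbreviation (input) "ptens \<equiv> pure_tensor s1 W1 s2 W2"
abbreviation (input) "sT \<equiv> (fscale (*) :: complex \<Rightarrow> (('a \<Rightarrow> 'b \<Rightarrow> complex) \<Rightarrow> complex) \<Rightarrow> _)"

lemma vector_space_tensor: "vector_space sT"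
  by (intro vector_space_fscale vector_space_times)

interpretation t: vector_space sT by (rule vector_space_tensor)

lemma subspace_tensor: "t.subspace tens"
  by (simp add: tensor_def)

lemma pure_tensor_mem: "x \<in> W1 \<Longrightarrow> y \<in> W2 \<Longrightarrow> ptens x y \<in> tens"
  and pure_tensor_lin_left: "y \<in> W2 \<Longrightarrow> lin_on s1 W1 sT tens (\<lambda>x. ptens x y)"
  and pure_tensor_lin_right: "x \<in> W1 \<Longrightarrow> lin_on s2 W2 sT tens (ptens x)"
  using bilin_on_pure_tensor[of s1 W1 s2 W2] by (auto simp: bilin_on_def lin_on_def)

lemma tensor_map_lin:
  assumes "lin_on s1 W1 s1 W1 a" "lin_on s2 W2 s2 W2 b"
  shows "lin_on sT tens sT tens (tensor_map s1 W1 s2 W2 a b)"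
proof -
  let ?m = "tensor_map s1 W1 s2 W2 a b"
  have lin: "?m (x + y) = ?m x + ?m y" "?m (sT c x) = sT c (?m x)" "?m 0 = 0" for x y c
    by (auto simp: tensor_map_def fscale_def fun_eq_iff)
  have "tens \<subseteq> {x. ?m x \<in> tens}"
    unfolding tensor_def[of s1 W1 s2 W2]
  proof (rule t.span_minimal)
    show "t.subspace {x. ?m x \<in> t.span {ptens x y |x y. x \<in> W1 \<and> y \<in> W2}}"
      by (rule t.subspaceI) (auto simp: lin t.span_zero t.span_add t.span_scale)
    show "{ptens x y |x y. x \<in> W1 \<and> y \<in> W2} \<subseteq> {x. ?m x \<in> t.span {ptens x y |x y. x \<in> W1 \<and> y \<in> W2}}"
    proof safe
      fix x y assume "x \<in> W1" "y \<in> W2"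
      then have "ptens (a x) (b y) \<in> {ptens x y |x y. x \<in> W1 \<and> y \<in> W2}"
        using lin_on_mem[OF assms(1)] lin_on_mem[OF assms(2)] by blast
      then show "?m (ptens x y) \<in> t.span {ptens x y |x y. x \<in> W1 \<and> y \<in> W2}"
        unfolding tensor_map_pure_tensor[OF assms] by (rule t.span_base)
    qed
  qed
  then show ?thesis using lin by (auto simp: lin_on_def)
qed

lemma tensor_lin_eqI:
  assumes "vector_space s3" "lin_on sT tens s3 W3 f" "lin_on sT tens s3 W3 g"
    "\<And>x y. x \<in> W1 \<Longrightarrow> y \<in> W2 \<Longrightarrow> f (ptens x y) = g (ptens x y)" "t \<in> tens"
  shows "f t = g t"
  by (rule lin_on_eq_on_span[OF vector_space_tensor assms(1-3) subspace_tensor,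
        of "{ptens x y |x y. x \<in> W1 \<and> y \<in> W2}"])
    (use assms(4,5) pure_tensor_mem in \<open>auto simp: tensor_def\<close>)

text \<open>Making the second factors independent prepares the proof of injectivity: a tensor in
  this form is zero as soon as all its first factors are.\<close>

lemma tensor_independent_form:
  assumes "vector_space s1" "vector_space s2" "module.subspace s1 W1" "module.subspace s2 W2" "t \<in> tens"
  shows "\<exists>F w. finite F \<and> F \<subseteq> W2 \<and> \<not> module.dependent s2 F \<and> (\<forall>f\<in>F. w f \<in> W1) \<and>
    t = (\<Sum>f\<in>F. ptens (w f) f)"
proof -
  interpret s1: vector_space s1 by fact
  interpret s2: vector_space s2 by fact
  obtain C where C: "C \<subseteq> W2" "s2.independent C" "W2 \<subseteq> s2.span C"
    by (rule s2.maximal_independent_subset)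
  define X where "X = {\<Sum>f\<in>F. ptens (w f) f |F w. finite F \<and> F \<subseteq> C \<and> (\<forall>f. w f \<in> W1)}"
  have p0: "ptens 0 f = 0" if "f \<in> W2" for f
    by (rule lin_on_zero[OF pure_tensor_lin_left[OF that] s1.subspace_0[OF assms(3)]])
  have X: "(\<Sum>f\<in>F. ptens (w f) f) \<in> X" if "finite F" "F \<subseteq> C" "\<And>f. w f \<in> W1" for F w
    using that unfolding X_def by blast
  have "tens \<subseteq> X"
    unfolding tensor_def
  proof (rule t.span_minimal)
    show "t.subspace X"
    proof (rule t.subspaceI)
      show "0 \<in> X" using X[of "{}" "\<lambda>_. 0"] s1.subspace_0[OF assms(3)] by simp
    next
      fix x y assume "x \<in> X" "y \<in> X"
      then obtain F w F' w' where F: "finite F" "F \<subseteq> C" "\<forall>f. w f \<in> W1" "x = (\<Sum>f\<in>F. ptens (w f) f)"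
        and F': "finite F'" "F' \<subseteq> C" "\<forall>f. w' f \<in> W1" "y = (\<Sum>f\<in>F'. ptens (w' f) f)"
        unfolding X_def by blast
      define u where "u f = (if f \<in> F then w f else 0)" for f
      define u' where "u' f = (if f \<in> F' then w' f else 0)" for f
      have u: "u f \<in> W1" "u' f \<in> W1" for f using F(3) F'(3) s1.subspace_0[OF assms(3)] by (auto simp: u_def u'_def)
      have "x = (\<Sum>f\<in>F \<union> F'. ptens (u f) f)" "y = (\<Sum>f\<in>F \<union> F'. ptens (u' f) f)"
        unfolding F(4) F'(4) using F F' C(1)
        by (auto simp: u_def u'_def p0 subset_iff intro!: sum.mono_neutral_cong_left)
      then have "x + y = (\<Sum>f\<in>F \<union> F'. ptens (u f + u' f) f)"
        using u F(2) F'(2) C(1)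
        by (auto simp: lin_on_add[OF pure_tensor_lin_left] subset_iff sum.distrib[symmetric] intro!: sum.cong)
      then show "x + y \<in> X"
        using X[of "F \<union> F'" "\<lambda>f. u f + u' f"] F F' u s1.subspace_add[OF assms(3)] by simp
    next
      fix c x assume "x \<in> X"
      then obtain F w where F: "finite F" "F \<subseteq> C" "\<forall>f. w f \<in> W1" "x = (\<Sum>f\<in>F. ptens (w f) f)"
        unfolding X_def by blast
      have "sT c x = (\<Sum>f\<in>F. sT c (ptens (w f) f))" unfolding F(4) by (rule t.scale_sum_right)
      also have "\<dots> = (\<Sum>f\<in>F. ptens (s1 c (w f)) f)"
        using F(2,3) C(1) by (intro sum.cong refl lin_on_scale[OF pure_tensor_lin_left, symmetric]) auto
      finally show "sT c x \<in> X"
        using X[of F "\<lambda>f. s1 c (w f)"] F s1.subspace_scale[OF assms(3)] by simp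
    qed
    show "{ptens x y |x y. x \<in> W1 \<and> y \<in> W2} \<subseteq> X"
    proof safe
      fix x y assume xy: "x \<in> W1" "y \<in> W2"
      then have "y \<in> s2.span C" using C(3) by blast
      then obtain F k where F: "finite F" "F \<subseteq> C" "y = (\<Sum>f\<in>F. s2 (k f) f)"
        unfolding s2.span_explicit by blast
      have "ptens x y = (\<Sum>f\<in>F. ptens x (s2 (k f) f))"
        unfolding F(3) using F(2) C(1)
        by (intro lin_on_sum[OF assms(2) pure_tensor_lin_right[OF xy(1)] assms(4)] s2.subspace_scale[OF assms(4)]) blast
      also have "\<dots> = (\<Sum>f\<in>F. ptens (s1 (k f) x) f)"
      proof (rule sum.cong[OF refl])
        fix f assume "f \<in> F"
        then have "f \<in> W2" using F(2) C(1) by blast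
        then show "ptens x (s2 (k f) f) = ptens (s1 (k f) x) f"
          using lin_on_scale[OF pure_tensor_lin_right[OF xy(1)]] lin_on_scale[OF pure_tensor_lin_left _ ] xy(1) by metis
      qed
      finally show "ptens x y \<in> X"
        using X[OF F(1,2), of "\<lambda>f. s1 (k f) x"] s1.subspace_scale[OF assms(3) xy(1)] by simp
    qed
  qed
  then have "t \<in> X" using assms(5) by blast
  then obtain F w where "finite F" "F \<subseteq> C" "\<forall>f. w f \<in> W1" "t = (\<Sum>f\<in>F. ptens (w f) f)"
    unfolding X_def by blast
  then show ?thesis using C s2.independent_mono[OF C(2)] by (intro exI[of _ F] exI[of _ w]) auto
qed

end

lemma subspace_direct_sum:
  fixes s :: "complex \<Rightarrow> 'a::ab_group_add \<Rightarrow> 'a"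
  assumes "vector_space s" "\<And>i. i \<in> I \<Longrightarrow> module.subspace s (X i)"
  shows "module.subspace (fscale s) (direct_sum I X)"
proof -
  interpret s: vector_space s by fact
  interpret f: vector_space "fscale s :: complex \<Rightarrow> ('b \<Rightarrow> 'a) \<Rightarrow> _" by (rule vector_space_fscale[OF assms(1)])
  show ?thesis
  proof (rule f.subspaceI)
    fix x y assume xy: "x \<in> direct_sum I X" "y \<in> direct_sum I X"
    have "{i. (x + y) i \<noteq> 0} \<subseteq> {i. x i \<noteq> 0} \<union> {i. y i \<noteq> 0}" by auto
    then have "finite {i. (x + y) i \<noteq> 0}" using xy by (auto simp: direct_sum_def intro: finite_subset)
    then show "x + y \<in> direct_sum I X" using xy assms(2) by (auto simp: direct_sum_def intro: s.subspace_add)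
  next
    fix c x assume x: "x \<in> direct_sum I X"
    have "{i. fscale s c x i \<noteq> 0} \<subseteq> {i. x i \<noteq> 0}" by (auto simp: fscale_def)
    then have "finite {i. fscale s c x i \<noteq> 0}" using x by (auto simp: direct_sum_def intro: finite_subset)
    then show "fscale s c x \<in> direct_sum I X"
      using x assms(2) by (auto simp: direct_sum_def fscale_def intro: s.subspace_scale)
  qed (use assms(2) in \<open>auto simp: direct_sum_def intro: s.subspace_0\<close>)
qed

section \<open>The evaluation map from the sum of tensor products to \<open>M\<close>\<close>

context tga_decomposition
begin

abbreviation "TP \<chi> \<equiv> tensor sW (W \<chi>) (fscale sM) (N \<chi>)"
abbreviation "pt \<chi> \<equiv> pure_tensor sW (W \<chi>) (fscale sM) (N \<chi>)"
abbreviation "DS \<equiv> direct_sum \<Lambda> TP"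

lemma evaluation_exists:
  assumes \<chi>: "\<chi> \<in> \<Lambda>"
  shows "\<exists>\<theta>. lin_on (fscale (*)) (TP \<chi>) sM UNIV \<theta> \<and> (\<forall>w\<in>W \<chi>. \<forall>f\<in>N \<chi>. \<theta> (pt \<chi> w f) = f w)"
proof (rule tensor_universal[OF M.vector_space_axioms])
  show "bilin_on sW (W \<chi>) (fscale sM) (N \<chi>) sM UNIV (\<lambda>w f. f w)"
    using N_lin[OF \<chi>] by (auto simp: bilin_on_def lin_on_def fscale_def)
qed

definition \<theta> :: "('v tga \<Rightarrow> complex) \<Rightarrow> (('w \<Rightarrow> ('w \<Rightarrow> 'm) \<Rightarrow> complex) \<Rightarrow> complex) \<Rightarrow> 'm"
  where "\<theta> \<chi> = (SOME \<theta>. lin_on (fscale (*)) (TP \<chi>) sM UNIV \<theta> \<and>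
    (\<forall>w\<in>W \<chi>. \<forall>f\<in>N \<chi>. \<theta> (pt \<chi> w f) = f w))"

lemma \<theta>_lin: "\<chi> \<in> \<Lambda> \<Longrightarrow> lin_on (fscale (*)) (TP \<chi>) sM UNIV (\<theta> \<chi>)"
  and \<theta>_pure: "\<chi> \<in> \<Lambda> \<Longrightarrow> w \<in> W \<chi> \<Longrightarrow> f \<in> N \<chi> \<Longrightarrow> \<theta> \<chi> (pt \<chi> w f) = f w"
  using someI_ex[OF evaluation_exists] unfolding \<theta>_def by blast+

definition \<Theta> :: "(('v tga \<Rightarrow> complex) \<Rightarrow> ('w \<Rightarrow> ('w \<Rightarrow> 'm) \<Rightarrow> complex) \<Rightarrow> complex) \<Rightarrow> 'm"
  where "\<Theta> t = (\<Sum>\<chi> | t \<chi> \<noteq> 0. \<theta> \<chi> (t \<chi>))"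

lemma TP_subspace: "module.subspace (fscale (*)) (TP \<chi>)"
  by (rule subspace_tensor)

lemma zero_TP: "0 \<in> TP \<chi>"
  by (rule module.subspace_0[OF _ TP_subspace])
    (simp add: module_iff_vector_space vector_space_tensor)

lemma \<theta>_zero: "\<chi> \<in> \<Lambda> \<Longrightarrow> \<theta> \<chi> 0 = 0"
  by (rule lin_on_zero[OF \<theta>_lin zero_TP])

lemma DS_mem: "t \<in> DS \<Longrightarrow> \<chi> \<in> \<Lambda> \<Longrightarrow> t \<chi> \<in> TP \<chi>"
  and DS_support: "t \<in> DS \<Longrightarrow> finite {\<chi>. t \<chi> \<noteq> 0}" "t \<in> DS \<Longrightarrow> {\<chi>. t \<chi> \<noteq> 0} \<subseteq> \<Lambda>"
  by (auto simp: direct_sum_def)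

lemma DS_subspace: "module.subspace (fscale (fscale (*))) DS"
  by (rule subspace_direct_sum[OF vector_space_tensor TP_subspace])

lemma \<Theta>_superset:
  assumes "finite K" "K \<subseteq> \<Lambda>" "{\<chi>. t \<chi> \<noteq> 0} \<subseteq> K"
  shows "\<Theta> t = (\<Sum>\<chi>\<in>K. \<theta> \<chi> (t \<chi>))"
  unfolding \<Theta>_def using assms by (intro sum.mono_neutral_left) (auto simp: \<theta>_zero subset_iff)

lemma \<Theta>_lin: "lin_on (fscale (fscale (*))) DS sM UNIV \<Theta>"
proof (rule lin_onI)
  fix x y assume xy: "x \<in> DS" "y \<in> DS"
  let ?K = "{\<chi>. x \<chi> \<noteq> 0} \<union> {\<chi>. y \<chi> \<noteq> 0}"
  have K: "finite ?K" "?K \<subseteq> \<Lambda>" using xy DS_support by blast+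
  have "\<Theta> (x + y) = (\<Sum>\<chi>\<in>?K. \<theta> \<chi> (x \<chi> + y \<chi>))"
    by (subst \<Theta>_superset[OF K]) auto
  also have "\<dots> = (\<Sum>\<chi>\<in>?K. \<theta> \<chi> (x \<chi>) + \<theta> \<chi> (y \<chi>))"
    using K(2) xy by (intro sum.cong refl lin_on_add[OF \<theta>_lin] DS_mem) auto
  also have "\<dots> = \<Theta> x + \<Theta> y"
    by (simp add: sum.distrib \<Theta>_superset[OF K])
  finally show "\<Theta> (x + y) = \<Theta> x + \<Theta> y" .
next
  fix c x assume x: "x \<in> DS"
  note K = DS_support[OF x]
  have "\<Theta> (fscale (fscale (*)) c x) = (\<Sum>\<chi> | x \<chi> \<noteq> 0. \<theta> \<chi> (fscale (*) c (x \<chi>)))"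
    by (subst \<Theta>_superset[OF K]) (auto simp: fscale_def fun_eq_iff)
  also have "\<dots> = (\<Sum>\<chi> | x \<chi> \<noteq> 0. sM c (\<theta> \<chi> (x \<chi>)))"
    using K(2) x by (intro sum.cong refl lin_on_scale[OF \<theta>_lin] DS_mem) auto
  also have "\<dots> = sM c (\<Theta> x)" by (simp add: \<Theta>_def M.scale_sum_right)
  finally show "\<Theta> (fscale (fscale (*)) c x) = sM c (\<Theta> x)" .
qed simp

lemma summand_DS: "\<chi> \<in> \<Lambda> \<Longrightarrow> t \<in> TP \<chi> \<Longrightarrow> summand \<chi> t \<in> DS"
  by (auto simp: direct_sum_def summand_def zero_TP)

lemma \<Theta>_summand:
  assumes "\<chi> \<in> \<Lambda>" "w \<in> W \<chi>" "f \<in> N \<chi>"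
  shows "\<Theta> (summand \<chi> (pt \<chi> w f)) = f w"
  using assms by (subst \<Theta>_superset[of "{\<chi>}"]) (auto simp: summand_def \<theta>_pure)

text \<open>The image is a subspace containing every value of a homomorphism, which gives
  surjectivity. For injectivity, each component is written with independent homomorphisms as second
  factors, and \<open>independence\<close> makes the first factors vanish.\<close>

lemma \<Theta>_bij: "bij_betw \<Theta> DS UNIV"
  unfolding bij_betw_def
proof
  have vsD: "vector_space (fscale (fscale (*)) :: complex \<Rightarrow>
      (('v tga \<Rightarrow> complex) \<Rightarrow> ('w \<Rightarrow> ('w \<Rightarrow> 'm) \<Rightarrow> complex) \<Rightarrow> complex) \<Rightarrow> _)"
    by (intro vector_space_fscale vector_space_times)
  have "isotypic \<subseteq> \<Theta> ` DS"
  proof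
    fix m assume "m \<in> isotypic"
    then obtain f w \<chi> where m: "m = f w" "\<chi> \<in> \<Lambda>" "f \<in> N \<chi>" "w \<in> W \<chi>" by (auto simp: isotypic_def)
    then show "m \<in> \<Theta> ` DS"
      by (intro image_eqI[of _ _ "summand \<chi> (pt \<chi> w f)"]) (auto simp: \<Theta>_summand summand_DS pure_tensor_mem)
  qed
  then have "M.span isotypic \<subseteq> \<Theta> ` DS"
    by (rule M.span_minimal) (rule lin_on_subspace_image[OF vsD M.vector_space_axioms \<Theta>_lin DS_subspace])
  then show "\<Theta> ` DS = UNIV" using isotypic_spans by blast
  show "inj_on \<Theta> DS"
    unfolding lin_on_inj_iff[OF vsD M.vector_space_axioms \<Theta>_lin DS_subspace]
  proof (intro ballI impI)
    fix t assume t: "t \<in> DS" "\<Theta> t = 0"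
    define K where "K = {\<chi>. t \<chi> \<noteq> 0}"
    have K: "finite K" "K \<subseteq> \<Lambda>" using DS_support[OF t(1)] by (auto simp: K_def)
    have "\<forall>\<chi>\<in>K. \<exists>F w. finite F \<and> F \<subseteq> N \<chi> \<and> F.independent F \<and> (\<forall>f\<in>F. w f \<in> W \<chi>) \<and>
      t \<chi> = (\<Sum>f\<in>F. pt \<chi> (w f) f)"
    proof
      fix \<chi> assume "\<chi> \<in> K"
      then have \<chi>: "\<chi> \<in> \<Lambda>" using K by blast
      interpret r: proj_rep G \<alpha> sW "W \<chi>" "R \<chi>" by (rule rep_W[OF \<chi>])
      show "\<exists>F w. finite F \<and> F \<subseteq> N \<chi> \<and> F.independent F \<and> (\<forall>f\<in>F. w f \<in> W \<chi>) \<and>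
        t \<chi> = (\<Sum>f\<in>F. pt \<chi> (w f) f)"
        by (rule tensor_independent_form[OF r.vector_space_axioms F.vector_space_axioms r.W subspace_N[OF \<chi>] DS_mem[OF t(1) \<chi>]])
    qed
    from bchoice[OF this] obtain F where "\<forall>\<chi>\<in>K. \<exists>w. finite (F \<chi>) \<and> F \<chi> \<subseteq> N \<chi> \<and> F.independent (F \<chi>) \<and>
      (\<forall>f\<in>F \<chi>. w f \<in> W \<chi>) \<and> t \<chi> = (\<Sum>f\<in>F \<chi>. pt \<chi> (w f) f)" by blast
    from bchoice[OF this] obtain w where F: "\<And>\<chi>. \<chi> \<in> K \<Longrightarrow> finite (F \<chi>) \<and> F \<chi> \<subseteq> N \<chi> \<and> F.independent (F \<chi>)"
      and w: "\<And>\<chi> f. \<chi> \<in> K \<Longrightarrow> f \<in> F \<chi> \<Longrightarrow> w \<chi> f \<in> W \<chi>"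
      and tF: "\<And>\<chi>. \<chi> \<in> K \<Longrightarrow> t \<chi> = (\<Sum>f\<in>F \<chi>. pt \<chi> (w \<chi> f) f)" by blast
    have eval: "\<theta> \<chi> (t \<chi>) = (\<Sum>f\<in>F \<chi>. f (w \<chi> f))" if "\<chi> \<in> K" for \<chi>
    proof -
      have \<chi>: "\<chi> \<in> \<Lambda>" using K that by blast
      have "\<theta> \<chi> (t \<chi>) = (\<Sum>f\<in>F \<chi>. \<theta> \<chi> (pt \<chi> (w \<chi> f) f))"
        unfolding tF[OF that] using F[OF that] w[OF that]
        by (intro lin_on_sum[OF vector_space_tensor \<theta>_lin[OF \<chi>] TP_subspace] pure_tensor_mem) auto
      also have "\<dots> = (\<Sum>f\<in>F \<chi>. f (w \<chi> f))"
        using F[OF that] w[OF that] by (intro sum.cong refl \<theta>_pure[OF \<chi>]) auto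
      finally show ?thesis .
    qed
    have zero: "(\<Sum>\<chi>\<in>K. \<Sum>f\<in>F \<chi>. f (w \<chi> f)) = 0"
      using t(2) eval unfolding \<Theta>_def K_def[symmetric] by simp
    have "t \<chi> = 0" if "\<chi> \<in> K" for \<chi>
    proof -
      have "pt \<chi> (w \<chi> f) f = 0" if f: "f \<in> F \<chi>" for f
      proof -
        have \<chi>: "\<chi> \<in> \<Lambda>" using K \<open>\<chi> \<in> K\<close> by blast
        interpret r: proj_rep G \<alpha> sW "W \<chi>" "R \<chi>" by (rule rep_W[OF \<chi>])
        have "w \<chi> f = 0" by (rule independence[where K = K and F = F and w = w and \<chi> = \<chi> and f = f, OF K F w zero \<open>\<chi> \<in> K\<close> f])
        moreover have "f \<in> N \<chi>" using f F[OF \<open>\<chi> \<in> K\<close>] by blast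
        ultimately show ?thesis
          using lin_on_zero[OF pure_tensor_lin_left r.subspace_0[OF r.W]] by metis
      qed
      then show ?thesis using tF[OF that] by simp
    qed
    then show "t = 0" by (auto simp: K_def fun_eq_iff)
  qed
qed

text \<open>Serves both actions: the algebra with \<open>B\<close> the identity, and the vertex
  algebra with \<open>A\<close> the identity.\<close>

lemma \<Theta>_tensor_map:
  assumes A: "\<And>\<chi>. \<chi> \<in> \<Lambda> \<Longrightarrow> lin_on sW (W \<chi>) sW (W \<chi>) (A \<chi>)"
    and B: "\<And>\<chi>. \<chi> \<in> \<Lambda> \<Longrightarrow> lin_on (fscale sM) (N \<chi>) (fscale sM) (N \<chi>) (B \<chi>)"
    and p: "lin_on sM UNIV sM UNIV p"
    and eq: "\<And>\<chi> w f. \<chi> \<in> \<Lambda> \<Longrightarrow> w \<in> W \<chi> \<Longrightarrow> f \<in> N \<chi> \<Longrightarrow> B \<chi> f (A \<chi> w) = p (f w)"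
    and t: "t \<in> DS"
  shows "\<Theta> (\<lambda>\<chi>. tensor_map sW (W \<chi>) (fscale sM) (N \<chi>) (A \<chi>) (B \<chi>) (t \<chi>)) = p (\<Theta> t)"
proof -
  let ?m = "\<lambda>\<chi>. tensor_map sW (W \<chi>) (fscale sM) (N \<chi>) (A \<chi>) (B \<chi>)"
  note K = DS_support[OF t]
  have "?m \<chi> 0 = 0" for \<chi> by (auto simp: tensor_map_def)
  then have "\<Theta> (\<lambda>\<chi>. ?m \<chi> (t \<chi>)) = (\<Sum>\<chi> | t \<chi> \<noteq> 0. \<theta> \<chi> (?m \<chi> (t \<chi>)))"
    by (intro \<Theta>_superset[OF K]) auto
  also have "\<dots> = (\<Sum>\<chi> | t \<chi> \<noteq> 0. p (\<theta> \<chi> (t \<chi>)))"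
  proof (rule sum.cong[OF refl])
    fix \<chi> assume "\<chi> \<in> {\<chi>. t \<chi> \<noteq> 0}"
    then have \<chi>: "\<chi> \<in> \<Lambda>" using K by blast
    show "\<theta> \<chi> (?m \<chi> (t \<chi>)) = p (\<theta> \<chi> (t \<chi>))"
    proof (rule tensor_lin_eqI[OF M.vector_space_axioms _ _ _ DS_mem[OF t \<chi>]])
      show "lin_on (fscale (*)) (TP \<chi>) sM UNIV (\<lambda>t. \<theta> \<chi> (?m \<chi> t))"
        by (rule lin_on_compose[OF tensor_map_lin[OF A[OF \<chi>] B[OF \<chi>]] \<theta>_lin[OF \<chi>]])
      show "lin_on (fscale (*)) (TP \<chi>) sM UNIV (\<lambda>t. p (\<theta> \<chi> t))"
        by (rule lin_on_compose[OF \<theta>_lin[OF \<chi>] p])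
      show "\<theta> \<chi> (?m \<chi> (pt \<chi> w f)) = p (\<theta> \<chi> (pt \<chi> w f))" if "w \<in> W \<chi>" "f \<in> N \<chi>" for w f
        using that lin_on_mem[OF A[OF \<chi>] that(1)] lin_on_mem[OF B[OF \<chi>] that(2)]
        by (simp add: tensor_map_pure_tensor[OF A[OF \<chi>] B[OF \<chi>]] \<theta>_pure[OF \<chi>] eq[OF \<chi>])
    qed
  qed
  also have "\<dots> = p (\<Theta> t)"
    unfolding \<Theta>_def by (rule lin_on_sum[OF M.vector_space_axioms p, symmetric]) auto
  finally show ?thesis .
qed

end

section \<open>The orbifold dual pair\<close>

text \<open>Once all sums share a fixed cut-off, an identity between maps can be checked pointwise.
  Before that it could not: the support of a \<open>Sum_any\<close> of functions must be finite for
  all arguments together.\<close>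

lemma jacobi_component_hom_modes:
  assumes "\<And>x. jacobi_component s YV YM k u v (f x) p m n I"
  shows "jacobi_component (fscale s) YV (hom_modes YM) k u v f p m n I"
  unfolding jacobi_component_def
proof
  fix x
  show "((if p \<in> \<int> then \<Sum>i<I. fscale s ((-1) ^ i * (of_rat p gchoose i))
        (hom_modes YM u (p + m - of_nat i) (hom_modes YM v (n + of_nat i) f)) else 0) -
    (if p \<in> \<int> then \<Sum>i<I. fscale s ((-1) powi (- \<lfloor>- p - 1\<rfloor> - 1) * ((-1) ^ i * (of_rat p gchoose i)))
      (hom_modes YM v (p + n - of_nat i) (hom_modes YM u (m + of_nat i) f)) else 0)) x =
    (if m - k \<in> \<int> then \<Sum>i<I. fscale s ((-1) ^ i * (of_rat (of_nat i - m - 1) gchoose i))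
      (hom_modes YM (YV u (p + of_nat i) v) (m + n - of_nat i) f) else 0) x"
    using assms[of x] unfolding jacobi_component_def
    by (cases "p \<in> \<int>"; cases "m - k \<in> \<int>") (simp_all add: fscale_sum_apply hom_modes_def)
qed

lemma (in vector_space) independent_family:
  assumes J: "finite J" and indep: "\<And>c j. (\<Sum>i\<in>J. scale (c i) (e i)) = 0 \<Longrightarrow> j \<in> J \<Longrightarrow> c j = 0"
  shows "inj_on e J" "independent (e ` J)"
proof -
  show inj: "inj_on e J"
  proof (rule inj_onI, rule ccontr)
    fix i j assume ij: "i \<in> J" "j \<in> J" "e i = e j" "i \<noteq> j"
    have "(\<Sum>k\<in>J. scale ((if k = i then 1 else 0) - (if k = j then 1 else 0)) (e k)) = 0"
      using ij J by (simp only: scale_left_diff_distrib sum_subtractf sum_scale_delta) simp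
    from indep[OF this ij(1)] show False using ij(4) by simp
  qed
  show "independent (e ` J)"
  proof (rule independent_if_scalars_zero)
    fix c x assume c: "(\<Sum>x\<in>e ` J. scale (c x) x) = 0" and x: "x \<in> e ` J"
    have "(\<Sum>i\<in>J. scale (c (e i)) (e i)) = 0" using c by (simp add: sum.reindex[OF inj])
    then show "c x = 0" using indep[of "\<lambda>i. c (e i)"] x by blast
  qed (use J in simp)
qed

locale orbifold = irreducible_full_module sV vac Y \<sigma> sM YM
  for sV :: "complex \<Rightarrow> 'v::ab_group_add \<Rightarrow> 'v" and vac Y \<sigma>
    and sM :: "complex \<Rightarrow> 'm::ab_group_add \<Rightarrow> 'm" and YM +
  fixes G :: "('v \<Rightarrow> 'v) set" and \<phi> :: "('v \<Rightarrow> 'v) \<Rightarrow> 'm \<Rightarrow> 'm"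
  assumes simple: "irreducible_under sV UNIV (va_modes UNIV Y)"
    and G: "finite_automorphism_group sV vac Y G" and \<sigma>_in: "\<sigma> \<in> G"
    and \<phi>: "stabilizing_isos sM YM G \<phi>"
begin

abbreviation "\<alpha> \<equiv> schur_cocycle sM \<phi>"
abbreviation "VG \<equiv> fixed_points G"

lemma G_aut:
  assumes "g \<in> G"
  shows "lin_on sV UNIV sV UNIV g" "bij g" "g vac = vac" "g (Y u n v) = Y (g u) n (g v)"
  using G assms by (auto simp: finite_automorphism_group_def va_automorphism_def)

lemma G_group: "finite G" "id \<in> G" "g \<in> G \<Longrightarrow> h \<in> G \<Longrightarrow> g \<circ> h \<in> G" "g \<in> G \<Longrightarrow> inv g \<in> G"
  using G by (auto simp: finite_automorphism_group_def)

lemma \<phi>_lin: "g \<in> G \<Longrightarrow> lin_on sM UNIV sM UNIV (\<phi> g)" and \<phi>_bij: "g \<in> G \<Longrightarrow> bij (\<phi> g)"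
  and \<phi>_id: "\<phi> id = id"
  using \<phi> by (auto simp: stabilizing_isos_def)

lemma \<phi>_YM:
  assumes "g \<in> G"
  shows "\<phi> g (YM v n x) = YM (g v) n (\<phi> g x)"
proof -
  have "\<phi> g \<circ> YM v n \<circ> inv (\<phi> g) = YM (g v) n" using \<phi> assms by (auto simp: stabilizing_isos_def)
  then have "(\<phi> g \<circ> YM v n \<circ> inv (\<phi> g)) (\<phi> g x) = YM (g v) n (\<phi> g x)" by simp
  then show ?thesis using \<phi>_bij[OF assms] by (simp add: bij_is_inj)
qed

lemma M_nontrivial: "\<exists>x::'m. x \<noteq> 0"
  using irr by (auto simp: irreducible_under_def)

text \<open>\<open>\<phi> g\<close> after \<open>\<phi> h\<close>, followed by the inverse of
  \<open>\<phi> (g \<circ> h)\<close>, commutes with all modes, so it is scalar by Schur's lemma.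
  The scalar is unique and nonzero because the maps are injective and \<open>M\<close> is nonzero,
  which justifies the definite description.\<close>

lemma cocycle:
  assumes g: "g \<in> G" and h: "h \<in> G"
  shows "\<phi> g (\<phi> h m) = sM (\<alpha> g h) (\<phi> (g \<circ> h) m)" "\<alpha> g h \<noteq> 0"
proof -
  have gh: "g \<circ> h \<in> G" using G_group(3) g h by blast
  define k where "k = inv (\<phi> (g \<circ> h))"
  have \<phi>k: "\<phi> (g \<circ> h) (k x) = x" and k\<phi>: "k (\<phi> (g \<circ> h) x) = x" for x
    using \<phi>_bij[OF gh] by (auto simp: k_def bij_is_inj bij_is_surj surj_f_inv_f)
  have k_lin: "lin_on sM UNIV sM UNIV k"
  proof (rule lin_onI)
    show "k (x + y) = k x + k y" for x y
      using k\<phi>[of "k x + k y"] by (simp add: lin_on_add[OF \<phi>_lin[OF gh]] \<phi>k)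
    show "k (sM c x) = sM c (k x)" for c x
      using k\<phi>[of "sM c (k x)"] by (simp add: lin_on_scale[OF \<phi>_lin[OF gh]] \<phi>k)
  qed simp
  have k_YM: "k (YM ((g \<circ> h) v) n x) = YM v n (k x)" for v n x
    using k\<phi>[of "YM v n (k x)"] by (simp only: \<phi>_YM[OF gh] \<phi>k)
  have "\<exists>c. \<forall>x. k (\<phi> g (\<phi> h x)) = sM c x"
  proof (rule schur)
    show "lin_on sM UNIV sM UNIV (\<lambda>x. k (\<phi> g (\<phi> h x)))"
      by (intro lin_on_compose[OF lin_on_compose[OF \<phi>_lin[OF h] \<phi>_lin[OF g]] k_lin])
    show "k (\<phi> g (\<phi> h (YM v n x))) = YM v n (k (\<phi> g (\<phi> h x)))" for v n x
      using k_YM[of v n] by (simp add: \<phi>_YM[OF g] \<phi>_YM[OF h])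
  qed
  then obtain c where c: "\<And>x. k (\<phi> g (\<phi> h x)) = sM c x" by blast
  have eq: "\<phi> g (\<phi> h x) = sM c (\<phi> (g \<circ> h) x)" for x
    using arg_cong[OF c[of x], of "\<phi> (g \<circ> h)"] by (simp add: \<phi>k lin_on_scale[OF \<phi>_lin[OF gh]])
  obtain x where x: "x \<noteq> (0::'m)" using M_nontrivial by blast
  have nz: "\<phi> g' x \<noteq> 0" if "g' \<in> G" "x \<noteq> 0" for g' x
    using bij_is_inj[OF \<phi>_bij[OF that(1)]] lin_on_zero[OF \<phi>_lin[OF that(1)]] that(2) by (metis UNIV_I injD)
  have "\<alpha> g h = c"
    unfolding schur_cocycle_def
  proof (rule the_equality)
    show "\<forall>m. \<phi> g (\<phi> h m) = sM c (\<phi> (g \<circ> h) m)" using eq by blast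
    fix d assume "\<forall>m. \<phi> g (\<phi> h m) = sM d (\<phi> (g \<circ> h) m)"
    then have "sM d (\<phi> (g \<circ> h) x) = sM c (\<phi> (g \<circ> h) x)" using eq[of x] by simp
    then show "d = c" using nz[OF gh x] by simp
  qed
  then show "\<phi> g (\<phi> h m) = sM (\<alpha> g h) (\<phi> (g \<circ> h) m)" using eq by simp
  have "\<phi> g (\<phi> h x) \<noteq> 0" using nz g h x by blast
  then show "\<alpha> g h \<noteq> 0" using eq[of x] \<open>\<alpha> g h = c\<close> by auto
qed

sublocale P: proj_rep G \<alpha> sM UNIV \<phi>
  by unfold_locales (auto simp: G_group G_aut(2) cocycle(2) \<phi>_lin \<phi>_id intro: cocycle(1))

text \<open>A relation \<open>\<Sum>\<^sub>g c\<^sub>g \<phi>(g) = 0\<close> yields, on commuting with \<open>v\<^sub>n\<close>, the relations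
  \<open>\<Sum>\<^sub>g c\<^sub>g (g v - h v)\<^sub>n \<phi>(g) = 0\<close>, where the term of \<open>h\<close> has disappeared. Since modes
  separate, expanding \<open>g v - h v\<close> in a basis gives a shorter relation between the \<open>\<phi>(g)\<close>.\<close>

theorem \<phi>_independent:
  assumes "\<And>m. (\<Sum>g\<in>G. sM (c g) (\<phi> g m)) = 0" "g \<in> G"
  shows "c g = 0"
  using assms
proof (induction "card {g \<in> G. c g \<noteq> 0}" arbitrary: c g rule: less_induct)
  case less
  show ?case
  proof (rule ccontr)
    assume "c g \<noteq> 0"
    define h where "h = g"
    have h: "h \<in> G" "c h \<noteq> 0" using less.prems(2) \<open>c g \<noteq> 0\<close> by (auto simp: h_def)
    have eq: "k v = h v" if k: "k \<in> G" "c k \<noteq> 0" for k v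
    proof -
      let ?X = "(\<lambda>g. g v - h v) ` G"
      obtain D where D: "D \<subseteq> ?X" "independent D" "?X \<subseteq> span D" by (rule maximal_independent_subset)
      have finD: "finite D" using D(1) G_group(1) by (meson finite_imageI finite_subset)
      define r where "r g d = representation D (g v - h v) d" for g d
      have expand: "g v - h v = (\<Sum>d\<in>D. sV (r g d) d)" if "g \<in> G" for g
        using sum_representation_eq[OF D(2), of "g v - h v" D] D(3) finD that by (auto simp: r_def)
      have rel: "(\<Sum>d\<in>D. YM d n (\<Sum>g\<in>G. sM (c g * r g d) (\<phi> g m))) = 0" for n m
      proof -
        have "(\<Sum>d\<in>D. YM d n (\<Sum>g\<in>G. sM (c g * r g d) (\<phi> g m))) =
          (\<Sum>g\<in>G. \<Sum>d\<in>D. sM (c g * r g d) (YM d n (\<phi> g m)))"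
          by (subst sum.swap) (simp add: YM_sum)
        also have "\<dots> = (\<Sum>g\<in>G. sM (c g) (YM (g v - h v) n (\<phi> g m)))"
          by (intro sum.cong refl) (simp add: expand YM_sum_left M.scale_sum_right)
        also have "\<dots> = (\<Sum>g\<in>G. sM (c g) (\<phi> g (YM v n m)) - YM (h v) n (sM (c g) (\<phi> g m)))"
          by (intro sum.cong refl)
            (simp add: lin_on_diff[OF vector_space_axioms M.vector_space_axioms lin_YM_left] \<phi>_YM M.scale_right_diff_distrib)
        also have "\<dots> = (\<Sum>g\<in>G. sM (c g) (\<phi> g (YM v n m))) - YM (h v) n (\<Sum>g\<in>G. sM (c g) (\<phi> g m))"
          by (simp only: sum_subtractf YM_sum)
        also have "\<dots> = 0" by (simp add: less.prems(1))
        finally show ?thesis .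
      qed
      have "r k d = 0" if d: "d \<in> D" for d
      proof -
        have sum0: "(\<Sum>g\<in>G. sM (c g * r g d) (\<phi> g m)) = 0" for m
          using modes_separate[OF simple finD, of "\<lambda>d. d" "\<lambda>d. \<Sum>g\<in>G. sM (c g * r g d) (\<phi> g m)"] D(2) rel d
          by simp
        have "r h d = 0" by (simp add: r_def representation_zero)
        then have "{g \<in> G. c g * r g d \<noteq> 0} \<subset> {g \<in> G. c g \<noteq> 0}" using h by auto
        then have "card {g \<in> G. c g * r g d \<noteq> 0} < card {g \<in> G. c g \<noteq> 0}"
          using G_group(1) by (intro psubset_card_mono) auto
        then have "c k * r k d = 0" using less.hyps[OF _ sum0 k(1)] by blast
        then show ?thesis using k(2) by simp
      qed
      then have "k v - h v = 0" using expand[OF k(1)] by simp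
      then show ?thesis by simp
    qed
    obtain x where x: "x \<noteq> (0::'m)" using M_nontrivial by blast
    \<comment> \<open>All elements of the support agree with \<open>h\<close> as maps of
      \<open>V\<close>, so the relation has a single term, which injectivity of
      \<open>\<phi> h\<close> forbids.\<close>
    have "k = h" if "k \<in> G" "c k \<noteq> 0" for k using eq[OF that] by (rule ext)
    then have "(\<Sum>g\<in>G. sM (c g) (\<phi> g x)) = (\<Sum>g\<in>G. if g = h then sM (c h) (\<phi> h x) else 0)"
      by (intro sum.cong) auto
    then have "\<phi> h x = 0" using less.prems(1)[of x] h G_group(1) by simp
    then show False
      using bij_is_inj[OF \<phi>_bij[OF h(1)]] lin_on_zero[OF \<phi>_lin[OF h(1)]] x by (metis UNIV_I injD)
  qed
qed

section \<open>The fixed-point subalgebra acting on \<open>M\<close> and on spaces of maps\<close>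

lemma VG_fixed: "v \<in> VG \<Longrightarrow> g \<in> G \<Longrightarrow> g v = v"
  by (simp add: fixed_points_def)

lemma VG_subspace: "subspace VG"
  by (rule subspaceI)
    (auto simp: fixed_points_def lin_on_zero[OF G_aut(1)] lin_on_add[OF G_aut(1)] lin_on_scale[OF G_aut(1)])

lemma \<phi>_YM_VG: "v \<in> VG \<Longrightarrow> g \<in> G \<Longrightarrow> \<phi> g (YM v n x) = YM v n (\<phi> g x)"
  by (simp add: \<phi>_YM VG_fixed)

lemma VG_vertex_algebra: "vertex_algebra sV VG vac Y"
proof unfold_locales
  show "bilin_on sV VG sV VG sV VG (\<lambda>u. Y u n)" for n
  proof -
    have "Y u n w \<in> VG" if "u \<in> VG" "w \<in> VG" for u w
    proof -
      have "g (Y u n w) = Y u n w" if g: "g \<in> G" for g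
        unfolding G_aut(4)[OF g] VG_fixed[OF \<open>u \<in> VG\<close> g] VG_fixed[OF \<open>w \<in> VG\<close> g] ..
      then show ?thesis by (simp add: fixed_points_def)
    qed
    then show ?thesis using Y_bilinear[of n] unfolding bilin_on_def lin_on_def by auto
  qed
  show "\<exists>N. \<forall>n\<ge>N. Y u n v = 0" for u v using Y_truncated by simp
  show "jacobi_identity sV (rat_modes Y) (rat_modes Y) 0 u v w" for u v w using jacobi by simp
qed (auto simp: VG_subspace Y_vac creation, auto simp: fixed_points_def G_aut(3))

text \<open>Since \<sigma> belongs to \<open>G\<close>, fixed vectors have \<sigma>-eigenvalue 1.
  This is why \<open>M\<close> restricts to an untwisted module, with integral modes and the Jacobi
  identity for \<open>k = 0\<close>.\<close>

lemma VG_eigen: "v \<in> VG \<Longrightarrow> v \<in> E 0"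
  using VG_fixed[OF _ \<sigma>_in] by (simp add: sigma_eigenspace_def)

lemma YM_VG_nonint: "v \<in> VG \<Longrightarrow> n \<notin> \<int> \<Longrightarrow> YM v n x = 0"
  using modes_eigen[OF order(1) VG_eigen, of v x n] by simp

lemma VG_jacobi: "u \<in> VG \<Longrightarrow> jacobi_identity sM YV YM 0 u v w"
  using twisted_jacobi[OF order(1) VG_eigen, of u v w] by simp

lemma VG_module: "va_module sV VG vac Y sM UNIV YM"
proof -
  interpret VG: vertex_algebra sV VG vac Y by (rule VG_vertex_algebra)
  show ?thesis
    by (rule VG.va_moduleI[OF M.vector_space_axioms M.subspace_UNIV])
      (auto simp: bilin_on_def lin_on_def YM_VG_nonint truncated YM_vac VG_jacobi)
qed

text \<open>The finite set \<open>B\<close> makes the truncation of the modes uniform over the argument of a map.\<close>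

lemma VG_module_of_maps:
  fixes N :: "('w \<Rightarrow> 'm) set"
  assumes N: "module.subspace (fscale sM) N" and st: "\<And>v n f. v \<in> VG \<Longrightarrow> f \<in> N \<Longrightarrow> hom_modes YM v n f \<in> N"
    and B: "finite B" "\<And>f. f \<in> N \<Longrightarrow> (\<And>b. b \<in> B \<Longrightarrow> f b = 0) \<Longrightarrow> f = 0"
  shows "va_module sV VG vac Y (fscale sM) N (hom_modes YM)"
proof -
  interpret VG: vertex_algebra sV VG vac Y by (rule VG_vertex_algebra)
  interpret F: vector_space "fscale sM :: complex \<Rightarrow> ('w \<Rightarrow> 'm) \<Rightarrow> _"
    by (intro vector_space_fscale M.vector_space_axioms)
  have trunc: "\<exists>L. \<forall>n\<ge>L. hom_modes YM v n f = 0" if "v \<in> VG" "f \<in> N" for v f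
  proof -
    have "\<forall>b\<in>B. \<exists>L. \<forall>n\<ge>L. YM v n (f b) = 0" using truncated by blast
    then have "eventually (\<lambda>n. \<forall>b\<in>B. YM v n (f b) = 0) at_top"
      using B(1) by (intro eventually_ball_finite) (auto simp: eventually_at_top_linorder)
    then obtain L where L: "\<forall>n\<ge>L. \<forall>b\<in>B. YM v n (f b) = 0" unfolding eventually_at_top_linorder by blast
    have "hom_modes YM v n f = 0" if "n \<ge> L" for n
      by (rule B(2)[OF st[OF \<open>v \<in> VG\<close> \<open>f \<in> N\<close>]]) (use L that in \<open>simp add: hom_modes_def\<close>)
    then show ?thesis by blast
  qed
  have jac: "jacobi_identity (fscale sM) YV (hom_modes YM) 0 u v f"
    if u: "u \<in> VG" and v: "v \<in> VG" and f: "f \<in> N" for u v f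
  proof (rule jacobi_identityI[OF F.vector_space_axioms])
    fix p m n I
    assume t: "\<And>i. i \<ge> I \<Longrightarrow> hom_modes YM u (m + of_nat i) f = 0" "\<And>i. i \<ge> I \<Longrightarrow> hom_modes YM v (n + of_nat i) f = 0"
      "\<And>i. i \<ge> I \<Longrightarrow> YV u (p + of_nat i) v = 0"
    show "jacobi_component (fscale sM) YV (hom_modes YM) 0 u v f p m n I"
    proof (rule jacobi_component_hom_modes)
      fix x
      show "jacobi_component sM YV YM 0 u v (f x) p m n I"
        using jacobi_at_component[OF M.vector_space_axioms, of YM "f x" I u m v n YV p 0] VG_jacobi[OF u, of v "f x"]
          fun_cong[OF t(1), of _ x] fun_cong[OF t(2), of _ x] t(3)
        by (simp add: jacobi_identity_iff hom_modes_def)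
    qed
  qed (use trunc u v f YV_truncated in \<open>auto simp: hom_modes_def\<close>)
  show ?thesis
  proof (rule VG.va_moduleI[OF F.vector_space_axioms N _ _ trunc _ jac])
    show "bilin_on sV VG (fscale sM) N (fscale sM) N (\<lambda>v. hom_modes YM v n)" for n
      using st by (auto simp: bilin_on_def lin_on_def hom_modes_def fscale_def)
  qed (auto simp: hom_modes_def YM_VG_nonint YM_vac)
qed

lemma avg_mode_sum: "a \<in> MS \<Longrightarrow> P.self.avg a \<in> mode_sums YM VG"
proof (induction rule: mode_sums.induct)
  case zero
  have "P.self.avg (\<lambda>w. 0) = (\<lambda>w. 0)"
    by (rule ext) (simp add: P.self.avg_def lin_on_zero[OF \<phi>_lin])
  then show ?case by (simp add: mode_sums.zero)
next
  case (add v a n)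
  have "(\<Sum>g\<in>G. g v) \<in> VG"
  proof -
    have "h (\<Sum>g\<in>G. g v) = (\<Sum>g\<in>G. g v)" if h: "h \<in> G" for h
    proof -
      have "h (\<Sum>g\<in>G. g v) = (\<Sum>g\<in>G. (h \<circ> g) v)"
        by (simp add: lin_on_sum[OF vector_space_axioms G_aut(1)[OF h]])
      also have "\<dots> = (\<Sum>g\<in>G. g v)" by (rule sum.reindex_bij_betw[OF P.bij_betw_translate[OF h]])
      finally show ?thesis .
    qed
    then show ?thesis by (simp add: fixed_points_def)
  qed
  moreover have "P.self.avg (\<lambda>w. YM v n w + a w) = (\<lambda>w. YM (\<Sum>g\<in>G. g v) n w + P.self.avg a w)"
  proof
    fix w
    have "P.self.avg (\<lambda>w. YM v n w + a w) w = (\<Sum>g\<in>G. YM (g v) n w + \<phi> g (a (P.Rinv g w)))"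
      unfolding P.self.avg_def by (intro sum.cong refl) (simp add: lin_on_add[OF \<phi>_lin] \<phi>_YM P.R_Rinv)
    then show "P.self.avg (\<lambda>w. YM v n w + a w) w = YM (\<Sum>g\<in>G. g v) n w + P.self.avg a w"
      by (simp add: sum.distrib YM_sum_left P.self.avg_def)
  qed
  ultimately show ?case using add.IH by (simp add: mode_sums.add)
qed

lemma VG_mode_sum_zero: "a \<in> mode_sums YM VG \<Longrightarrow> a 0 = 0"
  by (induction rule: mode_sums.induct) auto

lemma VG_mode_sum_mem:
  assumes "a \<in> mode_sums YM VG" "module.subspace (fscale sM) N" "\<And>v n f. v \<in> VG \<Longrightarrow> f \<in> N \<Longrightarrow> hom_modes YM v n f \<in> N"
    "f \<in> N"
  shows "(\<lambda>w. a (f w)) \<in> N"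
proof -
  interpret F: vector_space "fscale sM :: complex \<Rightarrow> ('a \<Rightarrow> 'm) \<Rightarrow> _"
    by (intro vector_space_fscale M.vector_space_axioms)
  show ?thesis
    using assms(1)
  proof induction
    case zero
    show ?case using F.subspace_0[OF assms(2)] by (simp add: zero_fun_def)
  next
    case (add v a n)
    have "(\<lambda>w. YM v n (f w) + a (f w)) = hom_modes YM v n f + (\<lambda>w. a (f w))"
      by (simp add: hom_modes_def fun_eq_iff)
    then show ?case using F.subspace_add[OF assms(2) assms(3)[OF add.hyps(1) assms(4)] add.IH] by simp
  qed
qed

end

section \<open>Density of the fixed-point modes on the homomorphism spaces\<close>

locale dual_pair = orbifold sV vac Y \<sigma> sM YM G \<phi> +
  D: tga_decomposition G \<alpha> sM \<phi> \<Lambda> sW W \<rho> N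
  for sV :: "complex \<Rightarrow> 'v::ab_group_add \<Rightarrow> 'v" and vac Y \<sigma>
    and sM :: "complex \<Rightarrow> 'm::ab_group_add \<Rightarrow> 'm" and YM G \<phi> \<Lambda>
    and sW :: "complex \<Rightarrow> 'w::ab_group_add \<Rightarrow> 'w" and W \<rho> N
begin

lemma N_stable:
  assumes "\<chi> \<in> \<Lambda>" "v \<in> VG" "f \<in> N \<chi>"
  shows "hom_modes YM v n f \<in> N \<chi>"
  using assms unfolding D.N_iff[OF assms(1)]
  by (auto simp: hom_modes_def lin_on_def \<phi>_YM_VG)

text \<open>The point is uniformity: one \<open>w'\<close> serves all homomorphisms in
  \<open>N \<chi>\<close>, so a rule turning \<open>f\<close> into \<open>h\<close> survives
  conjugation by the group.\<close>

lemma N_Rinv: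
  assumes \<chi>: "\<chi> \<in> \<Lambda>" and f: "f \<in> N \<chi>" and g: "g \<in> G" and w: "w \<in> W \<chi>"
  shows "\<exists>w'\<in>W \<chi>. P.Rinv g (f w) = f w' \<and> (\<forall>h\<in>N \<chi>. P.Rinv g (h w) = h w')"
proof -
  interpret r: proj_rep G \<alpha> sW "W \<chi>" "D.R \<chi>" by (rule D.rep_W[OF \<chi>])
  have "P.Rinv g (h w) = h (r.Rinv g w)" if h: "h \<in> N \<chi>" for h
    using w g by (simp add: P.Rinv_def r.Rinv_def lin_on_scale[OF D.N_lin[OF \<chi> h]] r.R_mem G_group(4) D.N_equiv[OF \<chi> h])
  then show ?thesis using r.Rinv_mem[OF g w] f by blast
qed

text \<open>Each of the \<open>card G\<close> summands of the average equals \<open>h w\<close>: the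
  inverse moves \<open>w\<close> to a common \<open>w'\<close>, there \<open>a\<close> replaces
  \<open>f\<close> by \<open>h\<close>, and \<open>\<phi> g\<close> moves back.\<close>

lemma avg_on_N:
  assumes \<chi>: "\<chi> \<in> \<Lambda>" and f: "f \<in> N \<chi>" and h: "h \<in> N \<chi>" and a: "\<And>w. w \<in> W \<chi> \<Longrightarrow> a (f w) = h w" and w: "w \<in> W \<chi>"
  shows "P.self.avg a (f w) = sM (of_nat (card G)) (h w)"
proof -
  have "\<phi> g (a (P.Rinv g (f w))) = h w" if g: "g \<in> G" for g
  proof -
    obtain w' where "w' \<in> W \<chi>" "P.Rinv g (f w) = f w'" "P.Rinv g (h w) = h w'"
      using N_Rinv[OF \<chi> f g w] h by blast
    then have "\<phi> g (a (P.Rinv g (f w))) = \<phi> g (P.Rinv g (h w))" using a by simp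
    then show ?thesis using P.R_Rinv[OF g] by simp
  qed
  then have "P.self.avg a (f w) = (\<Sum>g\<in>G. h w)" by (simp add: P.self.avg_def)
  then show ?thesis by (simp add: M.sum_constant_scale)
qed

lemma W_bases: "\<exists>B. \<forall>\<chi>\<in>\<Lambda>. finite (B \<chi>) \<and> \<not> module.dependent sW (B \<chi>) \<and> module.span sW (B \<chi>) = W \<chi>"
proof (intro bchoice ballI)
  fix \<chi> assume \<chi>: "\<chi> \<in> \<Lambda>"
  interpret r: proj_rep G \<alpha> sW "W \<chi>" "D.R \<chi>" by (rule D.rep_W[OF \<chi>])
  show "\<exists>B. finite B \<and> \<not> module.dependent sW B \<and> module.span sW B = W \<chi>"
    using r.finite_basis[OF D.irr_W[OF \<chi>]] by blast
qed

lemma MS_eq_on_W: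
  assumes \<chi>: "\<chi> \<in> \<Lambda>" and f: "f \<in> N \<chi>" and h: "h \<in> N \<chi>" and a: "a \<in> MS"
    and B: "module.span sW B = W \<chi>" "\<And>b. b \<in> B \<Longrightarrow> a (f b) = h b" and w: "w \<in> W \<chi>"
  shows "a (f w) = h w"
proof -
  interpret r: proj_rep G \<alpha> sW "W \<chi>" "D.R \<chi>" by (rule D.rep_W[OF \<chi>])
  show ?thesis
    by (rule lin_on_eq_on_span[OF r.vector_space_axioms M.vector_space_axioms
          lin_on_compose[OF D.N_lin[OF \<chi> f] MS_lin[OF a]] D.N_lin[OF \<chi> h] r.W, of B])
      (use B w r.span_superset in auto)
qed

lemma normalise: "\<chi> \<in> \<Lambda> \<Longrightarrow> h \<in> N \<chi> \<Longrightarrow> fscale sM (1 / of_nat (card G)) h \<in> N \<chi>"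
  by (rule D.F.subspace_scale[OF D.subspace_N])

text \<open>A homomorphism out of a simple module is zero or injective. Together with the
  independence of different characters, this makes the images under the \<open>f \<chi>\<close> of
  bases of the \<open>W \<chi>\<close> an independent family, on which modes of \<open>V\<close>
  realise any values. Several characters are treated at once in order to separate non-isomorphic
  pieces.\<close>

theorem VG_dense:
  assumes K: "finite K" "K \<subseteq> \<Lambda>" and f: "\<And>\<chi>. \<chi> \<in> K \<Longrightarrow> f \<chi> \<in> N \<chi>" "\<And>\<chi>. \<chi> \<in> K \<Longrightarrow> f \<chi> \<noteq> 0"
    and h: "\<And>\<chi>. \<chi> \<in> K \<Longrightarrow> h \<chi> \<in> N \<chi>"
  shows "\<exists>b\<in>mode_sums YM VG. \<forall>\<chi>\<in>K. (\<lambda>w. b (f \<chi> w)) = h \<chi>"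
proof -
  obtain B where B: "\<And>\<chi>. \<chi> \<in> \<Lambda> \<Longrightarrow> finite (B \<chi>)" "\<And>\<chi>. \<chi> \<in> \<Lambda> \<Longrightarrow> \<not> module.dependent sW (B \<chi>)"
    "\<And>\<chi>. \<chi> \<in> \<Lambda> \<Longrightarrow> module.span sW (B \<chi>) = W \<chi>"
    using W_bases by blast
  define J where "J = Sigma K B"
  define e where "e j = f (fst j) (snd j)" for j
  have J: "finite J" unfolding J_def using K B(1) by (intro finite_SigmaI) auto
  have indep: "c j = 0" if zero: "(\<Sum>j\<in>J. sM (c j) (e j)) = 0" and j: "j \<in> J" for c j
  proof -
    obtain \<chi> b where \<chi>: "j = (\<chi>, b)" "\<chi> \<in> K" "b \<in> B \<chi>" using j by (auto simp: J_def)
    \<comment> \<open>The second argument is ignored; it matches the shape of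
      \<open>independence\<close>, where \<kappa> contributes the singleton
      \<open>{f \<kappa>}\<close>. The vector is chosen so that \<open>f \<kappa>\<close> maps it to
      the \<kappa>-part of the relation.\<close>
    define w where "w \<kappa> k = (\<Sum>b\<in>B \<kappa>. sW (c (\<kappa>, b)) b)" for \<kappa> and k :: "'w \<Rightarrow> 'm"
    have w: "w \<kappa> k \<in> W \<kappa>" "f \<kappa> (w \<kappa> k) = (\<Sum>b\<in>B \<kappa>. sM (c (\<kappa>, b)) (f \<kappa> b))" if "\<kappa> \<in> K" for \<kappa> k
    proof -
      have \<kappa>: "\<kappa> \<in> \<Lambda>" using that K by blast
      interpret r: proj_rep G \<alpha> sW "W \<kappa>" "D.R \<kappa>" by (rule D.rep_W[OF \<kappa>])
      note lin = D.N_lin[OF \<kappa> f(1)[OF that]]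
      have BW: "B \<kappa> \<subseteq> W \<kappa>" using B(3)[OF \<kappa>] r.span_superset by blast
      show "w \<kappa> k \<in> W \<kappa>"
        unfolding w_def using BW by (intro r.subspace_sum[OF r.W] r.subspace_scale[OF r.W]) auto
      show "f \<kappa> (w \<kappa> k) = (\<Sum>b\<in>B \<kappa>. sM (c (\<kappa>, b)) (f \<kappa> b))"
        unfolding w_def using BW
        by (subst lin_on_sum[OF r.vector_space_axioms lin r.W])
          (auto simp: lin_on_scale[OF lin] subset_iff intro: r.subspace_scale[OF r.W])
    qed
    have "w \<chi> (f \<chi>) = 0"
    proof (rule D.independence[where K = K and F = "\<lambda>\<chi>. {f \<chi>}" and w = w and \<chi> = \<chi> and f = "f \<chi>"])
      have "(\<Sum>\<kappa>\<in>K. \<Sum>k\<in>{f \<kappa>}. k (w \<kappa> k)) = (\<Sum>\<kappa>\<in>K. \<Sum>b\<in>B \<kappa>. sM (c (\<kappa>, b)) (e (\<kappa>, b)))"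
        using w(2) by (simp add: e_def)
      also have "\<dots> = (\<Sum>j\<in>J. sM (c j) (e j))"
        unfolding J_def using K B(1) by (subst sum.Sigma) (auto intro: sum.cong)
      finally show "(\<Sum>\<kappa>\<in>K. \<Sum>k\<in>{f \<kappa>}. k (w \<kappa> k)) = 0" using zero by simp
    qed (use K f w(1) \<chi> in auto)
    moreover have \<chi>\<Lambda>: "\<chi> \<in> \<Lambda>" using \<chi>(2) K by blast
    interpret r: proj_rep G \<alpha> sW "W \<chi>" "D.R \<chi>" by (rule D.rep_W[OF \<chi>\<Lambda>])
    show ?thesis
      using \<open>w \<chi> (f \<chi>) = 0\<close> r.independentD[OF B(2,1)[OF \<chi>\<Lambda>] subset_refl, of "\<lambda>b. c (\<chi>, b)" b] \<chi>(1,3)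
      by (simp add: w_def)
  qed
  have fam: "inj_on e J" "M.independent (e ` J)"
    by (rule M.independent_family[OF J]; rule indep; assumption)+
  \<comment> \<open>Averaging will multiply by \<open>card G\<close>, so the targets are divided by
    it in advance. The function \<open>t\<close> finds the target of a vector by inverting the
    indexing \<open>e\<close>.\<close>
  let ?h = "\<lambda>\<chi>. fscale sM (1 / of_nat (card G)) (h \<chi>)"
  define t where "t x = (let j = the_inv_into J e x in ?h (fst j) (snd j))" for x
  obtain a where a: "a \<in> MS" "\<forall>x\<in>e ` J. a x = t x"
    using modes_dense[OF finite_imageI[OF J] fam(2)] by blast
  have mem: "P.self.avg a \<in> mode_sums YM VG" by (rule avg_mode_sum[OF a(1)])
  have "P.self.avg a (f \<chi> w) = h \<chi> w" if \<chi>: "\<chi> \<in> K" for \<chi> w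
  proof (cases "w \<in> W \<chi>")
    case True
    have \<chi>\<Lambda>: "\<chi> \<in> \<Lambda>" using \<chi> K by blast
    have "a (f \<chi> b) = ?h \<chi> b" if "b \<in> B \<chi>" for b
    proof -
      have j: "(\<chi>, b) \<in> J" using \<chi> that by (simp add: J_def)
      then have "a (e (\<chi>, b)) = t (e (\<chi>, b))" using a(2) by blast
      then show ?thesis using the_inv_into_f_f[OF fam(1) j] by (simp add: t_def e_def)
    qed
    note eq = MS_eq_on_W[OF \<chi>\<Lambda> f(1)[OF \<chi>] normalise[OF \<chi>\<Lambda> h[OF \<chi>]] a(1) B(3)[OF \<chi>\<Lambda>] this]
    show ?thesis
      using avg_on_N[OF \<chi>\<Lambda> f(1)[OF \<chi>] normalise[OF \<chi>\<Lambda> h[OF \<chi>]] eq True] P.card_G_nz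
      by (simp add: fscale_def)
  next
    case False
    have "\<chi> \<in> \<Lambda>" using \<chi> K by blast
    then show ?thesis
      using D.N_outside[OF _ f(1)[OF \<chi>] False] D.N_outside[OF _ h[OF \<chi>] False] VG_mode_sum_zero[OF mem] by simp
  qed
  then show ?thesis by (intro bexI[OF _ mem]) auto
qed

lemma N_nontrivial: "\<chi> \<in> \<Lambda> \<Longrightarrow> \<exists>f\<in>N \<chi>. f \<noteq> 0"
  using D.N_nonzero[of \<chi>] by (metis zero_fun_apply)

text \<open>Density for the single character \<chi> carries any nonzero homomorphism to any other,
  so a stable subspace with one nonzero element is everything. For the module axioms, a basis of
  \<open>W \<chi>\<close> is the finite set that makes truncation uniform.\<close>

theorem N_irreducible:
  assumes \<chi>: "\<chi> \<in> \<Lambda>"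
  shows "irreducible_va_module sV VG vac Y (fscale sM) (N \<chi>) (hom_modes YM)"
  unfolding irreducible_twisted_module_def
proof
  interpret r: proj_rep G \<alpha> sW "W \<chi>" "D.R \<chi>" by (rule D.rep_W[OF \<chi>])
  obtain B where B: "finite B" "\<not> module.dependent sW B" "module.span sW B = W \<chi>" using W_bases \<chi> by blast
  show "va_module sV VG vac Y (fscale sM) (N \<chi>) (hom_modes YM)"
  proof (rule VG_module_of_maps[OF D.subspace_N[OF \<chi>] N_stable[OF \<chi>] B(1)])
    fix f assume f: "f \<in> N \<chi>" "\<And>b. b \<in> B \<Longrightarrow> f b = 0"
    have "0 \<in> N \<chi>" by (rule D.F.subspace_0[OF D.subspace_N[OF \<chi>]])
    then have "f w = 0 w" if "w \<in> W \<chi>" for w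
      using lin_on_eq_on_span[OF r.vector_space_axioms M.vector_space_axioms D.N_lin[OF \<chi> f(1)]
          D.N_lin[OF \<chi>, of 0] r.W, of B w] B(3) f(2) that r.span_superset[of B] by simp
    then show "f = 0" using D.N_outside[OF \<chi> f(1)] by (auto simp: fun_eq_iff)
  qed
  show "irreducible_under (fscale sM) (N \<chi>) (va_modes VG (hom_modes YM))"
    unfolding irreducible_under_def
  proof (intro conjI allI impI)
    show "N \<chi> \<noteq> {0}" using N_nontrivial[OF \<chi>] by blast
    fix X assume X: "D.F.subspace X \<and> X \<subseteq> N \<chi> \<and> (\<forall>a\<in>va_modes VG (hom_modes YM). a ` X \<subseteq> X)"
    show "X = {0} \<or> X = N \<chi>"
    proof (rule disjCI)
      assume "X \<noteq> N \<chi>"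
      then obtain h where h: "h \<in> N \<chi>" "h \<notin> X" using X by blast
      have "f = 0" if f: "f \<in> X" for f
      proof (rule ccontr)
        assume "f \<noteq> 0"
        then obtain b where b: "b \<in> mode_sums YM VG" "(\<lambda>w. b (f w)) = h"
          using VG_dense[of "{\<chi>}" "\<lambda>_. f" "\<lambda>_. h"] \<chi> f h(1) X by auto
        have st: "hom_modes YM v n k \<in> X" if "v \<in> VG" "k \<in> X" for v n k
          using X that by (auto simp: va_modes_def)
        have "(\<lambda>w. b (f w)) \<in> X" by (rule VG_mode_sum_mem[OF b(1) _ st f]) (use X in auto)
        then show False using b(2) h(2) by simp
      qed
      then show "X = {0}" using X D.F.subspace_0 by blast
    qed
  qed
qed

text \<open>An isomorphism \<open>T\<close> commutes with sums of modes of fixed vectors. For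
  different characters, density gives such a sum that kills \<open>f\<close> and fixes the nonzero
  \<open>T f\<close>, which contradicts \<open>T 0 = 0\<close>.\<close>

theorem N_isomorphic_iff:
  assumes \<chi>: "\<chi> \<in> \<Lambda>" and \<psi>: "\<psi> \<in> \<Lambda>"
  shows "module_isomorphic VG (fscale sM) (N \<chi>) (hom_modes YM) (fscale sM) (N \<psi>) (hom_modes YM) \<longleftrightarrow> \<chi> = \<psi>"
proof
  assume "\<chi> = \<psi>"
  then show "module_isomorphic VG (fscale sM) (N \<chi>) (hom_modes YM) (fscale sM) (N \<psi>) (hom_modes YM)"
    unfolding module_isomorphic_def by (intro exI[of _ id]) (auto simp: lin_on_def)
next
  assume "module_isomorphic VG (fscale sM) (N \<chi>) (hom_modes YM) (fscale sM) (N \<psi>) (hom_modes YM)"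
  then obtain T where T: "lin_on (fscale sM) (N \<chi>) (fscale sM) (N \<psi>) T" "bij_betw T (N \<chi>) (N \<psi>)"
    "\<And>v n f. v \<in> VG \<Longrightarrow> f \<in> N \<chi> \<Longrightarrow> T (hom_modes YM v n f) = hom_modes YM v n (T f)"
    unfolding module_isomorphic_def by blast
  have N0: "0 \<in> N \<chi>" by (rule D.F.subspace_0[OF D.subspace_N[OF \<chi>]])
  have T0: "T 0 = 0" by (rule lin_on_zero[OF T(1) N0])
  have Tb: "T (\<lambda>w. b (f w)) = (\<lambda>w. b (T f w))" if b: "b \<in> mode_sums YM VG" and f: "f \<in> N \<chi>" for b f
    using b
  proof induction
    case zero
    then show ?case using T0 by (simp add: zero_fun_def)
  next
    case (add v a n)
    have mem: "hom_modes YM v n f \<in> N \<chi>" "(\<lambda>w. a (f w)) \<in> N \<chi>"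
      using N_stable[OF \<chi>] VG_mode_sum_mem[OF _ D.subspace_N[OF \<chi>] N_stable[OF \<chi>] f] add.hyps f by auto
    have "(\<lambda>w. YM v n (f w) + a (f w)) = hom_modes YM v n f + (\<lambda>w. a (f w))"
      by (simp add: hom_modes_def fun_eq_iff)
    then have "T (\<lambda>w. YM v n (f w) + a (f w)) = hom_modes YM v n (T f) + (\<lambda>w. a (T f w))"
      using lin_on_add[OF T(1) mem] T(3)[OF add.hyps(1) f] add.IH by simp
    then show ?case by (simp add: hom_modes_def fun_eq_iff)
  qed
  obtain f where f: "f \<in> N \<chi>" "f \<noteq> 0" using N_nontrivial[OF \<chi>] by blast
  have h: "T f \<in> N \<psi>" "T f \<noteq> 0"
    using lin_on_mem[OF T(1) f(1)] T(2) f N0 T0 by (auto simp: bij_betw_def inj_on_def)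
  show "\<chi> = \<psi>"
  proof (rule ccontr)
    assume "\<chi> \<noteq> \<psi>"
    let ?k = "\<lambda>\<kappa>. if \<kappa> = \<chi> then f else T f" and ?h = "\<lambda>\<kappa>. if \<kappa> = \<chi> then 0 else T f"
    have "\<exists>b\<in>mode_sums YM VG. \<forall>\<kappa>\<in>{\<chi>, \<psi>}. (\<lambda>w. b (?k \<kappa> w)) = ?h \<kappa>"
      by (rule VG_dense) (use \<chi> \<psi> f h N0 \<open>\<chi> \<noteq> \<psi>\<close> in auto)
    then obtain b where b: "b \<in> mode_sums YM VG" "(\<lambda>w. b (f w)) = 0" "(\<lambda>w. b (T f w)) = T f"
      using \<open>\<chi> \<noteq> \<psi>\<close> by auto
    then show False using Tb[OF b(1) f(1)] T0 h(2) by simp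
  qed
qed

lemma tga_rep_YM: "v \<in> VG \<Longrightarrow> P.tga_rep a (YM v n w) = YM v n (P.tga_rep a w)"
  by (simp add: P.tga_rep_def YM_sum \<phi>_YM_VG)

lemma tga_va_module_M: "tga_va_module G \<alpha> sV VG vac Y sM UNIV (tga_action G sM \<phi>) YM"
  unfolding tga_va_module_def D.tga_action_eq
  using P.tga_module_rep VG_module tga_rep_YM by blast

lemma \<Theta>_isomorphism:
  "tga_va_isomorphism G VG (fscale (fscale (*))) (direct_sum \<Lambda> (\<lambda>\<chi>. tensor sW (W \<chi>) (fscale sM) (N \<chi>)))
    (sum_tga_action sW W \<rho> (fscale sM) N) (sum_modes sW W (fscale sM) N (hom_modes YM))
    sM UNIV (tga_action G sM \<phi>) YM D.\<Theta>"
  unfolding tga_va_isomorphism_def D.tga_action_eq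
proof (intro conjI ballI allI D.\<Theta>_lin D.\<Theta>_bij)
  fix a t assume a: "a \<in> tga_carrier G" and t: "t \<in> D.DS"
  show "D.\<Theta> (sum_tga_action sW W \<rho> (fscale sM) N a t) = P.tga_rep a (D.\<Theta> t)"
    unfolding sum_tga_action_def
  proof (rule D.\<Theta>_tensor_map[OF _ _ P.tga_rep_lin _ t])
    fix \<chi> assume \<chi>: "\<chi> \<in> \<Lambda>"
    interpret r: tga_module G \<alpha> sW "W \<chi>" "\<rho> \<chi>" by (rule D.tga_W[OF \<chi>])
    show "lin_on sW (W \<chi>) sW (W \<chi>) (\<rho> \<chi> a)" using r.action_bilinear a by (simp add: bilin_on_def)
    show "id f (\<rho> \<chi> a w) = P.tga_rep a (f w)" if "w \<in> W \<chi>" "f \<in> N \<chi>" for w f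
      using that(2) that(1) a unfolding D.N[OF \<chi>] tga_hom_def D.tga_action_eq by simp
  qed (auto simp: lin_on_def)
next
  fix v n t assume v: "v \<in> VG" and t: "t \<in> D.DS"
  show "D.\<Theta> (sum_modes sW W (fscale sM) N (hom_modes YM) v n t) = YM v n (D.\<Theta> t)"
    unfolding sum_modes_def
  proof (rule D.\<Theta>_tensor_map[OF _ _ lin_YM _ t])
    fix \<chi> assume \<chi>: "\<chi> \<in> \<Lambda>"
    show "lin_on (fscale sM) (N \<chi>) (fscale sM) (N \<chi>) (hom_modes YM v n)"
      using N_stable[OF \<chi> v] by (auto simp: lin_on_def hom_modes_def fscale_def)
  qed (auto simp: lin_on_def hom_modes_def)
qed

end

theorem theorem6p7:
  fixes sV :: "complex \<Rightarrow> 'v::ab_group_add \<Rightarrow> 'v" and vac :: 'v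
    and Y :: "'v \<Rightarrow> int \<Rightarrow> 'v \<Rightarrow> 'v"
    and G :: "('v \<Rightarrow> 'v) set" and \<sigma> :: "'v \<Rightarrow> 'v"
    and sM :: "complex \<Rightarrow> 'm::ab_group_add \<Rightarrow> 'm" and YM :: "'v \<Rightarrow> rat \<Rightarrow> 'm \<Rightarrow> 'm"
    and \<phi> :: "('v \<Rightarrow> 'v) \<Rightarrow> 'm \<Rightarrow> 'm"
    and \<alpha> :: "('v \<Rightarrow> 'v) \<Rightarrow> ('v \<Rightarrow> 'v) \<Rightarrow> complex"
    and \<Lambda> :: "('v tga \<Rightarrow> complex) set"
    and sW :: "complex \<Rightarrow> 'w::ab_group_add \<Rightarrow> 'w"
    and W :: "('v tga \<Rightarrow> complex) \<Rightarrow> 'w set"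
    and \<rho> :: "('v tga \<Rightarrow> complex) \<Rightarrow> 'v tga \<Rightarrow> 'w \<Rightarrow> 'w"
    and N :: "('v tga \<Rightarrow> complex) \<Rightarrow> ('w \<Rightarrow> 'm) set"
  assumes V: "simple_vertex_algebra sV UNIV vac Y" "countable_dim sV UNIV"
    and G: "finite_automorphism_group sV vac Y G"
    and \<sigma>: "\<sigma> \<in> G" "\<forall>g\<in>G. \<sigma> \<circ> g = g \<circ> \<sigma>"
    and M: "irreducible_twisted_module sV UNIV vac Y \<sigma> sM UNIV YM" "G_stable sM YM G"
    and \<phi>: "stabilizing_isos sM YM G \<phi>"
    and \<alpha>: "\<alpha> = schur_cocycle sM \<phi>"
    and \<Lambda>: "\<Lambda> = irreducible_characters G \<alpha>"
    and W: "\<forall>\<chi>\<in>\<Lambda>. simple_tga_module G \<alpha> sW (W \<chi>) (\<rho> \<chi>) \<and>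
      tga_character G sW (W \<chi>) (\<rho> \<chi>) = \<chi>"
    and N: "\<forall>\<chi>\<in>\<Lambda>. N \<chi> = tga_hom G sW (W \<chi>) (\<rho> \<chi>) sM UNIV (tga_action G sM \<phi>)"
  shows "tga_va_module G \<alpha> sV (fixed_points G) vac Y sM UNIV (tga_action G sM \<phi>) YM \<and>
    (\<exists>\<Theta>. tga_va_isomorphism G (fixed_points G)
        (fscale (fscale (*))) (direct_sum \<Lambda> (\<lambda>\<chi>. tensor sW (W \<chi>) (fscale sM) (N \<chi>)))
        (sum_tga_action sW W \<rho> (fscale sM) N) (sum_modes sW W (fscale sM) N (hom_modes YM))
        sM UNIV (tga_action G sM \<phi>) YM \<Theta> \<and>
      (\<forall>\<chi>\<in>\<Lambda>. \<forall>w\<in>W \<chi>. \<forall>f\<in>N \<chi>.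
        \<Theta> (summand \<chi> (pure_tensor sW (W \<chi>) (fscale sM) (N \<chi>) w f)) = f w)) \<and>
    (\<forall>\<chi>\<in>\<Lambda>. N \<chi> \<noteq> {0}) \<and>
    (\<forall>\<chi>\<in>\<Lambda>. irreducible_va_module sV (fixed_points G) vac Y (fscale sM) (N \<chi>) (hom_modes YM)) \<and>
    (\<forall>\<chi>\<in>\<Lambda>. \<forall>\<psi>\<in>\<Lambda>.
      module_isomorphic (fixed_points G) (fscale sM) (N \<chi>) (hom_modes YM) (fscale sM) (N \<psi>) (hom_modes YM)
        \<longleftrightarrow> \<chi> = \<psi>)"
proof -
  have va: "twisted_module sV UNIV vac Y \<sigma> sM UNIV YM"
    and irr: "irreducible_under sM UNIV (va_modes UNIV YM)"
    and simple: "irreducible_under sV UNIV (va_modes UNIV Y)"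
    using M(1) V(1) by (auto simp: irreducible_twisted_module_def simple_vertex_algebra_def)
  interpret full_twisted_module sV vac Y \<sigma> sM YM
    unfolding full_twisted_module_def by (rule va)
  interpret orbifold sV vac Y \<sigma> sM YM G \<phi>
    by unfold_locales (use irr V(2) simple G \<sigma>(1) \<phi> in auto)
  have \<Lambda>': "\<Lambda> = irreducible_characters G (schur_cocycle sM \<phi>)"
    and W': "\<And>\<chi>. \<chi> \<in> \<Lambda> \<Longrightarrow> simple_tga_module G (schur_cocycle sM \<phi>) sW (W \<chi>) (\<rho> \<chi>)"
    using \<Lambda> W \<alpha> by auto
  \<comment> \<open>Independence of the operators \<open>\<phi> g\<close> is what provides the
    assumption \<open>faithful\<close>.\<close>
  interpret dual_pair sV vac Y \<sigma> sM YM G \<phi> \<Lambda> sW W \<rho> N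
    by unfold_locales (use \<phi>_independent \<Lambda>' W' W N in auto)
  show ?thesis
    unfolding \<alpha>
  proof (intro conjI exI ballI)
    show "tga_va_module G (schur_cocycle sM \<phi>) sV (fixed_points G) vac Y sM UNIV (tga_action G sM \<phi>) YM"
      by (rule tga_va_module_M)
    show "tga_va_isomorphism G (fixed_points G)
        (fscale (fscale (*))) (direct_sum \<Lambda> (\<lambda>\<chi>. tensor sW (W \<chi>) (fscale sM) (N \<chi>)))
        (sum_tga_action sW W \<rho> (fscale sM) N) (sum_modes sW W (fscale sM) N (hom_modes YM))
        sM UNIV (tga_action G sM \<phi>) YM D.\<Theta>"
      by (rule \<Theta>_isomorphism)
    show "N \<chi> \<noteq> {0}" if "\<chi> \<in> \<Lambda>" for \<chi> using N_nontrivial[OF that] by blast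
  qed (use D.\<Theta>_summand N_irreducible N_isomorphic_iff in auto)
qed

end
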